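(* Let $F\in\mathcal S(\Sigma)$. The following conditions are equivalent. (1) $\rho(F)$ is finite; (2) for every $h\ge0$ and every $p\in[1,\infty]$, $\limsup_{j\to\infty}\big\|\mathcal A^h\,L^j\mathcal G^{-1}F\big\|_{L^p(H_n)}^{1/j}$ is finite; (3) there exists $p\in[1,\infty]$ such that $\liminf_{j\to\infty}\big\|L^j\mathcal G^{-1}F\big\|_{L^p(H_n)}^{1/j}$ is finite. Moreover, if any of these conditions is satisfied, then for every $h\ge0$ and every $p\in[1,\infty]$, $$\lim_{j\to\infty}\big\|(1+\mathcal A)^h\,L^j\mathcal G^{-1}F\big\|_{L^p(H_n)}^{1/j}=\rho(F).$$
   Context: Let $n\ge 1$. The Heisenberg group is $H_n=\mathbb C^n\times\mathbb R$ with product $(z,t)(w,u)=(z+w,\,t+u+\tfrac12\operatorname{Im}\langle w|z\rangle)$, $\langle w|z\rangle=\sum_j w_j\bar z_j$, so $(z,t)^{-1}=(-z,-t)$; Lebesgue measure $dz\,dt$ is a Haar measure and $L^p(H_n)$ is taken with respect to it. Put $\mathcal A(z,t)=\frac{|z|^2}{4}+it$; powers of $\mathcal A$ and $1+\mathcal A$ are principal powers (only their modulus matters in norms). Sublaplacian: $L=-2\sum_{j=1}^n(Z_j\bar Z_j+\bar Z_jZ_j)$ with $Z_j=\partial_{z_j}-\frac i4\bar z_j\partial_t$, $\bar Z_j=\partial_{\bar z_j}+\frac i4z_j\partial_t$. A function on $H_n$ is radial if invariant under $(z,t)\mapsto(kz,t)$, $k\in U(n)$. $\mathcal S_{\mathrm{rad}}(H_n)$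 is the space of radial Schwartz functions. Spherical functions: for $(\xi,\lambda)\in\mathbb C^2$, $$\Phi_{\xi,\lambda}(z,t)=e^{i\lambda t}e^{-\lambda|z|^2/4}\Big(1+\sum_{k\ge1}\frac{|z|^{2k}}{(n)_k\,k!\,4^k}\prod_{d=0}^{k-1}\big(\lambda(2d+n)-\xi\big)\Big),\qquad (n)_k=n(n+1)\cdots(n+k-1).$$ Heisenberg fan: $\Sigma=\{(\xi,\lambda)\in\mathbb R^2:\lambda\neq0,\ \xi=|\lambda|(2j+n),\ j\in\mathbb N\}\cup\{(\xi,0):\xi\ge0\}$, with $0\in\mathbb N$. Plancherel measure $\mu$ on $\Sigma$: $\int_\Sigma\psi\,d\mu=\frac1{(2\pi)^{n+1}}\int_{\mathbb R}\sum_{j\ge0}\binom{j+n-1}{j}\psi(|\lambda|(2j+n),\lambda)|\lambda|^n\,d\lambda$. $\mathcal S(\Sigma)$ is the space of restrictions to $\Sigma$ of functions in $\mathcal S(\mathbb R^2)$. For $f\in\mathcal S_{\mathrm{rad}}(H_n)$, $\mathcal Gf(\xi,\lambda)=\int_{H_n}f(x)\Phi_{\xi,\lambda}(x^{-1})\,dx$ on $\Sigma$; it is known that $\mathcal G:\mathcal S_{\mathrm{rad}}(H_n)\to\mathcal S(\Sigma)$ is a bijection with $\mathcal G^{-1}F(x)=\int_\Sigma F\,\Phi_{\xi,\lambda}(x)\,d\mu(\xi,\lambda)$. For $F\in\mathcal S(\Sigma)$, $\rho(F)=\sup\{\xi:F(\xi,\lambda)\ne0,\ (\xi,\lambda)\in\Sigma\}\in[0,\infty]$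 ($0$ if $F=0$). *)

theory Defs
  imports "HOL-Analysis.Analysis" "HOL-Probability.Essential_Supremum"
begin

text \<open>
  The Heisenberg group is modelled on \<open>complex ^ 'n \<times> real\<close>, with \<open>n = CARD('n)\<close>.
  Its Haar measure is \<^term>\<open>lborel\<close> on this Euclidean space; the group law itself is
  not needed to state the results, since the sublaplacian is given explicitly in coordinates.
\<close>

type_synonym 'n heis = "(complex ^ 'n) \<times> real"

definition dir_deriv :: "'a::real_normed_vector \<Rightarrow> ('a \<Rightarrow> 'b::real_normed_vector) \<Rightarrow> 'a \<Rightarrow> 'b" where
  "dir_deriv v f x = vector_derivative (\<lambda>s. f (x + s *\<^sub>R v)) (at 0)"

text \<open>
  Schwartz functions: every iterated partial derivative exists, is (totally) differentiable,
  and decays faster than any power. Total differentiability of all iterated partial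
  derivatives is the same as being \<open>C\<^sup>\<infinity>\<close>.
\<close>

definition schwartz :: "('a::euclidean_space \<Rightarrow> complex) \<Rightarrow> bool" where
  "schwartz f \<longleftrightarrow> (\<forall>vs\<in>lists Basis.
     (\<forall>x. foldr dir_deriv vs f differentiable (at x)) \<and>
     (\<forall>k::nat. bounded (range (\<lambda>x. (1 + norm x) ^ k *\<^sub>R foldr dir_deriv vs f x))))"

text \<open>\<open>\<partial>/\<partial>z\<^sub>j = (\<partial>/\<partial>x\<^sub>j - i \<partial>/\<partial>y\<^sub>j)/2\<close> and its conjugate, where \<open>z\<^sub>j = x\<^sub>j + i y\<^sub>j\<close>.\<close>

definition d_z :: "'n::finite \<Rightarrow> ('n heis \<Rightarrow> complex) \<Rightarrow> 'n heis \<Rightarrow> complex" where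
  "d_z j f x = (dir_deriv (axis j 1, 0) f x - \<i> * dir_deriv (axis j \<i>, 0) f x) / 2"

definition d_zbar :: "'n::finite \<Rightarrow> ('n heis \<Rightarrow> complex) \<Rightarrow> 'n heis \<Rightarrow> complex" where
  "d_zbar j f x = (dir_deriv (axis j 1, 0) f x + \<i> * dir_deriv (axis j \<i>, 0) f x) / 2"

definition d_t :: "('n::finite heis \<Rightarrow> complex) \<Rightarrow> 'n heis \<Rightarrow> complex" where
  "d_t f x = dir_deriv (0, 1) f x"

definition Z_field :: "'n::finite \<Rightarrow> ('n heis \<Rightarrow> complex) \<Rightarrow> 'n heis \<Rightarrow> complex" where
  "Z_field j f x = d_z j f x - \<i> / 4 * cnj (fst x $ j) * d_t f x"

definition Zbar_field :: "'n::finite \<Rightarrow> ('n heis \<Rightarrow> complex) \<Rightarrow> 'n heis \<Rightarrow> complex" where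
  "Zbar_field j f x = d_zbar j f x + \<i> / 4 * (fst x $ j) * d_t f x"

definition sublaplacian :: "('n::finite heis \<Rightarrow> complex) \<Rightarrow> 'n heis \<Rightarrow> complex" where
  "sublaplacian f x =
     - 2 * (\<Sum>j\<in>UNIV. Z_field j (Zbar_field j f) x + Zbar_field j (Z_field j f) x)"

definition heis_A :: "'n::finite heis \<Rightarrow> complex" where
  "heis_A x = complex_of_real ((norm (fst x))\<^sup>2 / 4) + \<i> * complex_of_real (snd x)"

definition spherical :: "complex \<Rightarrow> complex \<Rightarrow> 'n::finite heis \<Rightarrow> complex" where
  "spherical \<xi> l x =
     exp (\<i> * l * of_real (snd x)) * exp (- l * of_real ((norm (fst x))\<^sup>2) / 4) *
     (1 + (\<Sum>k. let m = Suc k in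
        of_real ((norm (fst x)) ^ (2 * m)) / (pochhammer (of_nat CARD('n)) m * fact m * 4 ^ m) *
        (\<Prod>d<m. l * of_nat (2 * d + CARD('n)) - \<xi>)))"

definition fan :: "nat \<Rightarrow> (real \<times> real) set" where
  "fan n = {(\<xi>, l). l \<noteq> 0 \<and> (\<exists>j::nat. \<xi> = \<bar>l\<bar> * real (2 * j + n))} \<union> {(\<xi>, l). l = 0 \<and> \<xi> \<ge> 0}"

text \<open>
  The Plancherel measure, as a Borel measure on the plane carried by the fan: the image of
  the measure with density \<open>(2 \<pi>)\<^sup>-\<^sup>(\<^sup>n\<^sup>+\<^sup>1\<^sup>) binom(j+n-1, j) |\<lambda>|\<^sup>n\<close> on pairs \<open>(j, \<lambda>)\<close>
  under \<open>(j, \<lambda>) \<mapsto> (|\<lambda>| (2j+n), \<lambda>)\<close>.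
\<close>

definition plancherel :: "nat \<Rightarrow> (real \<times> real) measure" where
  "plancherel n =
     distr
       (density (count_space (UNIV :: nat set) \<Otimes>\<^sub>M lborel)
         (\<lambda>(j, l). ennreal (real ((j + n - 1) choose j) * \<bar>l\<bar> ^ n / (2 * pi) ^ (n + 1))))
       borel
       (\<lambda>(j, l). (\<bar>l\<bar> * real (2 * j + n), l))"

text \<open>
  Functions on the fan are represented by functions on the plane whose values off the fan are
  irrelevant.
\<close>

definition schwartz_fan :: "nat \<Rightarrow> (real \<times> real \<Rightarrow> complex) \<Rightarrow> bool" where
  "schwartz_fan n F \<longleftrightarrow> (\<exists>f. schwartz f \<and> (\<forall>p\<in>fan n. F p = f p))"

text \<open>
  The inverse of the spherical (Gelfand) transform
  \<open>f \<mapsto> (\<lambda>(\<xi>, \<lambda>). \<integral> f(x) \<Phi>\<^bsub>\<xi>,\<lambda>\<^esub>(x\<^sup>-\<^sup>1) dx)\<close> from radial Schwartz functions onto Schwartz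
  functions on the fan, given by the inversion formula.
\<close>

definition inv_gelfand :: "(real \<times> real \<Rightarrow> complex) \<Rightarrow> 'n::finite heis \<Rightarrow> complex" where
  "inv_gelfand F x =
     (LINT p:fan CARD('n)|plancherel CARD('n).
        F p * spherical (of_real (fst p)) (of_real (snd p)) x)"

text \<open>The supremum is taken in \<open>[0,\<infinity>]\<close>, where \<open>Sup {} = 0\<close>; on the fan \<open>\<xi> \<ge> 0\<close>.\<close>

definition rho :: "nat \<Rightarrow> (real \<times> real \<Rightarrow> complex) \<Rightarrow> ennreal" where
  "rho n F = (SUP p\<in>{p \<in> fan n. F p \<noteq> 0}. ennreal (fst p))"

text \<open>Powers in \<open>[0,\<infinity>]\<close> with nonnegative exponents.\<close>

definition ennpowr :: "ennreal \<Rightarrow> real \<Rightarrow> ennreal" where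
  "ennpowr a r = (if a = \<infinity> then \<infinity> else ennreal (enn2real a powr r))"

text \<open>The \<open>L\<^sup>p\<close> norm with values in \<open>[0,\<infinity>]\<close>, for \<open>1 \<le> p \<le> \<infinity>\<close>.\<close>

definition Lp_norm :: "ennreal \<Rightarrow> ('n::finite heis \<Rightarrow> complex) \<Rightarrow> ennreal" where
  "Lp_norm p f =
     (if p = \<infinity> then esssup lborel (\<lambda>x. ennreal (cmod (f x)))
      else ennpowr (\<integral>\<^sup>+ x. ennreal (cmod (f x) powr enn2real p) \<partial>lborel) (1 / enn2real p))"

end

theory Submission
  imports Defs "HOL-Probability.Probability" "HOL-Real_Asymp.Real_Asymp"
begin

text \<open>
  By the inversion formula \<open>\<G>\<^sup>-\<^sup>1 F\<close> is a superposition of the waves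
  \<open>exp(i\<lambda>t) exp(-|\<lambda>||z|\<^sup>2/4) L\<^sub>j(|\<lambda>||z|\<^sup>2/2)\<close>, \<open>L\<^sub>j\<close> a Laguerre polynomial of order
  \<open>n-1\<close>, on which \<open>L\<close> acts as multiplication by \<open>\<xi> = |\<lambda>|(2j+n)\<close>.

  For the upper bound, multiplication by \<open>\<A>\<close> is turned, by integration by parts in \<open>\<lambda>\<close> and summation by
  parts in \<open>j\<close>, into an operator on the coefficients that costs two derivatives of the extension of \<open>F\<close>.
  Applied \<open>k\<close> times to \<open>\<xi>\<^sup>J F\<close>, with \<open>F\<close> cut off beyond \<open>R > \<rho>(F)\<close>, it gives
  \<open>(1 + |\<A>|)\<^sup>k |L\<^sup>J \<G>\<^sup>-\<^sup>1 F| \<le> C (1 + J/R)\<^sup>2\<^sup>k R\<^sup>J\<close>; the polynomial factor disappears in the \<open>J\<close>-th root, and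
  sufficiently large \<open>k\<close> makes the weight integrable.

  For the lower bound, if \<open>F(\<xi>\<^sub>0, \<lambda>\<^sub>0) \<noteq> 0\<close> then, by continuity, \<open>F\<close> is bounded away from \<open>0\<close> on a short piece
  of a single ray where \<open>\<xi> > r\<close>. Pairing \<open>L\<^sup>J \<G>\<^sup>-\<^sup>1 F\<close> with a fixed bounded integrable function whose
  transform is carried by this piece yields \<open>\<parallel>L\<^sup>J \<G>\<^sup>-\<^sup>1 F\<parallel>\<^sub>p \<ge> c r\<^sup>J\<close> for all \<open>p\<close> at once.
\<close>

section \<open>Laguerre functions\<close>

text \<open>Passing to a neighbouring Laguerre index is, at fixed \<lambda>, a displacement of \<xi>
  by 2|\<lambda>|. Multiplication by \<A> therefore produces differences of f between neighbouring
  rays, weighted by j, which is of the order of \<xi>/|\<lambda>|, and divided by \<lambda>. Once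
  the first-order term is subtracted, such a difference is O(\<lambda>^2), and Taylor's formula with
  integral remainder absorbs both factors: no singularity is left at \<lambda> = 0. The price is
  that the remainder uses the values of f in the gaps between the rays. Hence everything is done for
  functions on the plane, and the extension of F must be controlled off the fan as well. The second
  obstacle is the point \<lambda> = 0 itself. Below a fixed \<xi> the number of rays tends to
  infinity as \<lambda> tends to 0, the sum over the rays need not vanish in the limit, and the
  integration by parts must be done on both half-lines separately, with a uniform estimate of the
  jump between them.\<close>

lemma power_le_exp: "x ^ N / fact N \<le> exp x" if "0 \<le> x" for x :: real
proof -
  have "sum (\<lambda>i. x ^ i /\<^sub>R fact i) {N} \<le> (\<Sum>i. x ^ i /\<^sub>R fact i)"
    using that by (intro sum_le_suminf summable_exp_generic) auto
  then show ?thesis by (simp add: exp_def divide_inverse mult.commute)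
qed

text \<open>The Laguerre polynomial of degree j and order a. Its usual coefficient binom(j+a, j-i)
  is written binom(j+a, i+a), which vanishes for i > j, so that sums of different degrees can be
  brought to a common range.\<close>

definition lag :: "nat \<Rightarrow> nat \<Rightarrow> real \<Rightarrow> real" where
  "lag a j s = (\<Sum>i\<le>j. (- 1) ^ i * real ((j + a) choose (i + a)) / fact i * s ^ i)"

lemma lag_extend: "j \<le> N \<Longrightarrow> lag a j s = (\<Sum>i\<le>N. (- 1) ^ i * real ((j + a) choose (i + a)) / fact i * s ^ i)"
  unfolding lag_def by (rule sum.mono_neutral_left) auto

lemma lag_0 [simp]: "lag a 0 s = 1"
  by (simp add: lag_def)

text \<open>Pascal's rule, coefficient by coefficient.\<close>

lemma lag_Suc_Suc: "lag (Suc a) (Suc j) s = lag (Suc a) j s + lag a (Suc j) s"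
proof -
  have "lag (Suc a) j s + lag a (Suc j) s =
     (\<Sum>i\<le>Suc j. (- 1) ^ i * real ((j + Suc a) choose (i + Suc a)) / fact i * s ^ i)
   + (\<Sum>i\<le>Suc j. (- 1) ^ i * real ((Suc j + a) choose (i + a)) / fact i * s ^ i)"
    by (subst lag_extend[of j "Suc j"]) (auto simp: lag_def)
  also have "\<dots> = lag (Suc a) (Suc j) s"
    unfolding lag_def sum.distrib[symmetric]
    by (rule sum.cong) (simp_all add: distrib_left distrib_right add_divide_distrib)
  finally show ?thesis by simp
qed

lemma choose_absorb_diff:
  "real (Suc j) * real (Suc (j + a) choose (i + a)) = real (j + a + 1) * real ((j + a) choose (i + a))
     + real i * real (Suc (j + a) choose (i + a))"
proof (cases "i \<le> Suc j")
  case True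
  have "(Suc (j+a) - (i+a)) * (Suc (j+a) choose (i+a)) = Suc (j+a) * ((j+a) choose (i+a))"
    using binomial_absorb_comp[of "Suc (j+a)" "i+a"] unfolding diff_Suc_1 .
  moreover have "Suc (j+a) - (i+a) = Suc j - i" by simp
  ultimately have "real (Suc j - i) * real (Suc (j+a) choose (i+a)) = real (Suc (j+a)) * real ((j+a) choose (i+a))"
    by (metis of_nat_mult)
  then show ?thesis using True by (simp add: of_nat_diff algebra_simps)
qed (simp add: binomial_eq_0)

text \<open>The derivative of a Laguerre polynomial has a higher order; this relation returns to the
  original order. Together they turn s d/ds into a shift of j.\<close>

lemma lag_mult:
  "s * lag (Suc a) j s = real (j + a + 1) * lag a j s - real (Suc j) * lag a (Suc j) s"
proof -
  define c where "c i = (- 1) ^ i / fact i * s ^ i" for i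
  have "real (j + a + 1) * lag a j s - real (Suc j) * lag a (Suc j) s =
     real (j + a + 1) * (\<Sum>i\<le>Suc j. c i * real ((j + a) choose (i + a)))
      - real (Suc j) * (\<Sum>i\<le>Suc j. c i * real ((Suc j + a) choose (i + a)))"
    by (subst lag_extend[of j "Suc j"]) (simp_all add: lag_def c_def mult_ac del: sum.atMost_Suc of_nat_Suc)
  also have "\<dots> = (\<Sum>i\<le>Suc j. c i * (real (j + a + 1) * real ((j + a) choose (i + a)) -
         real (Suc j) * real (Suc (j + a) choose (i + a))))"
    by (simp add: sum_distrib_left sum_subtractf algebra_simps del: sum.atMost_Suc)
  also have "\<dots> = (\<Sum>i\<le>Suc j. - c i * real i * real (Suc (j + a) choose (i + a)))"
    by (intro sum.cong refl) (simp add: choose_absorb_diff del: of_nat_Suc)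
  also have "\<dots> = (\<Sum>i\<le>j. - c (Suc i) * real (Suc i) * real (Suc (j + a) choose (Suc i + a)))"
    by (subst sum.atMost_Suc_shift) simp
  also have "\<dots> = (\<Sum>i\<le>j. s * ((- 1) ^ i * real ((j + Suc a) choose (i + Suc a)) / fact i * s ^ i))"
    by (intro sum.cong refl) (simp add: c_def fact_Suc divide_simps del: of_nat_Suc)
  finally show ?thesis by (simp add: lag_def sum_distrib_left)
qed

lemma lag_deriv:
  "(lag a j has_real_derivative (if j = 0 then 0 else - lag (Suc a) (j - 1) s)) (at s)"
proof (cases j)
  case 0
  then have "lag a j = (\<lambda>_. 1)" by auto
  then show ?thesis using 0 by simp
next
  case (Suc k)
  have "(lag a j has_real_derivative (\<Sum>i\<le>j. (- 1) ^ i * real ((j + a) choose (i + a)) / fact i * (real i * s ^ (i - 1)))) (at s)"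
    unfolding lag_def by (auto intro!: derivative_eq_intros sum.cong)
  also have "(\<Sum>i\<le>j. (- 1) ^ i * real ((j + a) choose (i + a)) / fact i * (real i * s ^ (i - 1)))
     = (\<Sum>i\<le>k. (- 1) ^ Suc i * real ((Suc k + a) choose (Suc i + a)) / fact (Suc i) * (real (Suc i) * s ^ i))"
    unfolding Suc by (subst sum.atMost_Suc_shift) simp
  also have "\<dots> = - lag (Suc a) k s"
    unfolding lag_def sum_negf[symmetric]
    by (intro sum.cong refl) (simp add: fact_Suc divide_simps del: of_nat_Suc)
  finally show ?thesis using Suc by simp
qed

text \<open>Charlier polynomials; their norm in the Poisson weight \<open>s ^ m / m!\<close> bounds the value
  on the diagonal \<open>m = n\<close>, which is a Laguerre polynomial in \<open>s\<close>.\<close>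

fun charlier :: "real \<Rightarrow> nat \<Rightarrow> nat \<Rightarrow> real" where
  "charlier s 0 m = 1"
| "charlier s (Suc n) m = real m * charlier s n (m - 1) - s * charlier s n m"

text \<open>On these monic polynomials in m the forward difference acts as d/dm acts on powers. It
  serves to undo a shift of m in the computation of the norm.\<close>

lemma charlier_diff: "charlier s n (Suc m) - charlier s n m = real n * charlier s (n - 1) m"
proof (induction n arbitrary: m)
  case (Suc n)
  show ?case
  proof (cases m)
    case 0
    have "charlier s n 1 = charlier s n 0 + real n * charlier s (n - 1) 0"
      using Suc.IH[of 0] by simp
    have 3: "real n * charlier s n 0 = - (real n * s * charlier s (n - 1) 0)"
      by (cases n) simp_all
    have "charlier s (Suc n) (Suc m) - charlier s (Suc n) m = charlier s n 0 - s * (charlier s n 1 - charlier s n 0)"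
      using 0 by (simp add: algebra_simps)
    also have "\<dots> = charlier s n 0 + real n * charlier s n 0"
      unfolding 3 using \<open>charlier s n 1 = _\<close> by (simp add: algebra_simps)
    finally show ?thesis using 0 by (simp add: algebra_simps)
  next
    case (Suc k)
    have 1: "charlier s n (Suc m) = charlier s n m + real n * charlier s (n - 1) m"
      and 2: "charlier s n m = charlier s n k + real n * charlier s (n - 1) k"
      using Suc.IH[of m] Suc.IH[of k] Suc by (simp_all add: algebra_simps)
    have 3: "real n * charlier s n m = real n * (real m * charlier s (n - 1) k - s * charlier s (n - 1) m)"
      using Suc by (cases n) auto
    have "charlier s (Suc n) (Suc m) - charlier s (Suc n) m =
       charlier s n m + real m * (charlier s n m - charlier s n k) - s * (charlier s n (Suc m) - charlier s n m)"
      using Suc by (simp add: algebra_simps)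
    also have "\<dots> = charlier s n m + real n * charlier s n m"
      unfolding 3 using 1 2 by (simp add: algebra_simps)
    finally show ?thesis by (simp add: algebra_simps)
  qed
qed simp

lemma charlier_bound: "0 \<le> s \<Longrightarrow> \<bar>charlier s n m\<bar> \<le> (real m + s) ^ n"
proof (induction n arbitrary: m)
  case (Suc n)
  have "\<bar>charlier s n (m - 1)\<bar> \<le> (real m + s) ^ n"
    by (rule order_trans[OF Suc.IH]) (use Suc.prems in \<open>auto intro!: power_mono\<close>)
  then have "\<bar>real m * charlier s n (m - 1)\<bar> \<le> real m * (real m + s) ^ n"
    by (simp add: abs_mult mult_left_mono)
  moreover have "\<bar>s * charlier s n m\<bar> \<le> s * (real m + s) ^ n"
    using Suc by (simp add: abs_mult mult_left_mono)
  ultimately show ?case by (simp add: algebra_simps abs_le_iff)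
qed simp

lemma charlier_summable:
  assumes "0 \<le> s" shows "summable (\<lambda>m. s ^ m / fact m * (charlier s n m * charlier s k m))"
proof (rule summable_comparison_test')
  have pe: "x ^ N / fact N \<le> exp x" if "0 \<le> x" for x :: real and N
  proof -
    have "sum (\<lambda>i. x ^ i /\<^sub>R fact i) {N} \<le> (\<Sum>i. x ^ i /\<^sub>R fact i)"
      using that by (intro sum_le_suminf summable_exp_generic) auto
    then show ?thesis by (simp add: exp_def divide_inverse mult.commute)
  qed
  show "summable (\<lambda>m. fact (n + k) * exp s * ((s * exp 1) ^ m / fact m))"
    using summable_exp[of "s * exp 1"] by (intro summable_mult) (simp add: divide_inverse mult.commute)
  fix m
  have "\<bar>charlier s n m\<bar> * \<bar>charlier s k m\<bar> \<le> (real m + s) ^ (n + k)"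
    unfolding power_add using assms by (intro mult_mono charlier_bound) auto
  also have "\<dots> \<le> fact (n + k) * exp (real m + s)"
    using pe[of "real m + s" "n + k"] assms by (simp add: field_simps)
  also have "exp (real m + s) = exp 1 ^ m * exp s"
    by (simp add: exp_add exp_of_nat_mult[of m 1, simplified])
  finally have "s ^ m / fact m * (\<bar>charlier s n m\<bar> * \<bar>charlier s k m\<bar>) \<le>
    s ^ m / fact m * (fact (n + k) * (exp 1 ^ m * exp s))"
    using assms by (intro mult_left_mono) auto
  then show "norm (s ^ m / fact m * (charlier s n m * charlier s k m)) \<le> fact (n + k) * exp s * ((s * exp 1) ^ m / fact m)"
    using assms by (simp add: abs_mult power_mult_distrib mult_ac)
qed

text \<open>With w the Poisson weight and d, c of degrees n and n+1, the sum of w(m) m d(m-1) c(m)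
  is computed twice: by the recursion for c, and, after shifting m, by the difference formula. The
  mixed terms coincide, and the norm of c is left as s(n+1) times the norm of d.\<close>

lemma charlier_norm:
  assumes "0 \<le> s"
  shows "(\<Sum>m. s ^ m / fact m * (charlier s n m)\<^sup>2) = s ^ n * fact n * exp s"
proof (induction n)
  case 0
  then show ?case by (simp add: exp_def divide_inverse mult.commute)
next
  case (Suc n)
  let ?w = "\<lambda>m. s ^ m / fact m"
  let ?c = "charlier s (Suc n)" and ?d = "charlier s n"
  let ?g = "\<lambda>m. ?w m * (real m * ?d (m - 1) * ?c m)"
  have sm1: "summable (\<lambda>m. ?w m * (?c m)\<^sup>2)" "summable (\<lambda>m. ?w m * (?c m * ?d m))"
    "summable (\<lambda>m. ?w m * (?d m * ?d m))"
    using charlier_summable[OF assms, of "Suc n" "Suc n"] charlier_summable[OF assms, of "Suc n" n]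
      charlier_summable[OF assms, of n n] by (auto simp: power2_eq_square simp del: charlier.simps)
  have g: "?g = (\<lambda>m. ?w m * (?c m)\<^sup>2 + s * (?w m * (?c m * ?d m)))"
    by (auto simp: power2_eq_square algebra_simps)
  have smg: "summable ?g" unfolding g by (intro summable_add summable_mult sm1)
  have gS: "?g (Suc m) = s * (?w m * (?d m * ?c (Suc m)))" for m
    by (simp add: fact_Suc divide_simps del: of_nat_Suc charlier.simps)
  have "suminf ?g = (\<Sum>m. ?g (Suc m))"
    using suminf_split_head[OF smg] by simp
  also have "\<dots> = (\<Sum>m. s * (?w m * (?c m * ?d m)) + s * real (Suc n) * (?w m * (?d m)\<^sup>2))"
  proof (intro arg_cong[where f = suminf] ext)
    fix m
    have "?c (Suc m) = ?c m + real (Suc n) * ?d m"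
      using charlier_diff[of s "Suc n" m] by simp
    then show "?g (Suc m) = s * (?w m * (?c m * ?d m)) + s * real (Suc n) * (?w m * (?d m)\<^sup>2)"
      unfolding gS by (simp add: algebra_simps power2_eq_square del: charlier.simps of_nat_Suc)
  qed
  also have "\<dots> = s * (\<Sum>m. ?w m * (?c m * ?d m)) + s * real (Suc n) * (\<Sum>m. ?w m * (?d m)\<^sup>2)"
    using sm1 unfolding power2_eq_square
    by (simp only: suminf_add[symmetric] suminf_mult summable_mult)
  finally have "suminf ?g = \<dots>" .
  moreover have "suminf ?g = (\<Sum>m. ?w m * (?c m)\<^sup>2) + s * (\<Sum>m. ?w m * (?c m * ?d m))"
    unfolding g using sm1 by (simp only: suminf_add[symmetric] suminf_mult summable_mult)
  ultimately show ?case using Suc.IH by (simp add: algebra_simps del: charlier.simps)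
qed

text \<open>Expansion in the falling factorials of m: one term of the recursion raises the order of
  the factorial, the other multiplies it by -s, and Pascal's rule collects them.\<close>

lemma charlier_explicit:
  "charlier s n m = (\<Sum>k\<le>n. real (n choose k) * (- s) ^ (n - k) * (fact k * real (m choose k)))"
proof (induction n arbitrary: m)
  case (Suc n)
  define u where "u k = (fact k * real (m choose k) :: real)" for k
  have u: "real m * (fact k * real ((m - 1) choose k)) = u (Suc k)" for k
  proof (cases m)
    case (Suc m')
    have "real (Suc k) * real (Suc m' choose Suc k) = real (Suc m') * real (m' choose k)"
      by (metis Suc_times_binomial_eq mult.commute of_nat_mult)
    then show ?thesis using Suc by (simp add: u_def fact_Suc algebra_simps del: of_nat_Suc binomial_Suc_Suc)
  qed (simp add: u_def)
  have "charlier s (Suc n) m = (\<Sum>k\<le>n. real (n choose k) * (- s) ^ (n - k) * u (Suc k))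
     + (\<Sum>k\<le>n. real (n choose k) * (- s) ^ (Suc n - k) * u k)"
    unfolding charlier.simps Suc.IH u[symmetric] sum_distrib_left minus_mult_left[symmetric] diff_conv_add_uminus sum_negf[symmetric]
    by (intro arg_cong2[where f = "(+)"] sum.cong refl) (auto simp: u_def Suc_diff_le)
  also have "(\<Sum>k\<le>n. real (n choose k) * (- s) ^ (Suc n - k) * u k) =
      (\<Sum>k\<le>Suc n. real (n choose k) * (- s) ^ (Suc n - k) * u k)" by simp
  also have "\<dots> = (- s) ^ Suc n * u 0 + (\<Sum>k\<le>n. real (n choose Suc k) * (- s) ^ (n - k) * u (Suc k))"
    by (subst sum.atMost_Suc_shift) simp
  also have "(\<Sum>k\<le>n. real (n choose k) * (- s) ^ (n - k) * u (Suc k)) + \<dots> =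
     (\<Sum>k\<le>Suc n. real (Suc n choose k) * (- s) ^ (Suc n - k) * u k)"
  proof -
    have "(\<Sum>k\<le>Suc n. real (Suc n choose k) * (- s) ^ (Suc n - k) * u k) =
       (- s) ^ Suc n * u 0 + (\<Sum>k\<le>n. real (Suc n choose Suc k) * (- s) ^ (n - k) * u (Suc k))"
      by (subst sum.atMost_Suc_shift) simp
    also have "(\<Sum>k\<le>n. real (Suc n choose Suc k) * (- s) ^ (n - k) * u (Suc k)) =
       (\<Sum>k\<le>n. real (n choose k) * (- s) ^ (n - k) * u (Suc k)) +
       (\<Sum>k\<le>n. real (n choose Suc k) * (- s) ^ (n - k) * u (Suc k))"
      unfolding sum.distrib[symmetric] by (intro sum.cong refl) (simp add: algebra_simps)
    finally show ?thesis by simp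
  qed
  finally show ?case by (simp add: u_def)
qed simp

lemma charlier_diag: "charlier s n n = fact n * lag 0 n s"
proof -
  have "charlier s n n = (\<Sum>k\<le>n. real (n choose (n - k)) * (- s) ^ (n - (n - k)) * (fact (n - k) * real (n choose (n - k))))"
    unfolding charlier_explicit
    by (rule sum.reindex_bij_witness[of _ "\<lambda>k. n - k" "\<lambda>k. n - k"]) auto
  also have "\<dots> = (\<Sum>k\<le>n. fact n * ((- 1) ^ k * real (n choose k) / fact k * s ^ k))"
  proof (rule sum.cong[OF refl])
    fix k assume "k \<in> {..n}"
    then have k: "k \<le> n" by simp
    have "fact k * fact (n - k) * (n choose k) = fact n" using binomial_fact_lemma[OF k] .
    then have "(fact k * fact (n - k) * real (n choose k)) = fact n" by (metis of_nat_fact of_nat_mult)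
    then have e: "fact (n - k) * real (n choose k) = fact n / fact k" by (simp add: field_simps)
    have "real (n choose (n - k)) * (- s) ^ (n - (n - k)) * (fact (n - k) * real (n choose (n - k)))
       = real (n choose k) * (- s) ^ k * (fact (n - k) * real (n choose k))"
      using k binomial_symmetric[OF k] by simp
    also have "\<dots> = fact n * ((- 1) ^ k * real (n choose k) / fact k * s ^ k)"
      unfolding e by (simp add: power_minus[of s] field_simps)
    finally show "real (n choose (n - k)) * (- s) ^ (n - (n - k)) * (fact (n - k) * real (n choose (n - k))) = \<dots>" .
  qed
  finally show ?thesis by (simp add: lag_def sum_distrib_left)
qed

lemma lag_0_bound:
  assumes "0 \<le> s" shows "(lag 0 n s)\<^sup>2 \<le> exp s"
proof (cases "s = 0")
  case True
  then show ?thesis by (simp add: lag_def sum.atMost_shift)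
next
  case False
  with assms have s: "s > 0" by simp
  let ?f = "\<lambda>m. s ^ m / fact m * (charlier s n m)\<^sup>2"
  have sm: "summable ?f" using charlier_summable[OF assms, of n n] by (simp add: power2_eq_square)
  have "sum ?f {n} \<le> suminf ?f" using s by (intro sum_le_suminf sm) auto
  then have "s ^ n / fact n * (fact n * lag 0 n s)\<^sup>2 \<le> s ^ n * fact n * exp s"
    unfolding charlier_norm[OF assms] by (simp add: charlier_diag)
  then have "(s ^ n * fact n) * (lag 0 n s)\<^sup>2 \<le> (s ^ n * fact n) * exp s"
    by (simp add: power2_eq_square field_simps)
  then show ?thesis using s by (subst (asm) mult_le_cancel_left_pos) auto
qed

section \<open>Laguerre functions, their derivatives and their differential equation\<close>

definition lagf :: "nat \<Rightarrow> nat \<Rightarrow> real \<Rightarrow> real" where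
  "lagf a j s = exp (- s / 2) * lag a j s"

text \<open>The right-hand side is the value at s = 0. Both sides obey the Pascal recursion in (a,
  j), so only order a = 0 needs the Charlier estimate.\<close>

lemma lagf_bound:
  assumes "0 \<le> s" shows "\<bar>lagf a j s\<bar> \<le> real ((j + a) choose j)"
proof (induction a arbitrary: j)
  case 0
  have "(lagf 0 j s)\<^sup>2 = exp (- s) * (lag 0 j s)\<^sup>2"
    by (simp add: lagf_def power_mult_distrib exp_double[symmetric])
  also have "\<dots> \<le> exp (- s) * exp s" by (intro mult_left_mono lag_0_bound assms) auto
  finally have "(lagf 0 j s)\<^sup>2 \<le> 1\<^sup>2" by (simp add: exp_minus)
  then show ?case by (simp add: abs_square_le_1)
next
  case (Suc a)
  show ?case
  proof (induction j)
    case 0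
    then show ?case using assms by (simp add: lagf_def)
  next
    case (Suc j)
    have "lagf (Suc a) (Suc j) s = lagf (Suc a) j s + lagf a (Suc j) s"
      by (simp add: lagf_def lag_Suc_Suc algebra_simps)
    then have "\<bar>lagf (Suc a) (Suc j) s\<bar> \<le> real ((j + Suc a) choose j) + real ((Suc j + a) choose Suc j)"
      using Suc.IH \<open>\<And>j. \<bar>lagf a j s\<bar> \<le> real ((j + a) choose j)\<close>[of "Suc j"] by linarith
    then show ?case by simp
  qed
qed

text \<open>The m-th derivative of \<open>lagf a j\<close>. The factor exp(-s/2) contributes -1/2,
  and the derivative of the polynomial is minus the one of order a+1 and degree j-1.\<close>

fun lagd :: "nat \<Rightarrow> nat \<Rightarrow> nat \<Rightarrow> real \<Rightarrow> real" where
  "lagd 0 a j s = lagf a j s"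
| "lagd (Suc m) a 0 s = - lagd m a 0 s / 2"
| "lagd (Suc m) a (Suc j) s = - lagd m a (Suc j) s / 2 - lagd m (Suc a) j s"

lemma lagd_deriv: "(lagd m a j has_real_derivative lagd (Suc m) a j s) (at s)"
proof (induction m arbitrary: a j)
  case 0
  have *: "lagd 0 a j = (\<lambda>s. exp (- s / 2) * lag a j s)" by (auto simp: lagf_def)
  show ?case unfolding *
    by (cases j; rule derivative_eq_intros lag_deriv refl | simp add: lagf_def algebra_simps)+
next
  case (Suc m)
  show ?case
  proof (cases j)
    case 0
    have *: "lagd (Suc m) a j = (\<lambda>s. - lagd m a 0 s / 2)" using 0 by auto
    show ?thesis unfolding * using 0 Suc.IH[of a 0]
      by (auto intro!: derivative_eq_intros)
  next
    case (Suc k)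
    have *: "lagd (Suc m) a j = (\<lambda>s. - lagd m a (Suc k) s / 2 - lagd m (Suc a) k s)" using Suc by auto
    show ?thesis unfolding * unfolding Suc lagd.simps(3)[of "Suc m"]
      by (auto intro!: derivative_eq_intros Suc.IH simp del: lagd.simps)
  qed
qed

text \<open>For a = n - 1 the factor is (2j+n)/2, so that |\<lambda>| times one derivative costs at
  most \<xi>/2. In the induction, going from (a, j) to (a+1, j-1) multiplies the binomial
  coefficient by j/(a+1), hence by at most j; the term with 1/2 fills up the rest of
  (2j+a+1)/2.\<close>

lemma lagd_bound:
  assumes "0 \<le> s"
  shows "\<bar>lagd m a j s\<bar> \<le> real ((j + a) choose j) * (real (2 * j + a + 1) / 2) ^ m"
proof (induction m arbitrary: a j)
  case 0
  then show ?case using lagf_bound[OF assms] by simp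
next
  case (Suc m)
  show ?case
  proof (cases j)
    case 0
    have "\<bar>lagd m a 0 s\<bar> / 2 \<le> (real (a + 1) / 2) ^ m * (1 / 2)"
      using Suc.IH[of a 0] by simp
    also have "\<dots> \<le> (real (a + 1) / 2) ^ m * (real (a + 1) / 2)"
      by (intro mult_left_mono) auto
    finally show ?thesis using 0 by (simp add: mult.commute)
  next
    case (Suc k)
    let ?b = "real ((j + a) choose j)" and ?q = "real (2 * j + a + 1) / 2"
    have b: "real ((k + Suc a) choose k) = ?b * (real j / real (a + 1))"
    proof -
      have "Suc k * (Suc (k + a) choose Suc k) = Suc (k + a) * ((k + a) choose k)"
        by (metis Suc_times_binomial_eq mult.commute)
      moreover have "Suc a * (Suc (k + a) choose Suc a) = Suc (k + a) * ((k + a) choose a)"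
        by (metis Suc_times_binomial_eq mult.commute)
      moreover have "(k + a) choose k = (k + a) choose a"
        using binomial_symmetric[of k "k + a"] by simp
      moreover have "Suc (k + a) choose Suc a = Suc (k + a) choose k"
        using binomial_symmetric[of k "Suc (k + a)"] by (simp add: Suc_diff_le)
      ultimately have "Suc a * ((k + Suc a) choose k) = j * ((j + a) choose j)"
        using Suc by simp
      then have "real (Suc a) * real ((k + Suc a) choose k) = real j * ?b"
        by (metis of_nat_mult)
      then show ?thesis by (simp add: field_simps)
    qed
    have "\<bar>lagd m (Suc a) k s\<bar> \<le> real ((k + Suc a) choose k) * (real (2 * k + Suc a + 1) / 2) ^ m"
      by (rule Suc.IH)
    also have "\<dots> \<le> real ((k + Suc a) choose k) * ?q ^ m"
      using Suc by (intro mult_left_mono power_mono) auto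
    also have "\<dots> = ?b * ?q ^ m * (real j / real (a + 1))" unfolding b by simp
    also have "\<dots> \<le> ?b * ?q ^ m * real j"
      by (intro mult_left_mono) (auto simp: divide_simps algebra_simps)
    finally have 1: "\<bar>lagd m (Suc a) k s\<bar> \<le> ?b * ?q ^ m * real j" .
    have 2: "\<bar>lagd m a j s\<bar> / 2 \<le> ?b * ?q ^ m * (1 / 2)" using Suc.IH[of a j] by simp
    have "\<bar>lagd (Suc m) a j s\<bar> \<le> \<bar>lagd m a j s\<bar> / 2 + \<bar>lagd m (Suc a) k s\<bar>"
      using Suc by simp
    also have "\<dots> \<le> ?b * ?q ^ m * (real j + 1 / 2)" using 1 2 by (simp add: algebra_simps)
    also have "\<dots> \<le> ?b * ?q ^ m * ?q" by (intro mult_left_mono) auto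
    finally show ?thesis by (simp add: mult_ac)
  qed
qed

lemma lagf_mult:
  "s * lagf (Suc a) j s = real (j + a + 1) * lagf a j s - real (Suc j) * lagf a (Suc j) s"
  using arg_cong[OF lag_mult[of s a j], of "\<lambda>u. exp (- s / 2) * u"]
  unfolding lagf_def right_diff_distrib by (simp only: mult_ac)

lemma lagf_Suc_Suc: "lagf (Suc a) (Suc j) s = lagf (Suc a) j s + lagf a (Suc j) s"
  by (simp add: lagf_def lag_Suc_Suc distrib_left)

text \<open>This and the next lemma are the two ladder relations: s d/ds through the neighbour j-1
  or through j+1. They differ in the sign of the term s/2. Since the real part of \<lambda>\<A> is
  s/2 for \<lambda> > 0 and -s/2 for \<lambda> < 0, where s = |\<lambda>||z|^2/2, the sign of
  \<lambda> decides which one is used.\<close>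

lemma lagd1_down:
  "s * lagd 1 a j s = - (s / 2) * lagf a j s + real j * lagf a j s
     - (if j = 0 then 0 else real (j + a) * lagf a (j - 1) s)"
proof (cases j)
  case (Suc k)
  then show ?thesis using lagf_mult[of s a k] by (simp add: algebra_simps)
qed simp

lemma lagd1_up:
  "s * lagd 1 a j s = (s / 2) * lagf a j s - real (j + a + 1) * lagf a j s + real (Suc j) * lagf a (Suc j) s"
proof -
  have "lagd 1 a j s = lagf a j s / 2 - lagf (Suc a) j s"
    by (cases j) (simp_all add: lagf_Suc_Suc, simp add: lagf_def)
  then have "s * lagd 1 a j s = (s / 2) * lagf a j s - s * lagf (Suc a) j s"
    by (simp only: right_diff_distrib times_divide_eq_left times_divide_eq_right)
  then show ?thesis unfolding lagf_mult by simp
qed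

text \<open>Laguerre's equation after the factor exp(-s/2) is included. It will become the
  eigenvalue equation of the sublaplacian and the source of orthogonality.\<close>

lemma lagd_ode:
  "s * lagd 2 a j s + real (a + 1) * lagd 1 a j s + (real j + real (a + 1) / 2 - s / 4) * lagf a j s = 0"
proof (cases j)
  case 0
  then show ?thesis by (simp add: numeral_2_eq_2 field_simps)
next
  case (Suc k)
  show ?thesis
  proof (cases k)
    case 0
    have [simp]: "lagf b 0 s = exp (- s / 2)" for b by (simp add: lagf_def)
    show ?thesis using Suc 0 lagf_mult[of s a 0] by (simp add: numeral_2_eq_2 field_simps)
  next
    case (Suc i)
    have d1: "lagd 1 a j s = - lagf a j s / 2 - lagf (Suc a) k s"
      and d2: "lagd 2 a j s = lagf a j s / 4 + lagf (Suc a) k s + lagf (Suc (Suc a)) i s"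
      using Suc \<open>j = Suc k\<close> by (simp_all add: numeral_2_eq_2 diff_divide_distrib add_divide_distrib)
    have m1: "s * lagf (Suc a) k s = real (k + a + 1) * lagf a k s - real j * lagf a j s"
      using lagf_mult[of s a k] \<open>j = Suc k\<close> by simp
    have m2: "s * lagf (Suc (Suc a)) i s = real (k + a + 1) * (lagf (Suc a) k s - lagf a k s) - real k * lagf (Suc a) k s"
      using lagf_mult[of s "Suc a" i] lagf_Suc_Suc[of a i s] Suc by simp
    have "s * lagd 2 a j s = s * lagf a j s / 4 + s * lagf (Suc a) k s + s * lagf (Suc (Suc a)) i s"
      unfolding d2 by (simp add: algebra_simps)
    moreover have "real j = real k + 1" using \<open>j = Suc k\<close> by simp
    ultimately show ?thesis unfolding m1 m2 d1 by (simp add: algebra_simps)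
  qed
qed

section \<open>The inverse transform as a superposition of waves\<close>

lemma fact_choose_rearrange:
  "(j choose m) / pochhammer (real (a + 1)) m
    = real ((j + a) choose (m + a)) / (fact m * real ((j + a) choose j))"
proof (cases "m \<le> j")
  case True
  have p: "pochhammer (real (a + 1)) m = fact (a + m) / fact a"
    using pochhammer_product'[of "1 :: real" a m] by (simp add: pochhammer_fact[symmetric] add.commute)
  show ?thesis
    unfolding p using True by (simp add: binomial_fact divide_simps add.commute)
qed (simp add: binomial_eq_0)

text \<open>The confluent hypergeometric series 1F1(-j; a+1; s), which terminates. It is the series
  of the spherical function for \<lambda> > 0.\<close>

lemma sums_lag_pos:
  "(\<lambda>m. (- s) ^ m * real (j choose m) / pochhammer (real (a + 1)) m) sums (lag a j s / real ((j + a) choose j))"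
proof -
  have "(\<lambda>m. (- s) ^ m * real (j choose m) / pochhammer (real (a + 1)) m) sums
     (\<Sum>m\<le>j. (- s) ^ m * real (j choose m) / pochhammer (real (a + 1)) m)"
    by (rule sums_finite) auto
  also have "(\<Sum>m\<le>j. (- s) ^ m * real (j choose m) / pochhammer (real (a + 1)) m) =
     lag a j s / real ((j + a) choose j)"
    unfolding lag_def sum_divide_distrib
    by (intro sum.cong refl, subst times_divide_eq_right[symmetric], subst fact_choose_rearrange)
       (simp add: power_minus[of s] mult_ac)
  finally show ?thesis .
qed

lemma sums_exp_choose:
  "(\<lambda>m. x ^ m / fact m * real (m choose i)) sums (x ^ i / fact i * exp x)" for x :: real
proof -
  have "(\<lambda>m. x ^ i / fact i * (x ^ m / fact m)) sums (x ^ i / fact i * exp x)"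
    using exp_converges[of x] by (intro sums_mult) (simp add: divide_inverse mult.commute)
  also have "(\<lambda>m. x ^ i / fact i * (x ^ m / fact m)) = (\<lambda>m. x ^ (m + i) / fact (m + i) * real ((m + i) choose i))"
    by (auto simp: binomial_fact power_add field_simps)
  finally show ?thesis
    by (subst (asm) sums_zero_iff_shift) auto
qed

text \<open>Kummer's transformation of 1F1(j+a+1; a+1; -s) into exp(-s) 1F1(-j; a+1; s), needed for
  \<lambda> < 0, where the series does not terminate. Vandermonde's identity expands binom(m+j+a,
  j), and the sum over m is then an exponential series.\<close>

lemma sums_lag_neg:
  "(\<lambda>m. (- s) ^ m * pochhammer (real (j + a + 1)) m / (pochhammer (real (a + 1)) m * fact m)) sums
     (exp (- s) * lag a j s / real ((j + a) choose j))"
proof -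
  have "(\<lambda>m. \<Sum>i\<le>j. real ((j + a) choose (i + a)) * ((- s) ^ m / fact m * real (m choose i))) sums
     (\<Sum>i\<le>j. real ((j + a) choose (i + a)) * ((- s) ^ i / fact i * exp (- s)))"
    by (intro sums_sum sums_mult sums_exp_choose)
  also have "(\<Sum>i\<le>j. real ((j + a) choose (i + a)) * ((- s) ^ i / fact i * exp (- s))) = exp (- s) * lag a j s"
    unfolding lag_def sum_distrib_left by (intro sum.cong refl) (simp add: power_minus[of s])
  also have "(\<lambda>m. \<Sum>i\<le>j. real ((j + a) choose (i + a)) * ((- s) ^ m / fact m * real (m choose i)))
     = (\<lambda>m. (- s) ^ m / fact m * real ((m + (j + a)) choose j))"
  proof
    fix m
    have "(\<Sum>i\<le>j. (m choose i) * ((j + a) choose (j - i))) = (m + (j + a)) choose j"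
      by (rule vandermonde)
    moreover have "(j + a) choose (j - i) = (j + a) choose (i + a)" if "i \<le> j" for i
      using that binomial_symmetric[of "j - i" "j + a"] by (simp add: Nat.diff_diff_right add.commute)
    ultimately have "(\<Sum>i\<le>j. (m choose i) * ((j + a) choose (i + a))) = (m + (j + a)) choose j"
      by simp
    then have "real ((m + (j + a)) choose j) = (\<Sum>i\<le>j. real (m choose i) * real ((j + a) choose (i + a)))"
      by (simp flip: of_nat_mult of_nat_sum)
    then show "(\<Sum>i\<le>j. real ((j + a) choose (i + a)) * ((- s) ^ m / fact m * real (m choose i))) =
       (- s) ^ m / fact m * real ((m + (j + a)) choose j)"
      by (simp add: sum_distrib_left mult_ac)
  qed
  finally have "(\<lambda>m. (- s) ^ m / fact m * real ((m + (j + a)) choose j) / real ((j + a) choose j)) sums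
     (exp (- s) * lag a j s / real ((j + a) choose j))"
    by (rule sums_divide)
  also have "(\<lambda>m. (- s) ^ m / fact m * real ((m + (j + a)) choose j) / real ((j + a) choose j)) =
     (\<lambda>m. (- s) ^ m * pochhammer (real (j + a + 1)) m / (pochhammer (real (a + 1)) m * fact m))"
  proof
    fix m
    have p: "pochhammer (real (b + 1)) m = fact (b + m) / fact b" for b
      using pochhammer_product'[of "1 :: real" b m] by (simp add: pochhammer_fact[symmetric] add.commute)
    show "(- s) ^ m / fact m * real ((m + (j + a)) choose j) / real ((j + a) choose j) =
       (- s) ^ m * pochhammer (real (j + a + 1)) m / (pochhammer (real (a + 1)) m * fact m)"
      unfolding p by (simp add: binomial_fact divide_simps) (simp add: algebra_simps)
  qed
  finally show ?thesis .
qed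

lemma prod_choose: "(\<Prod>d<m. real d - real j) = (- 1) ^ m * fact m * real (j choose m)"
proof -
  have "(\<Prod>d<m. real d - real j) = (\<Prod>d<m. (- 1) * (real j - real d))"
    by (intro prod.cong) auto
  also have "\<dots> = (- 1) ^ m * (\<Prod>d<m. real j - real d)"
    unfolding prod.distrib by simp
  also have "(\<Prod>d<m. real j - real d) = fact m * real (j choose m)"
    unfolding binomial_gbinomial gbinomial_prod_rev by (simp add: lessThan_atLeast0)
  finally show ?thesis by simp
qed

text \<open>With s = |\<lambda>||z|^2/2 the prefactor exp(-\<lambda>|z|^2/4) is exp(-s/2) for
  \<lambda> > 0, but exp(s/2) for \<lambda> < 0; there the factor exp(-s) of Kummer's transformation
  restores exp(-s/2).\<close>

lemma spherical_on_fan: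
  fixes x :: "'n::finite heis"
  assumes l: "l \<noteq> 0"
  defines "a \<equiv> CARD('n) - 1"
  shows "spherical (of_real (\<bar>l\<bar> * real (2 * j + CARD('n)))) (of_real l) x =
     exp (\<i> * of_real (l * snd x)) * of_real (lagf a j (\<bar>l\<bar> * (norm (fst x))\<^sup>2 / 2) / real ((j + a) choose j))"
proof -
  define r where "r = norm (fst x)"
  define s where "s = \<bar>l\<bar> * r\<^sup>2 / 2"
  define \<xi> where "\<xi> = \<bar>l\<bar> * real (2 * j + CARD('n))"
  define T where "T m = r ^ (2 * m) / (pochhammer (real CARD('n)) m * fact m * 4 ^ m) * (\<Prod>d<m. l * real (2 * d + CARD('n)) - \<xi>)" for m
  have n: "CARD('n) = a + 1" by (simp add: a_def)
  have sums: "T sums (exp (l * r\<^sup>2 / 4) * lagf a j s / real ((j + a) choose j))"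
  proof (cases "l > 0")
    case True
    have "T m = (- s) ^ m * real (j choose m) / pochhammer (real (a + 1)) m" for m
    proof -
      have "(\<Prod>d<m. l * real (2 * d + CARD('n)) - \<xi>) = (\<Prod>d<m. 2 * l * (real d - real j))"
        using True by (intro prod.cong) (auto simp: \<xi>_def algebra_simps)
      also have "\<dots> = (2 * l) ^ m * ((- 1) ^ m * fact m * real (j choose m))"
        unfolding prod.distrib prod_choose by simp
      finally have *: "(\<Prod>d<m. l * real (2 * d + CARD('n)) - \<xi>) = \<dots>" .
      have "(- s) ^ m = r ^ (2 * m) * (2 * l) ^ m * (- 1) ^ m / 4 ^ m"
      proof -
        have "(- s) ^ m = (r\<^sup>2 * (2 * l) * (- 1) / 4) ^ m" using True by (simp add: s_def field_simps)
        then show ?thesis by (simp only: power_mult_distrib power_divide power_mult)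
      qed
      then show ?thesis unfolding T_def * unfolding n by (simp add: power_mult_distrib mult_ac)
    qed
    then have "T sums (lag a j s / real ((j + a) choose j))" using sums_lag_pos[of s j a] by presburger
    moreover have "exp (l * r\<^sup>2 / 4) * lagf a j s = lag a j s"
      using True by (simp add: lagf_def s_def exp_minus)
    ultimately show ?thesis by simp
  next
    case False
    have "T m = (- s) ^ m * pochhammer (real (j + a + 1)) m / (pochhammer (real (a + 1)) m * fact m)" for m
    proof -
      have "(\<Prod>d<m. l * real (2 * d + CARD('n)) - \<xi>) = (\<Prod>d<m. 2 * l * (real (j + a + 1) + real d))"
        using False by (intro prod.cong) (auto simp: \<xi>_def algebra_simps n)
      also have "\<dots> = (2 * l) ^ m * pochhammer (real (j + a + 1)) m"
        unfolding prod.distrib pochhammer_prod by (simp add: lessThan_atLeast0)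
      finally have *: "(\<Prod>d<m. l * real (2 * d + CARD('n)) - \<xi>) = \<dots>" .
      have "(- s) ^ m = r ^ (2 * m) * (2 * l) ^ m / 4 ^ m"
      proof -
        have "(- s) ^ m = (r\<^sup>2 * (2 * l) / 4) ^ m" using False by (simp add: s_def field_simps)
        then show ?thesis by (simp only: power_mult_distrib power_divide power_mult)
      qed
      then show ?thesis unfolding T_def * unfolding n by (simp add: power_mult_distrib mult_ac)
    qed
    then have "T sums (exp (- s) * lag a j s / real ((j + a) choose j))"
      using sums_lag_neg[of s j a] by presburger
    moreover have "exp (l * r\<^sup>2 / 4) * lagf a j s = exp (- s) * lag a j s"
      using False by (simp add: lagf_def s_def exp_add[symmetric])
    ultimately show ?thesis by simp
  qed
  have "(\<lambda>k. T (Suc k)) sums (exp (l * r\<^sup>2 / 4) * lagf a j s / real ((j + a) choose j) - 1)"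
    using sums by (subst sums_Suc_iff) (simp add: T_def)
  then have "(\<lambda>k. complex_of_real (T (Suc k))) sums of_real (exp (l * r\<^sup>2 / 4) * lagf a j s / real ((j + a) choose j) - 1)"
    by (rule sums_of_real)
  moreover have "complex_of_real (T m) = of_real r ^ (2 * m) / (pochhammer (of_nat CARD('n)) m * fact m * 4 ^ m) *
         (\<Prod>d<m. of_real l * of_nat (2 * d + CARD('n)) - of_real \<xi>)" for m
    unfolding T_def by (simp add: pochhammer_of_real[symmetric])
  ultimately have S: "(\<Sum>k. of_real r ^ (2 * Suc k) / (pochhammer (of_nat CARD('n)) (Suc k) * fact (Suc k) * 4 ^ Suc k) *
         (\<Prod>d<Suc k. of_real l * of_nat (2 * d + CARD('n)) - complex_of_real \<xi>)) =
      of_real (exp (l * r\<^sup>2 / 4) * lagf a j s / real ((j + a) choose j) - 1)"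
    by (simp only: sums_unique[symmetric])
  have e: "exp (- complex_of_real l * (of_real r)\<^sup>2 / 4) = of_real (exp (- (l * r\<^sup>2 / 4)))"
    by (simp flip: exp_of_real)
  show ?thesis
    unfolding spherical_def Let_def r_def[symmetric] \<xi>_def[symmetric] s_def[symmetric] of_real_power S e
    by (simp add: exp_minus mult_ac)
qed

section \<open>The fan in the coordinates (j, \<lambda>)\<close>

definition nu :: "(nat \<times> real) measure" where
  "nu = count_space UNIV \<Otimes>\<^sub>M lborel"

text \<open>The index m counts derivatives of the Laguerre function, each with its factor
  |\<lambda>| from s = |\<lambda>||z|^2/2. With this index the family is closed under
  differentiation on the group.\<close>

definition wave :: "nat \<Rightarrow> (nat \<times> real \<Rightarrow> complex) \<Rightarrow> 'n::finite heis \<Rightarrow> complex" where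
  "wave m c x = (LINT q|nu. c q *
     of_real (\<bar>snd q\<bar> ^ m * lagd m (CARD('n) - 1) (fst q) (\<bar>snd q\<bar> * (norm (fst x))\<^sup>2 / 2)) *
     exp (\<i> * of_real (snd q * snd x)))"

text \<open>No binomial coefficient appears: the one in the Plancherel measure cancels the one by
  which the Laguerre function is divided in the spherical function.\<close>

definition fan_coeff :: "nat \<Rightarrow> (real \<times> real \<Rightarrow> complex) \<Rightarrow> nat \<times> real \<Rightarrow> complex" where
  "fan_coeff n f q = of_real (\<bar>snd q\<bar> ^ n / (2 * pi) ^ (n + 1)) * f (\<bar>snd q\<bar> * real (2 * fst q + n), snd q)"

lemma sets_nu [measurable_cong]: "sets nu = sets (count_space UNIV \<Otimes>\<^sub>M borel)"
  unfolding nu_def by (intro sets_pair_measure_cong) auto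

lemma space_nu [simp]: "space nu = UNIV"
  by (simp add: nu_def space_pair_measure)

lemma nu_pair: "pair_sigma_finite (count_space (UNIV :: nat set)) (lborel :: real measure)"
  by (intro pair_sigma_finite.intro sigma_finite_measure_count_space_countable lborel.sigma_finite_measure_axioms) auto

lemma AE_nu_nonzero: "AE q in nu. snd q \<noteq> 0"
proof -
  interpret pair_sigma_finite "count_space (UNIV :: nat set)" "lborel :: real measure" by (rule nu_pair)
  have "AE j in count_space (UNIV :: nat set). AE l in lborel. l \<noteq> (0::real)"
    using AE_lborel_singleton[of "0::real"] by (simp add: AE_count_space)
  then have "AE q in count_space (UNIV :: nat set) \<Otimes>\<^sub>M lborel. snd q \<noteq> (0::real)"
    by (intro AE_pair_measure) auto
  then show ?thesis unfolding nu_def .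
qed

lemma fan_measurable [measurable]: "fan n \<in> sets borel"
proof -
  have "fan n = (\<Union>j::nat. {p. fst p = \<bar>snd p\<bar> * real (2 * j + n)} \<inter> {p. snd p \<noteq> 0}) \<union> {p. snd p = 0 \<and> fst p \<ge> 0}"
    unfolding fan_def by auto
  also have "\<dots> \<in> sets borel"
  proof (intro sets.Un sets.countable_UN subsetI)
    have "{p. fst p = \<bar>snd p\<bar> * real (2 * j + n)} \<inter> {p::real \<times> real. snd p \<noteq> 0} \<in> sets borel" for j
      by (intro sets.Int borel_closed borel_open closed_Collect_eq open_Collect_neq continuous_intros)
    then show "A \<in> range (\<lambda>j. {p. fst p = \<bar>snd p\<bar> * real (2 * j + n)} \<inter> {p::real \<times> real. snd p \<noteq> 0}) \<Longrightarrow> A \<in> sets borel" for A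
      by blast
    show "{p::real \<times> real. snd p = 0 \<and> fst p \<ge> 0} \<in> sets borel"
      by (intro borel_closed closed_Collect_conj closed_Collect_eq closed_Collect_le continuous_intros)
  qed
  finally show ?thesis .
qed

text \<open>Pull-back of the Plancherel measure to pairs (j, \<lambda>), where \<lambda> = 0 is a
  null set. The Borel function f replaces F, whose values off the fan are arbitrary.\<close>

lemma inv_gelfand_eq_wave:
  fixes x :: "'n::finite heis"
  assumes f [measurable]: "f \<in> borel_measurable borel" and F: "\<And>p. p \<in> fan CARD('n) \<Longrightarrow> F p = f p"
  shows "inv_gelfand F x = wave 0 (fan_coeff CARD('n) f) x"
proof -
  let ?n = "CARD('n)"
  let ?S = "\<lambda>p. spherical (complex_of_real (fst p)) (of_real (snd p)) x"
  let ?G = "\<lambda>p. indicator (fan ?n) p *\<^sub>R (f p * ?S p)"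
  let ?w = "\<lambda>q::nat\<times>real. real ((fst q + ?n - 1) choose fst q) * \<bar>snd q\<bar> ^ ?n / (2 * pi) ^ (?n + 1)"
  let ?\<phi> = "\<lambda>q::nat\<times>real. (\<bar>snd q\<bar> * real (2 * fst q + ?n), snd q)"
  have pl: "plancherel ?n = distr (density nu (\<lambda>q. ennreal (?w q))) borel ?\<phi>"
    unfolding plancherel_def nu_def case_prod_beta ..
  have S [measurable]: "?S \<in> borel_measurable borel"
    unfolding spherical_def Let_def
    by (intro borel_measurable_times borel_measurable_add borel_measurable_suminf borel_measurable_continuous_onI continuous_intros) auto
  have \<phi> [measurable]: "?\<phi> \<in> measurable nu borel"
    by (subst borel_prod[symmetric]) measurable
  have w [measurable]: "?w \<in> borel_measurable nu" by measurable
  have G: "?G \<in> borel_measurable borel" by measurable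
  have G\<phi>: "(\<lambda>q. ?G (?\<phi> q)) \<in> borel_measurable nu" by (rule measurable_compose[OF \<phi> G])
  have f\<phi>: "(\<lambda>q. f (?\<phi> q)) \<in> borel_measurable nu" by (rule measurable_compose[OF \<phi> f])
  have "inv_gelfand F x = (LINT p|plancherel ?n. ?G p)"
    unfolding inv_gelfand_def set_lebesgue_integral_def
    by (intro Bochner_Integration.integral_cong) (auto simp: F indicator_def)
  also have "\<dots> = (LINT q|density nu (\<lambda>q. ennreal (?w q)). ?G (?\<phi> q))"
    unfolding pl by (rule integral_distr[OF _ G]) measurable
  also have "\<dots> = (LINT q|nu. ?w q *\<^sub>R ?G (?\<phi> q))"
    by (rule integral_density[OF G\<phi> w]) auto
  also have "\<dots> = wave 0 (fan_coeff ?n f) x"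
    unfolding wave_def
  proof (rule integral_cong_AE)
    show "AE q in nu. ?w q *\<^sub>R ?G (?\<phi> q) = fan_coeff ?n f q *
     of_real (\<bar>snd q\<bar> ^ 0 * lagd 0 (CARD('n) - 1) (fst q) (\<bar>snd q\<bar> * (norm (fst x))\<^sup>2 / 2)) *
     exp (\<i> * of_real (snd q * snd x))"
      using AE_nu_nonzero
    proof eventually_elim
      case (elim q)
      have "?\<phi> q \<in> fan ?n" using elim by (auto simp: fan_def)
      moreover have "fst q + ?n - 1 = fst q + (?n - 1)" by simp
      moreover have "\<not> fst q + CARD('n) - Suc 0 < fst q" using zero_less_card_finite[where 'a = 'n] by linarith
      ultimately show ?case using spherical_on_fan[OF elim, of "fst q" x]
        by (simp add: fan_coeff_def scaleR_conv_of_real mult_ac)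
    qed
    show "(\<lambda>q. ?w q *\<^sub>R ?G (?\<phi> q)) \<in> borel_measurable nu"
      by (rule borel_measurable_scaleR[OF w G\<phi>])
    show "(\<lambda>q. fan_coeff ?n f q *
       of_real (\<bar>snd q\<bar> ^ 0 * lagd 0 (CARD('n) - 1) (fst q) (\<bar>snd q\<bar> * (norm (fst x))\<^sup>2 / 2)) *
       exp (\<i> * of_real (snd q * snd x))) \<in> borel_measurable nu"
      using f\<phi> unfolding fan_coeff_def lagd.simps lagf_def lag_def by measurable
  qed
  finally show ?thesis .
qed

section \<open>Differentiating waves under the integral sign\<close>

lemma has_vector_derivative_at_0_iff:
  fixes f :: "real \<Rightarrow> 'b::real_normed_vector"
  shows "(f has_vector_derivative D) (at 0) \<longleftrightarrow> ((\<lambda>s. (f s - f 0) /\<^sub>R s) \<longlongrightarrow> D) (at 0)"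
proof -
  have "(f has_vector_derivative D) (at 0) \<longleftrightarrow> ((\<lambda>h. norm (f h - f 0 - h *\<^sub>R D) / norm h) \<longlongrightarrow> 0) (at 0)"
    unfolding has_vector_derivative_def has_derivative_at by (simp add: bounded_linear_scaleR_left)
  also have "\<dots> \<longleftrightarrow> ((\<lambda>h. norm ((f h - f 0) /\<^sub>R h - D)) \<longlongrightarrow> 0) (at 0)"
  proof (rule filterlim_cong[OF refl refl])
    show "\<forall>\<^sub>F h in at 0. norm (f h - f 0 - h *\<^sub>R D) / norm h = norm ((f h - f 0) /\<^sub>R h - D)"
      unfolding eventually_at_filter
    proof (intro always_eventually allI impI)
      fix h :: real assume h: "h \<noteq> 0"
      have "(f h - f 0) /\<^sub>R h - D = (f h - f 0 - h *\<^sub>R D) /\<^sub>R h"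
        using h by (simp add: scaleR_diff_right)
      then show "norm (f h - f 0 - h *\<^sub>R D) / norm h = norm ((f h - f 0) /\<^sub>R h - D)"
        by (simp add: divide_inverse mult.commute)
    qed
  qed
  also have "\<dots> \<longleftrightarrow> ((\<lambda>s. (f s - f 0) /\<^sub>R s) \<longlongrightarrow> D) (at 0)"
    by (simp add: LIM_zero_iff tendsto_norm_zero_iff)
  finally show ?thesis .
qed

text \<open>The domination is asked only near s = 0, because the derivative of a wave in direction v
  at x + sv carries the inner product of z + sv with v, which is unbounded in s. The mean value
  inequality passes it on to the difference quotients.\<close>

lemma has_vector_derivative_integral_dominated:
  fixes f f' :: "real \<Rightarrow> 'a \<Rightarrow> complex"
  assumes int: "\<And>s. integrable M (f s)"
    and deriv: "\<And>s q. ((\<lambda>s. f s q) has_vector_derivative f' s q) (at s)"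
    and bound: "\<And>s q. \<bar>s\<bar> < 1 \<Longrightarrow> norm (f' s q) \<le> g q"
    and g: "integrable M g" and meas: "f' 0 \<in> borel_measurable M"
  shows "((\<lambda>s. LINT q|M. f s q) has_vector_derivative (LINT q|M. f' 0 q)) (at 0)"
  unfolding has_vector_derivative_at_0_iff tendsto_at_iff_sequentially comp_def
proof (intro allI impI)
  fix X :: "nat \<Rightarrow> real" assume X0: "\<forall>i. X i \<in> UNIV - {0}" and X: "X \<longlonglongrightarrow> 0"
  have "\<forall>\<^sub>F i in sequentially. \<bar>X i\<bar> < 1"
    using X by (auto simp: tendsto_iff dist_real_def)
  then obtain N where N: "\<And>i. \<bar>X (i + N)\<bar> < 1"
    by (auto simp: eventually_sequentially) (metis le_add2)
  let ?Q = "\<lambda>i q. (f (X (i + N)) q - f 0 q) /\<^sub>R X (i + N)"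
  have "(\<lambda>i. LINT q|M. ?Q i q) \<longlonglongrightarrow> (LINT q|M. f' 0 q)"
  proof (rule integral_dominated_convergence[where w = g])
    show "?Q i \<in> borel_measurable M" for i
      using int[THEN borel_measurable_integrable] by measurable
    show "AE q in M. (\<lambda>i. ?Q i q) \<longlonglongrightarrow> f' 0 q"
    proof (rule AE_I2)
      fix q
      have "(\<lambda>i. (f (X i) q - f 0 q) /\<^sub>R X i) \<longlonglongrightarrow> f' 0 q"
        using deriv[of q 0] X0 X unfolding has_vector_derivative_at_0_iff tendsto_at_iff_sequentially comp_def by blast
      then show "(\<lambda>i. ?Q i q) \<longlonglongrightarrow> f' 0 q" by (rule LIMSEQ_ignore_initial_segment)
    qed
    show "AE q in M. norm (?Q i q) \<le> g q" for i
    proof (rule AE_I2)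
      fix q
      have "norm (f (X (i + N)) q - f 0 q) \<le> g q * norm (X (i + N) - 0)"
      proof (rule differentiable_bound[where f' = "\<lambda>s h. h *\<^sub>R f' s q" and S = "{-1<..<1}"])
        show "((\<lambda>s. f s q) has_derivative (\<lambda>h. h *\<^sub>R f' s q)) (at s within {-1<..<1})" for s
          using deriv[of q s] unfolding has_vector_derivative_def by (rule has_derivative_at_withinI)
        show "onorm (\<lambda>h. h *\<^sub>R f' s q) \<le> g q" if "s \<in> {-1<..<1}" for s
          using bound[of s q] that onorm_scaleR_left[of "\<lambda>h. h" "f' s q"]
          by (auto simp: onorm_id bounded_linear_ident abs_less_iff)
      qed (use N[of i] in \<open>auto simp: abs_less_iff\<close>)
      moreover have "norm (?Q i q) = norm (f (X (i + N)) q - f 0 q) / \<bar>X (i + N)\<bar>"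
        by (simp only: norm_scaleR abs_inverse divide_inverse_commute)
      ultimately show "norm (?Q i q) \<le> g q"
        using X0 by (simp add: pos_divide_le_eq)
    qed
  qed (use g meas in auto)
  moreover have "(LINT q|M. ?Q i q) = ((LINT q|M. f (X (i + N)) q) - (LINT q|M. f 0 q)) /\<^sub>R X (i + N)" for i
    using int by simp
  ultimately have "(\<lambda>i. ((LINT q|M. f (X (i + N)) q) - (LINT q|M. f 0 q)) /\<^sub>R X (i + N)) \<longlonglongrightarrow> (LINT q|M. f' 0 q)"
    by (simp only:)
  then show "(\<lambda>i. ((LINT q|M. f (X i) q) - (LINT q|M. f 0 q)) /\<^sub>R X i) \<longlonglongrightarrow> (LINT q|M. f' 0 q)"
    by (rule LIMSEQ_offset)
qed

text \<open>Here \<open>\<bar>\<lambda>\<bar>(2j+n)\<close> is the eigenvalue \<open>\<xi>\<close> of the sublaplacian, and the binomial coefficient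
  is the sharp bound of the Laguerre function.\<close>

definition xi :: "nat \<Rightarrow> nat \<times> real \<Rightarrow> real" where
  "xi n q = \<bar>snd q\<bar> * real (2 * fst q + n)"

definition fan_mult :: "nat \<Rightarrow> nat \<times> real \<Rightarrow> real" where
  "fan_mult n q = real ((fst q + (n - 1)) choose fst q)"

text \<open>The multiplicity bounds the Laguerre function and every derivative costs one power of
  \<xi>. Integrability against all powers therefore allows differentiation under the integral any
  number of times.\<close>

definition adm :: "nat \<Rightarrow> (nat \<times> real \<Rightarrow> complex) \<Rightarrow> bool" where
  "adm n c \<longleftrightarrow> c \<in> borel_measurable nu \<and> (\<forall>k. integrable nu (\<lambda>q. cmod (c q) * fan_mult n q * (1 + xi n q) ^ k))"

lemma xi_nonneg [simp]: "0 \<le> xi n q" by (simp add: xi_def)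
lemma fan_mult_nonneg [simp]: "0 \<le> fan_mult n q" by (simp add: fan_mult_def)

lemma xi_measurable [measurable]: "xi n \<in> borel_measurable nu"
  unfolding xi_def by measurable
lemma fan_mult_measurable [measurable]: "fan_mult n \<in> borel_measurable nu"
  unfolding fan_mult_def by measurable

lemma abs_le_xi: "n \<ge> 1 \<Longrightarrow> \<bar>snd q\<bar> \<le> xi n q"
proof -
  assume "n \<ge> 1"
  then have "\<bar>snd q\<bar> * 1 \<le> \<bar>snd q\<bar> * real (2 * fst q + n)" by (intro mult_left_mono) auto
  then show ?thesis by (simp add: xi_def)
qed

lemma adm_mono:
  assumes c: "adm n c" and d: "d \<in> borel_measurable nu"
    and le: "\<And>q. cmod (d q) \<le> K * (1 + xi n q) ^ p * cmod (c q)"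
  shows "adm n d"
  unfolding adm_def
proof (intro conjI allI d)
  fix k
  have "integrable nu (\<lambda>q. K * (cmod (c q) * fan_mult n q * (1 + xi n q) ^ (p + k)))"
    using c by (simp add: adm_def)
  then show "integrable nu (\<lambda>q. cmod (d q) * fan_mult n q * (1 + xi n q) ^ k)"
  proof (rule Bochner_Integration.integrable_bound)
    show "AE q in nu. norm (cmod (d q) * fan_mult n q * (1 + xi n q) ^ k)
       \<le> norm (K * (cmod (c q) * fan_mult n q * (1 + xi n q) ^ (p + k)))"
    proof (rule AE_I2)
      fix q
      have "cmod (d q) * (fan_mult n q * (1 + xi n q) ^ k) \<le> K * (1 + xi n q) ^ p * cmod (c q) * (fan_mult n q * (1 + xi n q) ^ k)"
        by (intro mult_right_mono le) auto
      also have "\<dots> = K * (cmod (c q) * fan_mult n q * (1 + xi n q) ^ (p + k))"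
        by (simp add: power_add)
      finally show "norm (cmod (d q) * fan_mult n q * (1 + xi n q) ^ k)
       \<le> norm (K * (cmod (c q) * fan_mult n q * (1 + xi n q) ^ (p + k)))"
        by (simp add: mult.assoc)
    qed
  qed (use d in measurable)
qed

definition tderiv :: "(nat \<times> real \<Rightarrow> complex) \<Rightarrow> nat \<times> real \<Rightarrow> complex" where
  "tderiv c q = \<i> * of_real (snd q) * c q"

lemma adm_tderiv:
  assumes "adm n c" "n \<ge> 1" shows "adm n (tderiv c)"
proof (rule adm_mono[OF assms(1), where K = 1 and p = 1])
  show "tderiv c \<in> borel_measurable nu"
    using assms(1) unfolding tderiv_def[abs_def] by (auto simp: adm_def)
  show "cmod (tderiv c q) \<le> 1 * (1 + xi n q) ^ 1 * cmod (c q)" for q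
    using abs_le_xi[OF assms(2), of q] by (auto simp: tderiv_def norm_mult intro!: mult_right_mono)
qed

lemma adm_xi:
  assumes "adm n c" shows "adm n (\<lambda>q. of_real (xi n q) * c q)"
proof (rule adm_mono[OF assms, where K = 1 and p = 1])
  show "(\<lambda>q. of_real (xi n q) * c q) \<in> borel_measurable nu"
    using assms(1) by (auto simp: adm_def)
  show "cmod (of_real (xi n q) * c q) \<le> 1 * (1 + xi n q) ^ 1 * cmod (c q)" for q
    by (auto simp: norm_mult intro!: mult_right_mono)
qed

lemma lagd_measurable:
  assumes g: "g \<in> measurable M (count_space UNIV)" and h: "h \<in> borel_measurable M"
  shows "(\<lambda>x. lagd m a (g x) (h x)) \<in> borel_measurable M"
proof (rule measurable_compose_countable[where f = "\<lambda>j x. lagd m a j (h x)" and g = g])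
  show "(\<lambda>x. lagd m a j (h x)) \<in> borel_measurable M" for j
    using lagd_deriv[of m a j, THEN DERIV_isCont]
    by (intro measurable_compose[OF h] borel_measurable_continuous_onI continuous_at_imp_continuous_on) auto
qed (rule g)

lemma lagd_measurable_nu [measurable]: "(\<lambda>q. lagd m a (fst q) (h q)) \<in> borel_measurable nu"
  if "h \<in> borel_measurable nu"
  by (rule lagd_measurable[OF _ that]) measurable

definition kern :: "nat \<Rightarrow> nat \<Rightarrow> nat \<times> real \<Rightarrow> 'n::finite heis \<Rightarrow> real" where
  "kern n m q x = \<bar>snd q\<bar> ^ m * lagd m (n - 1) (fst q) (\<bar>snd q\<bar> * (norm (fst x))\<^sup>2 / 2)"

lemma kern_measurable [measurable]: "(\<lambda>q. kern n m q x) \<in> borel_measurable nu"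
  unfolding kern_def by measurable

lemma kern_bound:
  assumes "n \<ge> 1" shows "\<bar>kern n m q x\<bar> \<le> fan_mult n q * (1 + xi n q) ^ m"
proof -
  have "\<bar>kern n m q x\<bar> \<le> \<bar>snd q\<bar> ^ m * (fan_mult n q * (real (2 * fst q + (n - 1) + 1) / 2) ^ m)"
    unfolding kern_def abs_mult fan_mult_def by (simp only: power_abs abs_abs) (intro mult_left_mono lagd_bound; simp)
  also have "\<dots> = fan_mult n q * (xi n q / 2) ^ m"
    using assms by (simp add: xi_def power_mult_distrib power_divide)
  also have "\<dots> \<le> fan_mult n q * (1 + xi n q) ^ m"
    using xi_nonneg[of n q] by (intro mult_left_mono power_mono) auto
  finally show ?thesis .
qed

lemma wave_kern:
  "wave m c (x :: 'n::finite heis) = (LINT q|nu. c q * of_real (kern CARD('n) m q x) * exp (\<i> * of_real (snd q * snd x)))"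
  unfolding wave_def kern_def ..

lemma adm_integrable:
  assumes "adm n c" "n \<ge> 1"
  shows "integrable nu (\<lambda>q. c q * of_real (kern n m q x) * exp (\<i> * of_real (snd q * t)))"
proof (rule Bochner_Integration.integrable_bound)
  show "integrable nu (\<lambda>q. cmod (c q) * fan_mult n q * (1 + xi n q) ^ m)"
    using assms by (simp add: adm_def)
  show "(\<lambda>q. c q * of_real (kern n m q x) * exp (\<i> * of_real (snd q * t))) \<in> borel_measurable nu"
    using assms by (auto simp: adm_def)
  show "AE q in nu. norm (c q * of_real (kern n m q x) * exp (\<i> * of_real (snd q * t))) \<le> norm (cmod (c q) * fan_mult n q * (1 + xi n q) ^ m)"
    using kern_bound[OF assms(2), of m _ x] by (intro AE_I2) (auto simp: norm_mult mult.assoc intro!: mult_left_mono)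
qed

lemma wave_bound:
  fixes x :: "'n::finite heis"
  assumes "adm CARD('n) c"
  shows "cmod (wave 0 c x) \<le> (LINT q|nu. cmod (c q) * fan_mult CARD('n) q)"
proof -
  have n: "CARD('n) \<ge> 1" by (simp add: Suc_leI)
  have "cmod (wave 0 c x) \<le> (LINT q|nu. cmod (c q * of_real (kern CARD('n) 0 q x) * exp (\<i> * of_real (snd q * snd x))))"
    unfolding wave_kern by (rule integral_norm_bound)
  also have "\<dots> \<le> (LINT q|nu. cmod (c q) * fan_mult CARD('n) q)"
    using kern_bound[OF n, of 0 _ x] adm_integrable[OF assms n, of 0 x] assms
    by (intro integral_mono integrable_norm)
       (auto simp: adm_def norm_mult mult.assoc intro!: mult_left_mono dest: spec[of _ 0])
  finally show ?thesis .
qed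

lemma kern_deriv:
  fixes x v :: "'n::finite heis"
  shows "((\<lambda>s. kern n m q (x + s *\<^sub>R v)) has_real_derivative
    (kern n (Suc m) q (x + s *\<^sub>R v) * inner (fst x + s *\<^sub>R fst v) (fst v))) (at s)"
proof -
  have 1: "((\<lambda>s. \<bar>snd q\<bar> * (norm (fst (x + s *\<^sub>R v)))\<^sup>2 / 2) has_real_derivative
     \<bar>snd q\<bar> * inner (fst x + s *\<^sub>R fst v) (fst v)) (at s)"
    unfolding power2_norm_eq_inner fst_add fst_scaleR inner_add_left inner_add_right inner_scaleR_left inner_scaleR_right
    by (auto intro!: derivative_eq_intros simp: inner_commute algebra_simps)
  show ?thesis
    unfolding kern_def
    by (rule derivative_eq_intros DERIV_chain2[OF lagd_deriv 1] refl)+ (simp add: mult_ac)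
qed

text \<open>In direction v the argument |\<lambda>||z|^2/2 changes at the rate |\<lambda>| times the
  inner product of z and v. The factor |\<lambda>| is taken up by the next \<open>wave\<close>, the
  inner product does not depend on the integration variable, and the t-component acts on the
  coefficient as \<open>tderiv\<close>.\<close>

lemma wave_has_vector_derivative:
  fixes x v :: "'n::finite heis"
  assumes c: "adm CARD('n) c"
  shows "((\<lambda>s. wave m c (x + s *\<^sub>R v)) has_vector_derivative
     (of_real (inner (fst x) (fst v)) * wave (Suc m) c x + of_real (snd v) * wave m (tderiv c) x)) (at 0)"
proof -
  let ?n = "CARD('n)"
  have n: "?n \<ge> 1" by (simp add: Suc_leI)
  have cm [measurable]: "c \<in> borel_measurable nu" using c by (simp add: adm_def)
  define f where "f s q = c q * of_real (kern ?n m q (x + s *\<^sub>R v)) * exp (\<i> * of_real (snd q * snd (x + s *\<^sub>R v)))" for s q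
  define f' where "f' s q = (of_real (inner (fst x + s *\<^sub>R fst v) (fst v)) * (c q * of_real (kern ?n (Suc m) q (x + s *\<^sub>R v)) * exp (\<i> * of_real (snd q * snd (x + s *\<^sub>R v))))
     + of_real (snd v) * (tderiv c q * of_real (kern ?n m q (x + s *\<^sub>R v)) * exp (\<i> * of_real (snd q * snd (x + s *\<^sub>R v)))))" for s q
  define C where "C = (norm (fst x) + norm (fst v)) * norm (fst v) + \<bar>snd v\<bar>"
  have "((\<lambda>s. LINT q|nu. f s q) has_vector_derivative (LINT q|nu. f' 0 q)) (at 0)"
  proof (rule has_vector_derivative_integral_dominated)
    show "integrable nu (f s)" for s
      unfolding f_def by (rule adm_integrable[OF c n])
    show "((\<lambda>s. f s q) has_vector_derivative f' s q) (at s)" for s q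
    proof -
      have e: "((\<lambda>s. exp (\<i> * of_real (snd q * snd (x + s *\<^sub>R v)))) has_vector_derivative
         (\<i> * of_real (snd q) * of_real (snd v) * exp (\<i> * of_real (snd q * snd (x + s *\<^sub>R v))))) (at s)"
        unfolding snd_add snd_scaleR of_real_mult of_real_add real_scaleR_def
        by (rule field_vector_diff_chain_at[where f = "\<lambda>s. \<i> * (of_real (snd q) * (of_real (snd x) + of_real s * of_real (snd v)))" and g = exp, unfolded comp_def, THEN has_vector_derivative_eq_rhs] derivative_eq_intros refl | simp)+
      show ?thesis
        unfolding f_def f'_def
        by (rule has_vector_derivative_mult[OF has_vector_derivative_mult_right[OF has_vector_derivative_of_real[OF kern_deriv]] e, THEN has_vector_derivative_eq_rhs])
           (simp add: tderiv_def algebra_simps)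
    qed
    show "norm (f' s q) \<le> C * (cmod (c q) * fan_mult ?n q * (1 + xi ?n q) ^ Suc m)" if "\<bar>s\<bar> < 1" for s q
    proof -
      have "\<bar>inner (fst x + s *\<^sub>R fst v) (fst v)\<bar> \<le> norm (fst x + s *\<^sub>R fst v) * norm (fst v)"
        by (rule Cauchy_Schwarz_ineq2)
      also have "\<dots> \<le> (norm (fst x) + 1 * norm (fst v)) * norm (fst v)"
        using that by (intro mult_right_mono order_trans[OF norm_triangle_ineq] add_left_mono) (use that in \<open>auto intro!: mult_left_le_one_le\<close>)
      finally have i: "\<bar>inner (fst x + s *\<^sub>R fst v) (fst v)\<bar> \<le> (norm (fst x) + norm (fst v)) * norm (fst v)" by simp
      let ?B = "cmod (c q) * (fan_mult ?n q * (1 + xi ?n q) ^ Suc m)"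
      have k1: "cmod (c q) * \<bar>kern ?n (Suc m) q (x + s *\<^sub>R v)\<bar> \<le> ?B"
        by (intro mult_left_mono kern_bound n) auto
      have "\<bar>snd q\<bar> * \<bar>kern ?n m q (x + s *\<^sub>R v)\<bar> \<le> (1 + xi ?n q) * (fan_mult ?n q * (1 + xi ?n q) ^ m)"
        using abs_le_xi[OF n, of q] by (intro mult_mono kern_bound n) auto
      then have k2: "cmod (c q) * (\<bar>snd q\<bar> * \<bar>kern ?n m q (x + s *\<^sub>R v)\<bar>) \<le> ?B"
        by (intro mult_left_mono) (auto simp: mult_ac)
      have "norm (f' s q) \<le> \<bar>inner (fst x + s *\<^sub>R fst v) (fst v)\<bar> * (cmod (c q) * \<bar>kern ?n (Suc m) q (x + s *\<^sub>R v)\<bar>)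
         + \<bar>snd v\<bar> * (cmod (c q) * (\<bar>snd q\<bar> * \<bar>kern ?n m q (x + s *\<^sub>R v)\<bar>))"
        unfolding f'_def by (rule order_trans[OF norm_triangle_ineq]) (simp add: tderiv_def norm_mult mult_ac)
      also have "\<dots> \<le> ((norm (fst x) + norm (fst v)) * norm (fst v)) * ?B + \<bar>snd v\<bar> * ?B"
        by (intro add_mono mult_mono i k1 k2) auto
      also have "\<dots> = C * (cmod (c q) * fan_mult ?n q * (1 + xi ?n q) ^ Suc m)"
        by (simp add: C_def algebra_simps)
      finally show ?thesis .
    qed
    show "integrable nu (\<lambda>q. C * (cmod (c q) * fan_mult ?n q * (1 + xi ?n q) ^ Suc m))"
      using c unfolding adm_def by (intro integrable_mult_right) blast
    show "f' 0 \<in> borel_measurable nu" unfolding f'_def tderiv_def by measurable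
  qed
  also have "(LINT q|nu. f' 0 q) = of_real (inner (fst x) (fst v)) * wave (Suc m) c x + of_real (snd v) * wave m (tderiv c) x"
    unfolding f'_def wave_kern
    using adm_integrable[OF c n, of "Suc m" x "snd x"] adm_integrable[OF adm_tderiv[OF c n] n, of m x "snd x"] by simp
  finally show ?thesis by (simp add: f_def wave_kern)
qed

lemma dir_deriv_eq: "((\<lambda>s. f (x + s *\<^sub>R v)) has_vector_derivative d) (at 0) \<Longrightarrow> dir_deriv v f x = d"
  unfolding dir_deriv_def by (rule vector_derivative_at)

lemma inner_axis_1 [simp]: "inner z (axis k 1) = Re (z $ k)" for z :: "complex ^ 'n::finite"
  by (simp add: inner_axis inner_complex_def)

lemma inner_axis_\<i> [simp]: "inner z (axis k \<i>) = Im (z $ k)" for z :: "complex ^ 'n::finite"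
  by (simp add: inner_axis inner_complex_def)

lemma card_ge_1 [simp]: "CARD('n::finite) \<ge> 1"
  by (simp add: Suc_leI)

section \<open>The sublaplacian on waves\<close>

context
  fixes c :: "nat \<times> real \<Rightarrow> complex" and ty :: "'n::finite itself"
  assumes c: "adm CARD('n) c"
begin

private lemma ct: "adm CARD('n) (tderiv c)"
  by (rule adm_tderiv[OF c card_ge_1])

private lemmas hvd = wave_has_vector_derivative[OF c] wave_has_vector_derivative[OF ct]

lemma Zbar_wave: "Zbar_field k (wave m c) (x :: 'n heis) =
    fst x $ k * (wave (Suc m) c x / 2 + \<i> / 4 * wave m (tderiv c) x)"
proof -
  obtain R I where RI: "Re (fst x $ k) = R" "Im (fst x $ k) = I" by blast
  then have z: "fst x $ k = of_real R + \<i> * of_real I"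
    by (simp add: complex_eq_iff)
  show ?thesis
    unfolding Zbar_field_def d_zbar_def d_t_def dir_deriv_eq[OF hvd(1)]
    by (simp only: inner_axis_1 inner_axis_\<i> fst_conv snd_conv RI inner_zero_right z)
       (simp add: field_simps)
qed

lemma Z_wave: "Z_field k (wave m c) (x :: 'n heis) =
    cnj (fst x $ k) * (wave (Suc m) c x / 2 - \<i> / 4 * wave m (tderiv c) x)"
proof -
  obtain R I where RI: "Re (fst x $ k) = R" "Im (fst x $ k) = I" by blast
  then have z: "cnj (fst x $ k) = of_real R - \<i> * of_real I"
    by (simp add: complex_eq_iff)
  show ?thesis
    unfolding Z_field_def d_z_def d_t_def dir_deriv_eq[OF hvd(1)]
    by (simp only: inner_axis_1 inner_axis_\<i> fst_conv snd_conv RI inner_zero_right z)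
       (simp add: field_simps)
qed

text \<open>The constant \<open>e\<close> is \<i>/4 or -\<i>/4, so that one derivative serves both
  orders of the two fields.\<close>

private lemma hvd_H:
  fixes x v :: "'n heis" and e :: complex and m :: nat
  defines "H \<equiv> \<lambda>x. wave (Suc m) c x / 2 + e * wave m (tderiv c) x"
  shows "((\<lambda>s. H (x + s *\<^sub>R v)) has_vector_derivative
    (of_real (inner (fst x) (fst v)) * (wave (Suc (Suc m)) c x / 2 + e * wave (Suc m) (tderiv c) x)
     + of_real (snd v) * (wave (Suc m) (tderiv c) x / 2 + e * wave m (tderiv (tderiv c)) x))) (at 0)"
  unfolding H_def
  by (rule has_vector_derivative_eq_rhs[OF has_vector_derivative_add[OF has_vector_derivative_divide[OF hvd(1)]
       has_vector_derivative_mult_right[OF hvd(2)]]])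
     (simp add: algebra_simps add_divide_distrib)

private lemma hvd_nth: "((\<lambda>s. fst (x + s *\<^sub>R v) $ k) has_vector_derivative fst v $ k) (at 0)" for x v :: "'n heis"
proof -
  have "(\<lambda>s. fst (x + s *\<^sub>R v) $ k) = (\<lambda>s. fst x $ k + s *\<^sub>R (fst v $ k))" by simp
  then show ?thesis by (auto intro!: derivative_eq_intros)
qed

private lemma hvd_cnj_nth: "((\<lambda>s. cnj (fst (x + s *\<^sub>R v) $ k)) has_vector_derivative cnj (fst v $ k)) (at 0)" for x v :: "'n heis"
  by (rule has_vector_derivative_cnj[OF hvd_nth])

lemma Z_Zbar_wave: "Z_field k (Zbar_field k (wave m c)) (x :: 'n heis) =
    wave (Suc m) c x / 2 + \<i> / 4 * wave m (tderiv c) x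
     + of_real ((cmod (fst x $ k))\<^sup>2) * (wave (Suc (Suc m)) c x / 4 + wave m (tderiv (tderiv c)) x / 16)"
proof -
  let ?H = "\<lambda>x::'n heis. wave (Suc m) c x / 2 + \<i> / 4 * wave m (tderiv c) x"
  have Zb: "Zbar_field k (wave m c) = (\<lambda>x::'n heis. fst x $ k * ?H x)"
    by (intro ext) (rule Zbar_wave)
  note d = dir_deriv_eq[OF has_vector_derivative_mult[OF hvd_nth hvd_H[where e = "\<i> / 4"]]]
  have r: "of_real ((cmod (fst x $ k))\<^sup>2) = fst x $ k * cnj (fst x $ k)"
    by (rule complex_norm_square)
  obtain R I where RI: "Re (fst x $ k) = R" "Im (fst x $ k) = I" by blast
  then have z: "fst x $ k = of_real R + \<i> * of_real I"
    and zc: "cnj (fst x $ k) = of_real R - \<i> * of_real I"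
    by (simp_all add: complex_eq_iff)
  show ?thesis
    unfolding Zb Z_field_def d_z_def d_t_def d r
    by (simp only: inner_axis_1 inner_axis_\<i> fst_conv snd_conv RI axis_nth inner_zero_right
        scaleR_zero_left add_0_right z zc)
       (simp add: field_simps)
qed

lemma Zbar_Z_wave: "Zbar_field k (Z_field k (wave m c)) (x :: 'n heis) =
    wave (Suc m) c x / 2 - \<i> / 4 * wave m (tderiv c) x
     + of_real ((cmod (fst x $ k))\<^sup>2) * (wave (Suc (Suc m)) c x / 4 + wave m (tderiv (tderiv c)) x / 16)"
proof -
  let ?H = "\<lambda>x::'n heis. wave (Suc m) c x / 2 + (- \<i> / 4) * wave m (tderiv c) x"
  have Zb: "Z_field k (wave m c) = (\<lambda>x::'n heis. cnj (fst x $ k) * ?H x)"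
    by (intro ext) (simp add: Z_wave)
  note d = dir_deriv_eq[OF has_vector_derivative_mult[OF hvd_cnj_nth hvd_H[where e = "- \<i> / 4"]]]
  have r: "of_real ((cmod (fst x $ k))\<^sup>2) = fst x $ k * cnj (fst x $ k)"
    by (rule complex_norm_square)
  obtain R I where RI: "Re (fst x $ k) = R" "Im (fst x $ k) = I" by blast
  then have z: "fst x $ k = of_real R + \<i> * of_real I"
    and zc: "cnj (fst x $ k) = of_real R - \<i> * of_real I"
    by (simp_all add: complex_eq_iff)
  show ?thesis
    unfolding Zb Zbar_field_def d_zbar_def d_t_def d r
    by (simp only: inner_axis_1 inner_axis_\<i> fst_conv snd_conv RI axis_nth inner_zero_right
        scaleR_zero_left add_0_right z zc)
       (simp add: field_simps)
qed

text \<open>In the symmetrised sum the terms with \<i>/4 times one t-derivative cancel, and the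
  squares |z_k|^2 add up to |z|^2: only radial derivatives and the second t-derivative
  survive.\<close>

lemma sublaplacian_wave_derivs:
  "sublaplacian (wave m c) (x :: 'n heis) =
    - 2 * of_nat CARD('n) * wave (Suc m) c x
     - of_real ((norm (fst x))\<^sup>2) * (wave (Suc (Suc m)) c x + wave m (tderiv (tderiv c)) x / 4)"
proof -
  have "(norm (fst x))\<^sup>2 = (\<Sum>k\<in>UNIV. (cmod (fst x $ k))\<^sup>2)"
    by (simp add: norm_vec_def L2_set_def sum_nonneg)
  then have n: "of_real ((norm (fst x))\<^sup>2) = (\<Sum>k\<in>UNIV. complex_of_real ((cmod (fst x $ k))\<^sup>2))"
    by (simp only: of_real_sum)
  let ?C = "wave (Suc (Suc m)) c x + wave m (tderiv (tderiv c)) x / 4"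
  have "Z_field k (Zbar_field k (wave m c)) x + Zbar_field k (Z_field k (wave m c)) x
     = wave (Suc m) c x + of_real ((cmod (fst x $ k))\<^sup>2) * (?C / 2)" for k
    unfolding Z_Zbar_wave Zbar_Z_wave by (simp add: field_simps)
  then have "sublaplacian (wave m c) x = - 2 * (of_nat CARD('n) * wave (Suc m) c x + of_real ((norm (fst x))\<^sup>2) * (?C / 2))"
    unfolding sublaplacian_def n by (simp only: sum.distrib sum_distrib_right[symmetric] sum_constant)
  moreover have "- 2 * (a + b * (d / 2)) = - 2 * a - b * d" for a b d :: complex
    by (simp add: field_simps)
  ultimately show ?thesis by (simp only: mult.assoc)
qed

end

text \<open>Under the integral sign the claim is Laguerre's equation at s = |\<lambda>||z|^2/2,
  multiplied by -2|\<lambda>|.\<close>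

lemma sublaplacian_wave:
  fixes c :: "nat \<times> real \<Rightarrow> complex"
  assumes c: "adm CARD('n) c"
  shows "sublaplacian (wave 0 c) = (wave 0 (\<lambda>q. of_real (xi CARD('n) q) * c q) :: 'n::finite heis \<Rightarrow> complex)"
proof
  fix x :: "'n heis"
  let ?n = "CARD('n)"
  note ctt = adm_tderiv[OF adm_tderiv[OF c card_ge_1] card_ge_1]
  let ?e = "\<lambda>q. exp (\<i> * of_real (snd q * snd x))"
  have "sublaplacian (wave 0 c) x = (LINT q|nu. - 2 * of_nat ?n * (c q * of_real (kern ?n 1 q x) * ?e q)
     - of_real ((norm (fst x))\<^sup>2) * (c q * of_real (kern ?n 2 q x) * ?e q + tderiv (tderiv c) q * of_real (kern ?n 0 q x) * ?e q / 4))"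
    unfolding sublaplacian_wave_derivs[OF c] wave_kern numeral_2_eq_2 One_nat_def
    using adm_integrable[OF c card_ge_1, of 1 x "snd x"] adm_integrable[OF c card_ge_1, of 2 x "snd x"]
      adm_integrable[OF ctt card_ge_1, of 0 x "snd x"]
    by (simp add: numeral_2_eq_2)
  also have "\<dots> = (LINT q|nu. of_real (xi ?n q) * c q * of_real (kern ?n 0 q x) * ?e q)"
  proof (rule Bochner_Integration.integral_cong[OF refl])
    fix q :: "nat \<times> real"
    define l :: real where "l = \<bar>snd q\<bar>"
    define s where "s = l * (norm (fst x))\<^sup>2 / 2"
    let ?L = "\<lambda>m. lagd m (?n - 1) (fst q) s"
    have ode: "s * ?L 2 + real ?n * ?L 1 + (real (fst q) + real ?n / 2 - s / 4) * ?L 0 = 0"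
      using lagd_ode[of s "?n - 1" "fst q"] by simp
    have "- 2 * real ?n * (l * ?L 1) - (norm (fst x))\<^sup>2 * (l\<^sup>2 * ?L 2 - l\<^sup>2 * ?L 0 / 4)
      = - 2 * l * (s * ?L 2 + real ?n * ?L 1 - s / 4 * ?L 0)"
      by (simp add: s_def power2_eq_square algebra_simps)
    also have "s * ?L 2 + real ?n * ?L 1 - s / 4 * ?L 0 = - (real (fst q) + real ?n / 2) * ?L 0"
      using ode by (simp add: algebra_simps)
    also have "- 2 * l * (- (real (fst q) + real ?n / 2) * ?L 0) = l * real (2 * fst q + ?n) * ?L 0"
      by (simp add: field_simps)
    finally have "- 2 * real ?n * (l * ?L 1) - (norm (fst x))\<^sup>2 * (l\<^sup>2 * ?L 2 - l\<^sup>2 * ?L 0 / 4) = l * real (2 * fst q + ?n) * ?L 0" .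
    then have k: "- 2 * real ?n * kern ?n 1 q x - (norm (fst x))\<^sup>2 * (kern ?n 2 q x - (snd q)\<^sup>2 * kern ?n 0 q x / 4) = xi ?n q * kern ?n 0 q x"
      unfolding kern_def xi_def l_def[symmetric] s_def[symmetric] by (simp add: l_def)
    have tt: "tderiv (tderiv c) q = - of_real ((snd q)\<^sup>2) * c q"
      by (simp add: complex_eq_iff tderiv_def power2_eq_square algebra_simps)
    have "- 2 * of_nat ?n * (c q * of_real (kern ?n 1 q x) * ?e q)
     - of_real ((norm (fst x))\<^sup>2) * (c q * of_real (kern ?n 2 q x) * ?e q + tderiv (tderiv c) q * of_real (kern ?n 0 q x) * ?e q / 4)
      = c q * ?e q * of_real (- 2 * real ?n * kern ?n 1 q x - (norm (fst x))\<^sup>2 * (kern ?n 2 q x - (snd q)\<^sup>2 * kern ?n 0 q x / 4))"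
      unfolding tt by (simp add: algebra_simps)
    then show "- 2 * of_nat ?n * (c q * of_real (kern ?n 1 q x) * ?e q)
     - of_real ((norm (fst x))\<^sup>2) * (c q * of_real (kern ?n 2 q x) * ?e q + tderiv (tderiv c) q * of_real (kern ?n 0 q x) * ?e q / 4)
      = of_real (xi ?n q) * c q * of_real (kern ?n 0 q x) * ?e q"
      unfolding k by (simp add: mult_ac)
  qed
  finally show "sublaplacian (wave 0 c) x = wave 0 (\<lambda>q. of_real (xi ?n q) * c q) x"
    by (simp add: wave_kern)
qed

lemma sublaplacian_pow_wave:
  assumes c: "adm CARD('n) c"
  shows "(sublaplacian ^^ J) (wave 0 c) = (wave 0 (\<lambda>q. of_real (xi CARD('n) q ^ J) * c q) :: 'n::finite heis \<Rightarrow> complex)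
    \<and> adm CARD('n) (\<lambda>q. of_real (xi CARD('n) q ^ J) * c q)"
proof (induction J)
  case (Suc J)
  then have a: "adm CARD('n) (\<lambda>q. of_real (xi CARD('n) q ^ J) * c q)" by blast
  show ?case using Suc sublaplacian_wave[OF a] adm_xi[OF a] by (simp add: mult_ac)
qed (use c in simp)

section \<open>Smooth functions on the fan\<close>

lemma integrable_inverse_1_square: "integrable lborel (\<lambda>x::real. 1 / (1 + x\<^sup>2))"
  using integrable_inverse_1_plus_square by (simp add: set_integrable_def inverse_eq_divide)

lemma fan_mult_le_pow:
  assumes "n \<ge> 1" shows "fan_mult n q \<le> real (2 * fst q + n) ^ (n - 1)"
proof -
  have "(fst q + (n - 1)) choose fst q = (fst q + (n - 1)) choose (n - 1)"
    by (subst binomial_symmetric) auto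
  also have "\<dots> \<le> (fst q + (n - 1)) ^ (n - 1)"
    by (rule binomial_le_pow) simp
  also have "\<dots> \<le> (2 * fst q + n) ^ (n - 1)"
    by (rule power_mono) auto
  finally show ?thesis unfolding fan_mult_def by (metis of_nat_le_iff of_nat_power)
qed

text \<open>Origin of the exponent n + 2: with M = 2j+n the numerator is at most \<xi>^n / M, so n
  powers of 1 + \<xi> compensate it. The two others make the \<lambda>-integral a constant times
  1/M, since \<xi> = M|\<lambda>|, and the sum of 1/M^2 over j converges.\<close>

lemma integrable_plancherel_weight:
  assumes n: "n \<ge> 1"
  shows "integrable nu (\<lambda>q. \<bar>snd q\<bar> ^ n * fan_mult n q / (1 + xi n q) ^ (n + 2))"
proof (rule Bochner_Integration.integrable_bound)
  let ?m = "\<lambda>j. real (2 * j + n)"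
  let ?h = "\<lambda>q::nat \<times> real. 1 / (?m (fst q) * (1 + (?m (fst q) * snd q)\<^sup>2))"
  have h [measurable]: "?h \<in> borel_measurable nu" by measurable
  show "integrable nu ?h"
  proof (rule integrableI_bounded[OF h])
    let ?K = "\<integral>\<^sup>+ x. ennreal (1 / (1 + x\<^sup>2)) \<partial>lborel"
    have K: "?K < \<infinity>"
      using integrable_inverse_1_square by (simp add: integrable_iff_bounded)
    have "(\<integral>\<^sup>+ q. ennreal (norm (?h q)) \<partial>nu) = (\<integral>\<^sup>+ j. \<integral>\<^sup>+ l. ennreal (norm (?h (j, l))) \<partial>lborel \<partial>count_space UNIV)"
      unfolding nu_def using h by (subst lborel.nn_integral_fst) (auto simp: nu_def)
    also have "\<dots> = (\<integral>\<^sup>+ j. ennreal (1 / (?m j)\<^sup>2) * ?K \<partial>count_space UNIV)"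
    proof (rule nn_integral_cong)
      fix j
      define m where "m = ?m j"
      have m: "m > 0" using n by (simp add: m_def)
      have "?K = ennreal (m) * (\<integral>\<^sup>+ l. ennreal (1 / (1 + (m * l)\<^sup>2)) \<partial>lborel)"
        using nn_integral_real_affine[of "\<lambda>x. ennreal (1 / (1 + x\<^sup>2))" "m" 0] m by simp
      have "ennreal (1 / (m)\<^sup>2) * ?K = ennreal (1 / m) * (\<integral>\<^sup>+ l. ennreal (1 / (1 + (m * l)\<^sup>2)) \<partial>lborel)"
      proof -
        have "ennreal (1 / m\<^sup>2) * ennreal m = ennreal (1 / m)"
          using m by (simp add: ennreal_mult[symmetric] power2_eq_square)
        then show ?thesis using \<open>?K = _\<close> by (simp only: mult.assoc[symmetric])
      qed
      also have "\<dots> = (\<integral>\<^sup>+ l. ennreal (1 / m) * ennreal (1 / (1 + (m * l)\<^sup>2)) \<partial>lborel)"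
        by (subst nn_integral_cmult) auto
      also have "\<dots> = (\<integral>\<^sup>+ l. ennreal (norm (?h (j, l))) \<partial>lborel)"
        using m by (intro nn_integral_cong) (simp only: norm_divide norm_one real_norm_def abs_mult fst_conv snd_conv m_def[symmetric]; simp add: ennreal_mult[symmetric] add_nonneg_nonneg abs_mult)
      finally show "(\<integral>\<^sup>+ l. ennreal (norm (?h (j, l))) \<partial>lborel) = ennreal (1 / (?m j)\<^sup>2) * ?K" by (simp add: m_def)
    qed
    also have "\<dots> = (\<Sum>j. ennreal (1 / (?m j)\<^sup>2)) * ?K"
      by (subst nn_integral_multc) (auto simp: nn_integral_count_space_nat)
    also have "\<dots> < \<infinity>"
    proof -
      have "summable (\<lambda>j. 1 / (?m j)\<^sup>2)"
      proof (rule summable_comparison_test')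
        show "summable (\<lambda>j. 1 / (real (Suc j))\<^sup>2)"
          using inverse_power_summable[of 2, where 'a = real] by (subst summable_Suc_iff) (simp add: inverse_eq_divide)
        show "norm (1 / (?m j)\<^sup>2) \<le> 1 / (real (Suc j))\<^sup>2" for j
          using n by (auto intro!: divide_left_mono power_mono)
      qed
      then have "(\<Sum>j. ennreal (1 / (?m j)\<^sup>2)) \<noteq> \<infinity>"
        unfolding infinity_ennreal_def by (rule ennreal_suminf_neq_top) simp
      then show ?thesis using K by (simp add: ennreal_mult_less_top top.not_eq_extremum)
    qed
    finally show "(\<integral>\<^sup>+ q. ennreal (norm (?h q)) \<partial>nu) < \<infinity>" .
  qed
  show "(\<lambda>q. \<bar>snd q\<bar> ^ n * fan_mult n q / (1 + xi n q) ^ (n + 2)) \<in> borel_measurable nu" by measurable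
  show "AE q in nu. norm (\<bar>snd q\<bar> ^ n * fan_mult n q / (1 + xi n q) ^ (n + 2)) \<le> norm (?h q)"
  proof (rule AE_I2)
    fix q :: "nat \<times> real"
    let ?M = "?m (fst q)" and ?x = "xi n q"
    have m: "?M > 0" using n by simp
    have x: "?x = \<bar>snd q\<bar> * ?M" by (simp add: xi_def)
    have "?M * (\<bar>snd q\<bar> ^ n * fan_mult n q) \<le> ?M * (\<bar>snd q\<bar> ^ n * ?M ^ (n - 1))"
      using fan_mult_le_pow[OF n, of q] m by (intro mult_left_mono) auto
    also have "\<dots> = ?x ^ n"
    proof -
      have "?M ^ n = ?M * ?M ^ (n - 1)" using n by (simp only: power_eq_if[of _ n]) simp
      then show ?thesis unfolding x power_mult_distrib by (simp only: mult_ac)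
    qed
    also have "\<dots> \<le> (1 + ?x) ^ n" by (intro power_mono) auto
    finally have 1: "?M * (\<bar>snd q\<bar> ^ n * fan_mult n q) \<le> (1 + ?x) ^ n" .
    have "(?M * snd q)\<^sup>2 = ?x\<^sup>2" unfolding x by (simp add: power_mult_distrib)
    then have 2: "1 + (?M * snd q)\<^sup>2 \<le> (1 + ?x)\<^sup>2" by (simp add: power2_sum)
    have "(?M * (\<bar>snd q\<bar> ^ n * fan_mult n q)) * (1 + (?M * snd q)\<^sup>2) \<le> (1 + ?x) ^ n * (1 + ?x)\<^sup>2"
      by (intro mult_mono 1 2) (auto intro!: add_nonneg_nonneg)
    also have "\<dots> = (1 + ?x) ^ (n + 2)" by (simp only: power_add)
    finally have "(\<bar>snd q\<bar> ^ n * fan_mult n q) * (?M * (1 + (?M * snd q)\<^sup>2)) \<le> 1 * (1 + ?x) ^ (n + 2)"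
      by (simp only: mult_ac mult_1)
    moreover have "0 < ?M * (1 + (?M * snd q)\<^sup>2)" using m by (intro mult_pos_pos add_pos_nonneg) auto
    moreover have "0 < (1 + ?x) ^ (n + 2)" by (intro zero_less_power add_pos_nonneg) auto
    ultimately have "\<bar>snd q\<bar> ^ n * fan_mult n q / (1 + ?x) ^ (n + 2) \<le> ?h q"
      by (simp only: pos_divide_le_eq times_divide_eq_left mult_1 pos_le_divide_eq)
    then show "norm (\<bar>snd q\<bar> ^ n * fan_mult n q / (1 + xi n q) ^ (n + 2)) \<le> norm (?h q)"
      by (simp add: abs_mult)
  qed
qed

lemma fan_coeff_measurable:
  assumes f: "f \<in> borel_measurable borel"
  shows "fan_coeff n f \<in> borel_measurable nu"
proof -
  have \<phi>: "(\<lambda>q::nat\<times>real. (\<bar>snd q\<bar> * real (2 * fst q + n), snd q)) \<in> measurable nu borel"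
    by (subst borel_prod[symmetric]) measurable
  have [measurable]: "(\<lambda>q. f (\<bar>snd q\<bar> * real (2 * fst q + n), snd q)) \<in> borel_measurable nu"
    by (rule measurable_compose[OF \<phi> f])
  show ?thesis unfolding fan_coeff_def[abs_def] by measurable
qed

lemma cmod_fan_coeff: "cmod (fan_coeff n f q) = \<bar>snd q\<bar> ^ n / (2 * pi) ^ (n + 1) * cmod (f (xi n q, snd q))"
  by (simp add: fan_coeff_def xi_def norm_mult norm_divide norm_power)

lemma adm_fan_coeff:
  assumes f: "f \<in> borel_measurable borel" and n: "n \<ge> 1"
    and bd: "\<And>k. \<exists>C. \<forall>\<xi> l. 0 \<le> \<xi> \<longrightarrow> cmod (f (\<xi>, l)) * (1 + \<xi>) ^ k \<le> C"
  shows "adm n (fan_coeff n f)"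
  unfolding adm_def
proof (intro conjI allI fan_coeff_measurable[OF f])
  fix k
  obtain C where C: "\<And>\<xi> l. 0 \<le> \<xi> \<Longrightarrow> cmod (f (\<xi>, l)) * (1 + \<xi>) ^ (k + (n + 2)) \<le> C"
    using bd[of "k + (n + 2)"] by blast
  show "integrable nu (\<lambda>q. cmod (fan_coeff n f q) * fan_mult n q * (1 + xi n q) ^ k)"
  proof (rule Bochner_Integration.integrable_bound[OF integrable_mult_right[OF integrable_plancherel_weight[OF n], of "C / (2 * pi) ^ (n + 1)"]])
    show "(\<lambda>q. cmod (fan_coeff n f q) * fan_mult n q * (1 + xi n q) ^ k) \<in> borel_measurable nu"
      using fan_coeff_measurable[OF f, of n] by measurable
    show "AE q in nu. norm (cmod (fan_coeff n f q) * fan_mult n q * (1 + xi n q) ^ k)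
       \<le> norm (C / (2 * pi) ^ (n + 1) * (\<bar>snd q\<bar> ^ n * fan_mult n q / (1 + xi n q) ^ (n + 2)))"
    proof (rule AE_I2)
      fix q
      let ?x = "1 + xi n q" and ?w = "\<bar>snd q\<bar> ^ n / (2 * pi) ^ (n + 1) * fan_mult n q"
      have x: "?x > 0" using xi_nonneg[of n q] by linarith
      have "cmod (f (xi n q, snd q)) * ?x ^ k * ?x ^ (n + 2) \<le> C"
        using C[of "xi n q" "snd q"] by (simp add: power_add mult_ac)
      then have "cmod (f (xi n q, snd q)) * ?x ^ k \<le> C / ?x ^ (n + 2)"
        using x by (simp add: pos_le_divide_eq)
      then have "?w * (cmod (f (xi n q, snd q)) * ?x ^ k) \<le> ?w * (C / ?x ^ (n + 2))"
        by (intro mult_left_mono) auto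
      then have "cmod (fan_coeff n f q) * fan_mult n q * ?x ^ k \<le> C / (2 * pi) ^ (n + 1) * (\<bar>snd q\<bar> ^ n * fan_mult n q / ?x ^ (n + 2))"
        unfolding cmod_fan_coeff by (simp add: mult_ac)
      then show "norm (cmod (fan_coeff n f q) * fan_mult n q * (1 + xi n q) ^ k)
       \<le> norm (C / (2 * pi) ^ (n + 1) * (\<bar>snd q\<bar> ^ n * fan_mult n q / (1 + xi n q) ^ (n + 2)))"
        using abs_ge_self[of "C / (2 * pi) ^ (n + 1) * (\<bar>snd q\<bar> ^ n * fan_mult n q / ?x ^ (n + 2))"] x
        by (subst (1) real_norm_def, subst abs_of_nonneg) (auto simp del: power_Suc)
    qed
  qed
qed

section \<open>Functions of finite smoothness on the plane, with explicit bounds\<close>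

declare split_paired_All [simp del]

text \<open>\<open>CN N B f\<close>: \<open>f\<close> is of class \<open>C\<^sup>N\<close> and its derivatives of order at most \<open>N\<close> are bounded by \<open>B\<close>.\<close>

primrec CN :: "nat \<Rightarrow> real \<Rightarrow> (real \<times> real \<Rightarrow> complex) \<Rightarrow> bool" where
  "CN 0 B f \<longleftrightarrow> continuous_on UNIV f \<and> (\<forall>p. cmod (f p) \<le> B)"
| "CN (Suc N) B f \<longleftrightarrow> (\<forall>p. cmod (f p) \<le> B) \<and>
     (\<exists>f1 f2. (\<forall>p. (f has_derivative (\<lambda>h. fst h *\<^sub>R f1 p + snd h *\<^sub>R f2 p)) (at p)) \<and> CN N B f1 \<and> CN N B f2)"

definition box_supp :: "real \<Rightarrow> (real \<times> real \<Rightarrow> complex) \<Rightarrow> bool" where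
  "box_supp R f \<longleftrightarrow> (\<forall>p. \<bar>fst p\<bar> > R \<or> \<bar>snd p\<bar> > R \<longrightarrow> f p = 0)"

lemma CN_bound: "CN N B f \<Longrightarrow> cmod (f p) \<le> B"
  by (cases N) auto

lemma CN_nonneg: "CN N B f \<Longrightarrow> 0 \<le> B"
  using CN_bound[of N B f] norm_ge_zero order_trans by blast

lemma CN_continuous: "CN N B f \<Longrightarrow> continuous_on UNIV f"
proof (cases N)
  case (Suc M)
  assume "CN N B f"
  then obtain f1 f2 where "\<And>p. (f has_derivative (\<lambda>h. fst h *\<^sub>R f1 p + snd h *\<^sub>R f2 p)) (at p)"
    unfolding Suc CN.simps by blast
  then show ?thesis by (intro continuous_at_imp_continuous_on ballI has_derivative_continuous)
qed simp

lemma CN_SucI: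
  assumes "\<And>p. cmod (f p) \<le> B"
    and "\<And>p. (f has_derivative (\<lambda>h. fst h *\<^sub>R f1 p + snd h *\<^sub>R f2 p)) (at p)" "CN N B f1" "CN N B f2"
  shows "CN (Suc N) B f"
  unfolding CN.simps using assms by blast

lemma CN_SucE:
  assumes "CN (Suc N) B f"
  obtains f1 f2 where "\<And>p. (f has_derivative (\<lambda>h. fst h *\<^sub>R f1 p + snd h *\<^sub>R f2 p)) (at p)" "CN N B f1" "CN N B f2"
  using assms unfolding CN.simps by blast

lemma CN_mono: "CN N B f \<Longrightarrow> B \<le> B' \<Longrightarrow> CN N B' f"
proof (induction N arbitrary: f)
  case 0
  then show ?case by (auto intro: order_trans)
next
  case (Suc N)
  show ?case
    by (rule CN_SucE[OF Suc.prems(1)], rule CN_SucI, rule order_trans[OF CN_bound[OF Suc.prems(1)] Suc.prems(2)])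
       (blast intro: Suc.IH Suc.prems(2))+
qed

lemma CN_Suc_imp: "CN (Suc N) B f \<Longrightarrow> CN N B f"
proof (induction N arbitrary: f)
  case 0
  then show ?case using CN_continuous[OF 0] CN_bound[OF 0] by simp
next
  case (Suc N)
  show ?case
    by (rule CN_SucE[OF Suc.prems], rule CN_SucI, rule CN_bound[OF Suc.prems]) (blast intro: Suc.IH)+
qed

lemma CN_le: "CN N B f \<Longrightarrow> M \<le> N \<Longrightarrow> CN M B f"
  by (induction N) (auto simp: le_Suc_eq simp del: CN.simps dest: CN_Suc_imp)

lemma CN_add: "CN N A f \<Longrightarrow> CN N B g \<Longrightarrow> CN N (A + B) (\<lambda>p. f p + g p)"
proof (induction N arbitrary: f g)
  case 0
  then show ?case by (auto intro!: continuous_intros norm_triangle_mono)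
next
  case (Suc N)
  obtain f1 f2 g1 g2 where d: "\<And>p. (f has_derivative (\<lambda>h. fst h *\<^sub>R f1 p + snd h *\<^sub>R f2 p)) (at p)"
     "\<And>p. (g has_derivative (\<lambda>h. fst h *\<^sub>R g1 p + snd h *\<^sub>R g2 p)) (at p)"
    and c: "CN N A f1" "CN N A f2" "CN N B g1" "CN N B g2"
    using Suc.prems unfolding CN.simps by blast
  show ?case
  proof (rule CN_SucI[where ?f1.0 = "\<lambda>p. f1 p + g1 p" and ?f2.0 = "\<lambda>p. f2 p + g2 p"])
    show "((\<lambda>p. f p + g p) has_derivative (\<lambda>h. fst h *\<^sub>R (f1 p + g1 p) + snd h *\<^sub>R (f2 p + g2 p))) (at p)" for p
      by (rule has_derivative_eq_rhs[OF has_derivative_add[OF d]]) (auto simp: algebra_simps)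
  qed (use Suc.prems CN_bound in \<open>blast intro: norm_triangle_mono Suc.IH c\<close>)+
qed

lemma CN_cmult: "CN N B f \<Longrightarrow> CN N (cmod c * B) (\<lambda>p. c * f p)"
proof (induction N arbitrary: f)
  case 0
  then show ?case by (auto intro!: continuous_intros mult_left_mono simp: norm_mult)
next
  case (Suc N)
  obtain f1 f2 where d: "\<And>p. (f has_derivative (\<lambda>h. fst h *\<^sub>R f1 p + snd h *\<^sub>R f2 p)) (at p)"
    and c: "CN N B f1" "CN N B f2"
    using Suc.prems unfolding CN.simps by blast
  show ?case
  proof (rule CN_SucI[where ?f1.0 = "\<lambda>p. c * f1 p" and ?f2.0 = "\<lambda>p. c * f2 p"])
    show "((\<lambda>p. c * f p) has_derivative (\<lambda>h. fst h *\<^sub>R (c * f1 p) + snd h *\<^sub>R (c * f2 p))) (at p)" for p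
      by (rule has_derivative_eq_rhs[OF has_derivative_mult_right[OF d]]) (auto simp: algebra_simps)
    show "cmod (c * f p) \<le> cmod c * B" for p
      using CN_bound[OF Suc.prems, of p] by (simp add: norm_mult mult_left_mono)
  qed (intro Suc.IH c)+
qed

lemma CN_mult: "CN N A f \<Longrightarrow> CN N B g \<Longrightarrow> CN N (2 ^ N * (A * B)) (\<lambda>p. f p * g p)"
proof (induction N arbitrary: f g)
  case 0
  then show ?case by (auto intro!: continuous_intros mult_mono simp: norm_mult intro: order_trans[OF norm_ge_zero])
next
  case (Suc N)
  have AB: "0 \<le> A" "0 \<le> B" using Suc.prems CN_nonneg by blast+
  obtain f1 f2 g1 g2 where d: "\<And>p. (f has_derivative (\<lambda>h. fst h *\<^sub>R f1 p + snd h *\<^sub>R f2 p)) (at p)"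
     "\<And>p. (g has_derivative (\<lambda>h. fst h *\<^sub>R g1 p + snd h *\<^sub>R g2 p)) (at p)"
    and c: "CN N A f1" "CN N A f2" "CN N B g1" "CN N B g2"
    using Suc.prems unfolding CN.simps by blast
  note fg = Suc.prems[THEN CN_Suc_imp]
  have e: "2 ^ N * (A * B) + 2 ^ N * (A * B) = 2 ^ Suc N * (A * B)" by simp
  show ?case
  proof (rule CN_SucI[where ?f1.0 = "\<lambda>p. f p * g1 p + f1 p * g p" and ?f2.0 = "\<lambda>p. f p * g2 p + f2 p * g p"])
    show "((\<lambda>p. f p * g p) has_derivative (\<lambda>h. fst h *\<^sub>R (f p * g1 p + f1 p * g p) + snd h *\<^sub>R (f p * g2 p + f2 p * g p))) (at p)" for p
      by (rule has_derivative_eq_rhs[OF has_derivative_mult[OF d]]) (auto simp: algebra_simps)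
    show "cmod (f p * g p) \<le> 2 ^ Suc N * (A * B)" for p
    proof -
      have "cmod (f p * g p) \<le> A * B"
        using CN_bound[OF Suc.prems(1), of p] CN_bound[OF Suc.prems(2), of p] AB by (auto simp: norm_mult intro!: mult_mono)
      also have "\<dots> \<le> 2 ^ Suc N * (A * B)"
        using mult_right_mono[OF one_le_power[of "2::real" "Suc N"], of "A * B"] AB by (simp del: power_Suc)
      finally show ?thesis .
    qed
  qed (unfold e[symmetric]; intro CN_add Suc.IH fg c)+
qed

lemma box_supp_deriv:
  assumes d: "\<And>p. (f has_derivative (\<lambda>h. fst h *\<^sub>R f1 p + snd h *\<^sub>R f2 p)) (at p)" and s: "box_supp R f"
  shows "box_supp R f1" "box_supp R f2"
proof -
  have "f1 p = 0 \<and> f2 p = 0" if p: "\<bar>fst p\<bar> > R \<or> \<bar>snd p\<bar> > R" for p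
  proof -
    have op: "open {p::real \<times> real. \<bar>fst p\<bar> > R \<or> \<bar>snd p\<bar> > R}"
      by (intro open_Collect_disj open_Collect_less continuous_intros)
    have "((\<lambda>_. 0) has_derivative (\<lambda>h. fst h *\<^sub>R f1 p + snd h *\<^sub>R f2 p)) (at p)"
      by (rule has_derivative_transform_within_open[OF d op]) (use p s in \<open>auto simp: box_supp_def\<close>)
    then have "(\<lambda>h. fst h *\<^sub>R f1 p + snd h *\<^sub>R f2 p) = (\<lambda>h. 0)"
      by (rule has_derivative_unique) auto
    from fun_cong[OF this, of "(1, 0)"] fun_cong[OF this, of "(0, 1)"] show ?thesis by simp
  qed
  then show "box_supp R f1" "box_supp R f2" by (auto simp: box_supp_def)
qed

text \<open>K bounds the linear factor on the box that carries f, and its two constant derivatives.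
  A derivative can fall on this factor only once, so that differentiating N times adds at most N
  terms to the one with the factor intact; hence N + 1.\<close>

lemma CN_linear_mult:
  assumes "\<bar>a\<bar> \<le> K" "\<bar>b\<bar> \<le> K" "(\<bar>a\<bar> + \<bar>b\<bar>) * R \<le> K"
  shows "CN N B f \<Longrightarrow> box_supp R f \<Longrightarrow> CN N (K * (real N + 1) * B) (\<lambda>p. of_real (a * fst p + b * snd p) * f p)"
proof (induction N arbitrary: f)
  have K: "0 \<le> K" using assms(1) by linarith
  have bd: "cmod (of_real (a * fst p + b * snd p) * f p) \<le> K * B" if "box_supp R f" "\<And>p. cmod (f p) \<le> B" for f p
  proof (cases "\<bar>fst p\<bar> > R \<or> \<bar>snd p\<bar> > R")
    case True
    then show ?thesis using that K order_trans[OF norm_ge_zero that(2)[of p]] by (auto simp: box_supp_def)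
  next
    case False
    have "\<bar>a * fst p + b * snd p\<bar> \<le> \<bar>a\<bar> * \<bar>fst p\<bar> + \<bar>b\<bar> * \<bar>snd p\<bar>"
      using abs_triangle_ineq[of "a * fst p" "b * snd p"] by (simp add: abs_mult)
    also have "\<dots> \<le> \<bar>a\<bar> * R + \<bar>b\<bar> * R" using False by (intro add_mono mult_left_mono) auto
    also have "\<dots> \<le> K" using assms(3) by (simp add: algebra_simps)
    finally show ?thesis using that(2)[of p] K by (simp add: norm_mult mult_mono del: of_real_add)
  qed
  {
    case 0
    then show ?case using bd[where f = f] by (auto intro!: continuous_intros)
  next
    case (Suc N)
    have B: "0 \<le> B" using Suc.prems CN_nonneg by blast
    obtain f1 f2 where d: "\<And>p. (f has_derivative (\<lambda>h. fst h *\<^sub>R f1 p + snd h *\<^sub>R f2 p)) (at p)"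
      and c: "CN N B f1" "CN N B f2"
      using Suc.prems unfolding CN.simps by blast
    note s = box_supp_deriv[OF d Suc.prems(2)]
    have e: "CN N (K * (real (Suc N) + 1) * B) (\<lambda>p. of_real (a * fst p + b * snd p) * f' p + of_real c * f p)"
      if "CN N B f'" "box_supp R f'" "\<bar>c\<bar> \<le> K" for f' c
    proof (rule CN_mono[OF CN_add[OF Suc.IH[OF that(1,2)] CN_cmult[OF CN_Suc_imp[OF Suc.prems(1)]]]])
      show "K * (real N + 1) * B + cmod (complex_of_real c) * B \<le> K * (real (Suc N) + 1) * B"
        using mult_right_mono[OF that(3) B] by (simp add: algebra_simps)
    qed
    show ?case
    proof (rule CN_SucI[OF _ _ e[OF c(1) s(1) assms(1)] e[OF c(2) s(2) assms(2)]])
      show "((\<lambda>p. of_real (a * fst p + b * snd p) * f p) has_derivative (\<lambda>h. fst h *\<^sub>R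
         (of_real (a * fst p + b * snd p) * f1 p + of_real a * f p) + snd h *\<^sub>R (of_real (a * fst p + b * snd p) * f2 p + of_real b * f p))) (at p)" for p
        by (rule derivative_eq_intros d refl)+ (auto simp: algebra_simps scaleR_conv_of_real)
      have "K * B \<le> K * (real (Suc N) + 1) * B"
        using K B mult_right_mono[of 1 "real (Suc N) + 1" "K * B"] by (simp add: mult_ac)
      then show "cmod (of_real (a * fst p + b * snd p) * f p) \<le> K * (real (Suc N) + 1) * B" for p
        using bd[OF Suc.prems(2) CN_bound[OF Suc.prems(1)], where p = p] by linarith
    qed
  }
qed

text \<open>A derivative that falls on \<xi>^J gives J \<xi>^(J-1), which on the box is J/R times
  the bound R^J. So each of the N derivatives costs a factor 1 + J/R, whereas the growth R^J is that
  of the box.\<close>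

lemma CN_fst_power:
  assumes R: "0 < R"
  shows "CN N B f \<Longrightarrow> box_supp R f \<Longrightarrow> CN N (B * R ^ J * (1 + real J / R) ^ N) (\<lambda>p. of_real (fst p ^ J) * f p)"
proof (induction N arbitrary: f J)
  have bd: "cmod (of_real (fst p ^ J) * f p) \<le> B * R ^ J" if "box_supp R f" "\<And>p. cmod (f p) \<le> B" for f p J
  proof (cases "\<bar>fst p\<bar> > R")
    case True
    then show ?thesis using that R order_trans[OF norm_ge_zero that(2)[of p]] by (auto simp: box_supp_def)
  next
    case False
    then show ?thesis using that(2)[of p] R order_trans[OF norm_ge_zero that(2)[of p]]
      by (subst mult.commute) (auto simp: norm_mult norm_power intro!: mult_mono power_mono)
  qed
  {
    case 0
    then show ?case using bd[where f = f and J = J] by (auto intro!: continuous_intros)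
  next
    case (Suc N)
    have B: "0 \<le> B" using Suc.prems CN_nonneg by blast
    obtain f1 f2 where d: "\<And>p. (f has_derivative (\<lambda>h. fst h *\<^sub>R f1 p + snd h *\<^sub>R f2 p)) (at p)"
      and c: "CN N B f1" "CN N B f2"
      using Suc.prems unfolding CN.simps by blast
    note s = box_supp_deriv[OF d Suc.prems(2)]
    let ?b = "B * R ^ J * (1 + real J / R) ^ Suc N"
    have b: "B * R ^ J * (1 + real J / R) ^ N \<le> ?b"
      using R B by (intro mult_left_mono power_increasing mult_nonneg_nonneg) auto
    have e1: "CN N ?b (\<lambda>p. of_real (fst p ^ J) * f1 p + of_nat J * (of_real (fst p ^ (J - 1)) * f p))"
    proof (rule CN_mono[OF CN_add[OF Suc.IH[OF c(1) s(1)] CN_cmult[OF Suc.IH[OF CN_Suc_imp[OF Suc.prems(1)] Suc.prems(2)]]]])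
      have "real J * (B * R ^ (J - 1) * (1 + real (J - 1) / R) ^ N) \<le> real J * (B * R ^ (J - 1) * (1 + real J / R) ^ N)"
        using R B by (intro mult_left_mono power_mono) (auto intro!: divide_right_mono)
      also have "\<dots> = (real J / R) * (B * R ^ J * (1 + real J / R) ^ N)"
        using R by (cases J) (auto simp: field_simps)
      finally show "B * R ^ J * (1 + real J / R) ^ N + cmod (of_nat J) * (B * R ^ (J - 1) * (1 + real (J - 1) / R) ^ N) \<le> ?b"
        by (simp add: algebra_simps)
    qed
    show ?case
    proof (rule CN_SucI[OF _ _ e1 CN_mono[OF Suc.IH[OF c(2) s(2)] b]])
      show "((\<lambda>p. of_real (fst p ^ J) * f p) has_derivative (\<lambda>h. fst h *\<^sub>R
         (of_real (fst p ^ J) * f1 p + of_nat J * (of_real (fst p ^ (J - 1)) * f p)) + snd h *\<^sub>R (of_real (fst p ^ J) * f2 p))) (at p)" for p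
        by (rule derivative_eq_intros d refl)+ (auto simp: algebra_simps scaleR_conv_of_real)
      have "B * R ^ J * 1 \<le> ?b" using R B by (intro mult_left_mono one_le_power) auto
      then show "cmod (of_real (fst p ^ J) * f p) \<le> ?b" for p
        using bd[OF Suc.prems(2) CN_bound[OF Suc.prems(1)], where p = p and J = J] by linarith
    qed
  }
qed

section \<open>Averages over the gap between two rays\<close>

text \<open>A mean of f along the segment from \<xi> to \<xi> - 2\<lambda> at fixed \<lambda>. The
  weight is kept general because a derivative in \<lambda> multiplies it by -2\<theta>.\<close>

definition avg :: "(real \<Rightarrow> real) \<Rightarrow> (real \<times> real \<Rightarrow> complex) \<Rightarrow> real \<times> real \<Rightarrow> complex" where
  "avg w f p = integral {0..1} (\<lambda>\<theta>. w \<theta> *\<^sub>R f (fst p - 2 * \<theta> * snd p, snd p))"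

lemma avg_continuous_integrand:
  fixes f :: "real \<times> real \<Rightarrow> complex"
  assumes f: "continuous_on UNIV f" and w: "continuous_on {0..1} w"
  shows "continuous_on (U \<times> cbox 0 1) (\<lambda>(p, \<theta>). w \<theta> *\<^sub>R f (fst p - 2 * \<theta> * snd p, snd p))"
proof -
  have "continuous_on (U \<times> cbox 0 1) (\<lambda>q::(real\<times>real)\<times>real. w (snd q) *\<^sub>R f (fst (fst q) - 2 * snd q * snd (fst q), snd (fst q)))"
    by (intro continuous_intros continuous_on_compose2[OF w] continuous_on_compose2[OF f]) auto
  then show ?thesis by (simp add: case_prod_beta)
qed

lemma avg_integrable:
  fixes f :: "real \<times> real \<Rightarrow> complex"
  assumes f: "continuous_on UNIV f" and w: "continuous_on {0..1} w"
  shows "(\<lambda>\<theta>. w \<theta> *\<^sub>R f (fst p - 2 * \<theta> * snd p, snd p)) integrable_on {0..1}"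
  by (intro integrable_continuous_real continuous_intros w continuous_on_compose2[OF f]) auto

lemma avg_bound:
  assumes f: "continuous_on UNIV f" and w: "continuous_on {0..1} w"
    and B: "\<And>p. cmod (f p) \<le> B" and W: "\<And>\<theta>. \<theta> \<in> {0..1} \<Longrightarrow> \<bar>w \<theta>\<bar> \<le> W"
  shows "cmod (avg w f p) \<le> W * B"
proof -
  have "cmod (avg w f p) \<le> W * B * (1 - 0)"
    unfolding avg_def
  proof (rule integral_bound)
    show "continuous_on {0..1} (\<lambda>\<theta>. w \<theta> *\<^sub>R f (fst p - 2 * \<theta> * snd p, snd p))"
      by (intro continuous_intros w continuous_on_compose2[OF f]) auto
    show "norm (w \<theta> *\<^sub>R f (fst p - 2 * \<theta> * snd p, snd p)) \<le> W * B" if "\<theta> \<in> {0..1}" for \<theta>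
      unfolding norm_scaleR using order_trans[OF norm_ge_zero B] order_trans[OF abs_ge_zero W[OF that]]
      by (intro mult_mono B W that) auto
  qed auto
  then show ?thesis by simp
qed

lemma avg_has_derivative:
  assumes d: "\<And>p. (f has_derivative (\<lambda>h. fst h *\<^sub>R f1 p + snd h *\<^sub>R f2 p)) (at p)"
    and c: "continuous_on UNIV f1" "continuous_on UNIV f2" and w: "continuous_on {0..1} w"
  shows "(avg w f has_derivative (\<lambda>h. fst h *\<^sub>R avg w f1 p + snd h *\<^sub>R (avg w f2 p + avg (\<lambda>\<theta>. - 2 * \<theta> * w \<theta>) f1 p))) (at p)"
proof -
  let ?P = "\<lambda>p \<theta>. (fst p - 2 * \<theta> * snd p, snd p)"
  let ?w2 = "\<lambda>\<theta>. - 2 * \<theta> * w \<theta>"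
  \<comment> \<open>The derivative of the integrand in p as a bounded linear map, the form in which
    parameter integrals are differentiated. The part of it that multiplies the \<lambda>-component
    contains \<partial>f/\<partial>\<xi> as well, as the left end of the segment moves with
    \<lambda>.\<close>
  define D where "D p \<theta> = (blinfun_scaleR_left (w \<theta> *\<^sub>R f1 (?P p \<theta>)) o\<^sub>L fst_blinfun)
     + (blinfun_scaleR_left (w \<theta> *\<^sub>R f2 (?P p \<theta>) + ?w2 \<theta> *\<^sub>R f1 (?P p \<theta>)) o\<^sub>L snd_blinfun)" for p :: "real \<times> real" and \<theta>
  have D: "blinfun_apply (D p \<theta>) h = fst h *\<^sub>R (w \<theta> *\<^sub>R f1 (?P p \<theta>)) + snd h *\<^sub>R (w \<theta> *\<^sub>R f2 (?P p \<theta>) + ?w2 \<theta> *\<^sub>R f1 (?P p \<theta>))" for p \<theta> h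
    by (simp add: D_def plus_blinfun.rep_eq)
  have w2: "continuous_on {0..1} ?w2" by (intro continuous_intros w)
  have f: "continuous_on UNIV f"
    by (intro continuous_at_imp_continuous_on ballI has_derivative_continuous[OF d])
  have cD: "continuous_on (UNIV \<times> cbox 0 1) (\<lambda>(p, \<theta>). D p \<theta>)"
  proof -
    have "continuous_on (UNIV \<times> cbox 0 1) (\<lambda>q. blinfun_scaleR_left (g q) o\<^sub>L L)"
      if "continuous_on (UNIV \<times> cbox 0 1) g" for g :: "(real \<times> real) \<times> real \<Rightarrow> complex" and L :: "(real \<times> real) \<Rightarrow>\<^sub>L real"
      by (rule bounded_bilinear.continuous_on[OF bounded_bilinear_blinfun_compose
            bounded_linear.continuous_on[OF bounded_linear_blinfun_scaleR_left that] continuous_on_const])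
    note c' = this[OF avg_continuous_integrand[OF c(1) w, of UNIV]]
      this[OF continuous_on_add[OF avg_continuous_integrand[OF c(2) w, of UNIV] avg_continuous_integrand[OF c(1) w2, of UNIV]]]
    show ?thesis
      using continuous_on_add[OF c'(1)[of fst_blinfun] c'(2)[of snd_blinfun]]
      unfolding D_def case_prod_beta .
  qed
  have lb: "((\<lambda>p. integral (cbox 0 1) (\<lambda>\<theta>. w \<theta> *\<^sub>R f (?P p \<theta>))) has_derivative integral (cbox 0 1) (D p)) (at p within UNIV)"
  proof (rule leibniz_rule[OF _ _ cD])
    fix p :: "real \<times> real" and \<theta> :: real
    have P: "((\<lambda>p. ?P p \<theta>) has_derivative (\<lambda>h. ?P h \<theta>)) (at p)"
      by (auto intro!: derivative_eq_intros)
    have "((\<lambda>p. f (?P p \<theta>)) has_derivative (\<lambda>h. fst (?P h \<theta>) *\<^sub>R f1 (?P p \<theta>) + snd (?P h \<theta>) *\<^sub>R f2 (?P p \<theta>))) (at p)"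
      by (rule has_derivative_compose[OF P d])
    then show "((\<lambda>p. w \<theta> *\<^sub>R f (?P p \<theta>)) has_derivative blinfun_apply (D p \<theta>)) (at p within UNIV)"
      by (rule has_derivative_eq_rhs[OF has_derivative_scaleR_right]) (auto simp: D algebra_simps)
    show "(\<lambda>\<theta>. w \<theta> *\<^sub>R f (?P p \<theta>)) integrable_on cbox 0 1"
      using avg_integrable[OF f w, of p] by simp
  qed auto
  have eq: "blinfun_apply (integral (cbox 0 1) (D p)) h = fst h *\<^sub>R avg w f1 p + snd h *\<^sub>R (avg w f2 p + avg ?w2 f1 p)" for h
  proof -
    have "D p integrable_on cbox 0 1"
      by (intro integrable_continuous continuous_on_compose2[OF cD, of _ "\<lambda>\<theta>. (p, \<theta>)", unfolded case_prod_conv] continuous_intros) auto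
    then have "blinfun_apply (integral (cbox 0 1) (D p)) h = integral (cbox 0 1) (\<lambda>\<theta>. blinfun_apply (D p \<theta>) h)"
      by (rule blinfun_apply_integral)
    also have "\<dots> = fst h *\<^sub>R avg w f1 p + snd h *\<^sub>R (avg w f2 p + avg ?w2 f1 p)"
      unfolding D avg_def cbox_interval
      by (intro integral_unique has_integral_add has_integral_cmul integrable_integral avg_integrable c w w2)
    finally show ?thesis .
  qed
  have "avg w f = (\<lambda>p. integral (cbox 0 1) (\<lambda>\<theta>. w \<theta> *\<^sub>R f (?P p \<theta>)))"
    by (intro ext) (simp only: avg_def cbox_interval)
  then show ?thesis using has_derivative_eq_rhs[OF lb ext[OF eq]] by (simp only:)
qed

text \<open>The \<lambda>-derivative is one average with weight bound W and one with weight bound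
  2W; together they account for a factor 3 per derivative.\<close>

lemma CN_avg:
  "CN N B f \<Longrightarrow> continuous_on {0..1} w \<Longrightarrow> (\<And>\<theta>. \<theta> \<in> {0..1} \<Longrightarrow> \<bar>w \<theta>\<bar> \<le> W) \<Longrightarrow> CN N (3 ^ N * W * B) (avg w f)"
proof (induction N arbitrary: f w W)
  case 0
  then have f: "continuous_on UNIV f" and B: "\<And>p. cmod (f p) \<le> B" by auto
  have "continuous_on UNIV (avg w f)"
    unfolding avg_def[abs_def] cbox_interval[symmetric]
    using avg_continuous_integrand[OF f 0(2), of UNIV]
    by (intro integral_continuous_on_param) auto
  then show ?case using avg_bound[OF f 0(2) B 0(3)] by simp
next
  case (Suc N)
  obtain f1 f2 where d: "\<And>p. (f has_derivative (\<lambda>h. fst h *\<^sub>R f1 p + snd h *\<^sub>R f2 p)) (at p)"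
    and c: "CN N B f1" "CN N B f2"
    using Suc.prems unfolding CN.simps by blast
  have B: "0 \<le> B" using Suc.prems CN_nonneg by blast
  have W: "0 \<le> W" using Suc.prems(3)[of 0] by auto
  let ?w2 = "\<lambda>\<theta>. - 2 * \<theta> * w \<theta>"
  have w2: "continuous_on {0..1} ?w2" by (intro continuous_intros Suc.prems)
  have w2b: "\<bar>?w2 \<theta>\<bar> \<le> 2 * W" if "\<theta> \<in> {0..1}" for \<theta>
    using mult_mono[OF _ Suc.prems(3)[OF that], of "\<bar>\<theta>\<bar>" 1] that by (simp add: abs_mult)
  have WB: "0 \<le> 3 ^ N * W * B" using W B by simp
  show ?case
  proof (rule CN_SucI[OF _ avg_has_derivative[OF d CN_continuous[OF c(1)] CN_continuous[OF c(2)] Suc.prems(2)]])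
    show "cmod (avg w f p) \<le> 3 ^ Suc N * W * B" for p
    proof -
      have "cmod (avg w f p) \<le> W * B"
        using Suc.prems CN_continuous CN_bound by (intro avg_bound) blast+
      also have "\<dots> \<le> 3 ^ Suc N * (W * B)"
        using mult_right_mono[OF one_le_power[of "3::real" "Suc N"], of "W * B"] W B by (simp del: power_Suc)
      finally show ?thesis by (simp add: mult.assoc)
    qed
    show "CN N (3 ^ Suc N * W * B) (avg w f1)"
      by (rule CN_mono[OF Suc.IH[OF c(1) Suc.prems(2,3)]]) (use WB W B in \<open>auto simp: mult.assoc mult_nonneg_nonneg\<close>)
    show "CN N (3 ^ Suc N * W * B) (\<lambda>p. avg w f2 p + avg ?w2 f1 p)"
      by (rule CN_mono[OF CN_add[OF Suc.IH[OF c(2) Suc.prems(2,3)] Suc.IH[OF c(1) w2 w2b]]]) auto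
  qed
qed

text \<open>For |\<lambda>| at most R the segment has length at most 2R, so the support moves by at
  most 2R.\<close>

lemma box_supp_avg:
  assumes "box_supp R f" "0 \<le> R" shows "box_supp (3 * R) (avg w f)"
  unfolding box_supp_def
proof (intro allI impI)
  fix p :: "real \<times> real" assume p: "\<bar>fst p\<bar> > 3 * R \<or> \<bar>snd p\<bar> > 3 * R"
  have "w \<theta> *\<^sub>R f (fst p - 2 * \<theta> * snd p, snd p) = 0" if "\<theta> \<in> {0..1}" for \<theta>
  proof (cases "\<bar>snd p\<bar> > R")
    case False
    have "\<bar>2 * \<theta> * snd p\<bar> \<le> 2 * R" using that False mult_mono[of "\<theta>" 1 "\<bar>snd p\<bar>" R] by (simp add: abs_mult)
    then have "\<bar>fst p - 2 * \<theta> * snd p\<bar> > R" using p False assms(2) by linarith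
    then show ?thesis using assms(1) by (simp add: box_supp_def)
  qed (use assms(1) in \<open>simp add: box_supp_def\<close>)
  then show "avg w f p = 0"
    unfolding avg_def by (intro integral_unique has_integral_is_0)
qed

text \<open>Taylor's formula at distance \<open>-2\<lambda>\<close>, the spacing of two neighbouring rays of the fan.\<close>

lemma avg_taylor:
  assumes d: "\<And>p. (f has_derivative (\<lambda>h. fst h *\<^sub>R f1 p + snd h *\<^sub>R f2 p)) (at p)"
    and d1: "\<And>p. (f1 has_derivative (\<lambda>h. fst h *\<^sub>R f11 p + snd h *\<^sub>R f12 p)) (at p)"
  shows "of_real (4 * l\<^sup>2) * avg (\<lambda>\<theta>. 1 - \<theta>) f11 (\<xi>, l) = f (\<xi> - 2 * l, l) - f (\<xi>, l) + of_real (2 * l) * f1 (\<xi>, l)"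
proof -
  let ?P = "\<lambda>\<theta>. (\<xi> - 2 * \<theta> * l, l)"
  have P: "(?P has_derivative (\<lambda>h. (- 2 * h * l, 0))) (at \<theta> within {0..1})" for \<theta>
    by (auto intro!: derivative_eq_intros)
  have g: "((\<lambda>\<theta>. f (?P \<theta>)) has_vector_derivative of_real (- 2 * l) * f1 (?P \<theta>)) (at \<theta> within {0..1})" for \<theta>
    unfolding has_vector_derivative_def
    by (rule has_derivative_eq_rhs[OF has_derivative_compose[OF P d]]) (auto simp: scaleR_conv_of_real)
  have g1: "((\<lambda>\<theta>. f1 (?P \<theta>)) has_vector_derivative of_real (- 2 * l) * f11 (?P \<theta>)) (at \<theta> within {0..1})" for \<theta>
    unfolding has_vector_derivative_def
    by (rule has_derivative_eq_rhs[OF has_derivative_compose[OF P d1]]) (auto simp: scaleR_conv_of_real)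
  let ?G = "\<lambda>\<theta>. of_real (1 - \<theta>) * (of_real (- 2 * l) * f1 (?P \<theta>)) + f (?P \<theta>)"
  have "(?G has_vector_derivative of_real (4 * l\<^sup>2) * ((1 - \<theta>) *\<^sub>R f11 (?P \<theta>))) (at \<theta> within {0..1})" for \<theta>
  proof -
    have o: "((\<lambda>\<theta>. complex_of_real (1 - \<theta>)) has_vector_derivative of_real (- 1)) (at \<theta> within {0..1})"
      by (intro has_vector_derivative_of_real) (auto intro!: derivative_eq_intros)
    show ?thesis
      by (rule has_vector_derivative_eq_rhs[OF has_vector_derivative_add[OF has_vector_derivative_mult[OF o has_vector_derivative_mult_right[OF g1]] g]])
         (simp add: scaleR_conv_of_real power2_eq_square algebra_simps)
  qed
  then have "((\<lambda>\<theta>. of_real (4 * l\<^sup>2) * ((1 - \<theta>) *\<^sub>R f11 (?P \<theta>))) has_integral (?G 1 - ?G 0)) {0..1}"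
    by (intro fundamental_theorem_of_calculus) auto
  then have "integral {0..1} (\<lambda>\<theta>. of_real (4 * l\<^sup>2) * ((1 - \<theta>) *\<^sub>R f11 (?P \<theta>))) = ?G 1 - ?G 0"
    by (rule integral_unique)
  then have "of_real (4 * l\<^sup>2) * avg (\<lambda>\<theta>. 1 - \<theta>) f11 (\<xi>, l) = ?G 1 - ?G 0"
    unfolding avg_def fst_conv snd_conv by (simp only: Henstock_Kurzweil_Integration.integral_mult_right)
  then show ?thesis by (simp add: algebra_simps)
qed

text \<open>The total derivative exists by assumption and is determined by its values on the two
  unit vectors. These are again iterated directional derivatives of f, so the induction runs over
  all words in the unit vectors at once.\<close>

lemma schwartz_CN:
  assumes "schwartz f" shows "\<exists>B. CN N B f"
proof -
  have B: "(Basis :: (real \<times> real) set) = {(1, 0), (0, 1)}" by (auto simp: Basis_prod_def)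
  have "vs \<in> lists Basis \<Longrightarrow> \<exists>B. CN N B (foldr dir_deriv vs f)" for vs
  proof (induction N arbitrary: vs)
    let ?g = "\<lambda>vs. foldr dir_deriv vs f"
    have bd: "\<exists>B. \<forall>p. cmod (?g vs p) \<le> B" if "vs \<in> lists Basis" for vs
    proof -
      have "bounded (range (\<lambda>p. (1 + norm p) ^ 0 *\<^sub>R ?g vs p))"
        using assms that unfolding schwartz_def by blast
      then show ?thesis unfolding bounded_iff by auto
    qed
    have df: "?g vs differentiable (at p)" if "vs \<in> lists Basis" for vs p
      using assms that unfolding schwartz_def by blast
    {
      case 0
      have "continuous_on UNIV (?g vs)"
        using df[OF 0] by (intro continuous_at_imp_continuous_on ballI differentiable_imp_continuous_within)
      then show ?case using bd[OF 0] by auto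
    next
      case (Suc N)
      let ?f1 = "?g ((1, 0) # vs)" and ?f2 = "?g ((0, 1) # vs)"
      have l: "(1, 0) # vs \<in> lists Basis" "(0, 1) # vs \<in> lists Basis" using Suc.prems B by auto
      obtain B0 B1 B2 where b: "\<And>p. cmod (?g vs p) \<le> B0" "CN N B1 ?f1" "CN N B2 ?f2"
        using bd[OF Suc.prems] Suc.IH[OF l(1)] Suc.IH[OF l(2)] by blast
      have "(?g vs has_derivative (\<lambda>h. fst h *\<^sub>R ?f1 p + snd h *\<^sub>R ?f2 p)) (at p)" for p
      proof -
        obtain D where D: "(?g vs has_derivative D) (at p)"
          using df[OF Suc.prems, of p] unfolding differentiable_def by blast
        interpret D: bounded_linear D using D by (rule has_derivative_bounded_linear)
        have dd: "dir_deriv v (?g vs) p = D v" for v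
        proof (rule dir_deriv_eq)
          have "((\<lambda>s. p + s *\<^sub>R v) has_derivative (\<lambda>h. h *\<^sub>R v)) (at 0)"
            by (auto intro!: derivative_eq_intros)
          from has_derivative_compose[OF this, of "?g vs" D] D
          show "((\<lambda>s. ?g vs (p + s *\<^sub>R v)) has_vector_derivative D v) (at 0)"
            by (simp add: has_vector_derivative_def D.scaleR)
        qed
        have "D h = fst h *\<^sub>R ?f1 p + snd h *\<^sub>R ?f2 p" for h
        proof -
          have "h = fst h *\<^sub>R (1, 0) + snd h *\<^sub>R (0, 1)" by (cases h) simp
          then have "D h = D (fst h *\<^sub>R (1, 0) + snd h *\<^sub>R (0, 1))" by simp
          then show ?thesis by (simp only: D.add D.scaleR foldr.simps o_apply dd)
        qed
        then have "D = (\<lambda>h. fst h *\<^sub>R ?f1 p + snd h *\<^sub>R ?f2 p)" by blast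
        then show ?thesis using D by simp
      qed
      then have "CN (Suc N) (max B0 (max B1 B2)) (?g vs)"
        by (rule CN_SucI[rotated]) (use b in \<open>auto intro: CN_mono order_trans simp: le_max_iff_disj\<close>)
      then show ?case by blast
    }
  qed
  from this[of "[]"] show ?thesis by simp
qed

section \<open>Multiplication by \<open>\<A>\<close>\<close>

text \<open>One ray at fixed \<lambda>, without the constant (2 pi)^-(n+1). The sum over the rays is
  the integrand in \<lambda> of the inverse transform, the function to which integration by parts is
  applied.\<close>

definition ray_term :: "nat \<Rightarrow> (real \<times> real \<Rightarrow> complex) \<Rightarrow> 'n::finite heis \<Rightarrow> nat \<Rightarrow> real \<Rightarrow> complex" where
  "ray_term n f x j l = of_real (\<bar>l\<bar> ^ n) * f (\<bar>l\<bar> * real (2 * j + n), l) *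
     of_real (lagf (n - 1) j (\<bar>l\<bar> * (norm (fst x))\<^sup>2 / 2)) * exp (\<i> * of_real (l * snd x))"

definition ray_sum :: "nat \<Rightarrow> (real \<times> real \<Rightarrow> complex) \<Rightarrow> 'n::finite heis \<Rightarrow> real \<Rightarrow> complex" where
  "ray_sum n f x l = (LINT j|count_space UNIV. ray_term n f x j l)"

lemma ray_sum_eq_sum:
  assumes s: "box_supp R f" and J: "\<bar>l\<bar> * real (2 * J + n) > R"
  shows "ray_sum n f x l = (\<Sum>j<J. ray_term n f x j l)"
proof -
  have z: "ray_term n f x j l = 0" if "j \<ge> J" for j
  proof -
    have "\<bar>l\<bar> * real (2 * J + n) \<le> \<bar>l\<bar> * real (2 * j + n)" using that by (intro mult_left_mono) auto
    then have "f (\<bar>l\<bar> * real (2 * j + n), l) = 0" using s J by (auto simp: box_supp_def)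
    then show ?thesis by (simp add: ray_term_def)
  qed
  have sub: "{j. ray_term n f x j l \<noteq> 0} \<subseteq> {..<J}" using z by (auto simp: not_less[symmetric])
  then have "finite {j. ray_term n f x j l \<noteq> 0}" by (rule finite_subset) simp
  then have "ray_sum n f x l = (\<Sum>j | ray_term n f x j l \<noteq> 0. ray_term n f x j l)"
    using lebesgue_integral_count_space_finite_support[of UNIV "\<lambda>j. ray_term n f x j l"] by (simp add: ray_sum_def)
  also have "\<dots> = (\<Sum>j<J. ray_term n f x j l)"
    using sub by (intro sum.mono_neutral_left) auto
  finally show ?thesis .
qed

lemma ray_sum_eq_0:
  assumes "box_supp R f" "\<bar>l\<bar> > R" shows "ray_sum n f x l = 0"
proof -
  have "ray_term n f x j l = 0" for j using assms by (simp add: ray_term_def box_supp_def)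
  then show ?thesis by (simp add: ray_sum_def)
qed

lemma lagf_deriv: "(lagf a j has_real_derivative lagd 1 a j s) (at s)"
proof -
  have "lagf a j = lagd 0 a j" by (simp add: fun_eq_iff)
  then show ?thesis using lagd_deriv[of 0 a j s] by simp
qed

lemma lagf_continuous: "continuous_on UNIV (lagf a j)"
  using lagf_deriv[THEN DERIV_isCont] by (intro continuous_at_imp_continuous_on) simp

lemma ray_term_continuous:
  assumes f: "continuous_on UNIV f" shows "continuous_on UNIV (ray_term n f x j)"
  unfolding ray_term_def[abs_def]
  by (intro continuous_intros continuous_on_compose2[OF f] continuous_on_compose2[OF lagf_continuous]) auto

text \<open>One index works for all \<lambda>' near \<lambda>, so the sum over the rays is locally a
  fixed finite sum and may be differentiated termwise. The bound holds already at J - 1 because the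
  boundary term at J involves the ray before it.\<close>

lemma obtain_index:
  assumes "(l::real) \<noteq> 0" obtains J where "J \<ge> 1" "\<And>l'. \<bar>l'\<bar> > \<bar>l\<bar> / 2 \<Longrightarrow> \<bar>l'\<bar> * real (2 * (J - 1)) > R"
proof -
  obtain K :: nat where K: "real K > \<bar>R\<bar> / \<bar>l\<bar>" using reals_Archimedean2 by blast
  show ?thesis
  proof (rule that[of "Suc K"])
    fix l' assume l': "\<bar>l'\<bar> > \<bar>l\<bar> / 2"
    have "R < real K * \<bar>l\<bar>" using K assms by (simp add: pos_divide_less_eq)
    also have "\<dots> \<le> \<bar>l'\<bar> * real (2 * (Suc K - 1))" using mult_left_mono[of "\<bar>l\<bar>" "2 * \<bar>l'\<bar>" "real K"] l' by (simp add: mult_ac)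
    finally show "\<bar>l'\<bar> * real (2 * (Suc K - 1)) > R" .
  qed simp
qed

lemma open_near_nonzero: "open {l'. \<bar>l'\<bar> > \<bar>l::real\<bar> / 2}"
  by (intro open_Collect_less continuous_intros)

lemma ray_sum_near:
  assumes s: "box_supp R f" and l: "l \<noteq> 0"
  obtains J where "\<And>l'. \<bar>l'\<bar> > \<bar>l\<bar> / 2 \<Longrightarrow> ray_sum n f x l' = (\<Sum>j<J. ray_term n f x j l')"
proof -
  obtain J where J: "\<And>l'. \<bar>l'\<bar> > \<bar>l\<bar> / 2 \<Longrightarrow> \<bar>l'\<bar> * real (2 * (J - 1)) > R" using obtain_index[OF l] by metis
  show ?thesis
  proof (rule that[of J])
    fix l' assume l': "\<bar>l'\<bar> > \<bar>l\<bar> / 2"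
    have "\<bar>l'\<bar> * real (2 * (J - 1)) \<le> \<bar>l'\<bar> * real (2 * J + n)" by (intro mult_left_mono) auto
    then show "ray_sum n f x l' = (\<Sum>j<J. ray_term n f x j l')"
      using J[OF l'] by (intro ray_sum_eq_sum[OF s]) linarith
  qed
qed

lemma ray_sum_isCont:
  assumes f: "continuous_on UNIV f" and s: "box_supp R f" and l: "l \<noteq> 0"
  shows "isCont (ray_sum n f x) l"
proof -
  obtain J where J: "\<And>l'. \<bar>l'\<bar> > \<bar>l\<bar> / 2 \<Longrightarrow> ray_sum n f x l' = (\<Sum>j<J. ray_term n f x j l')"
    using ray_sum_near[OF s l] by metis
  have "continuous_on {l'. \<bar>l'\<bar> > \<bar>l\<bar> / 2} (\<lambda>l'. \<Sum>j<J. ray_term n f x j l')"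
    by (intro continuous_intros continuous_on_subset[OF ray_term_continuous[OF f]]) auto
  then have "continuous_on {l'. \<bar>l'\<bar> > \<bar>l\<bar> / 2} (ray_sum n f x)"
    by (rule continuous_on_eq) (simp add: J)
  then show ?thesis using l by (simp only: continuous_on_eq_continuous_at[OF open_near_nonzero]) simp
qed

text \<open>On the fan the factor -2\<xi> + 2n\<lambda> equals -4j\<lambda> for \<lambda> > 0 and
  4(j+n)\<lambda> for \<lambda> < 0. By Taylor's formula the last term is then the difference of
  neighbouring rays with weight j or j+n, divided by \<lambda>, and corrected by its first-order
  part. This correction absorbs the part of the \<xi>-derivative along the ray that grows with j and
  leaves n times \<open>f1\<close> for both signs. One formula thus covers the whole fan.\<close>

definition M_op where
  "M_op n f1 f2 f11 p = - f2 p - of_nat n * f1 p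
     + of_real (- 2 * fst p + 2 * real n * snd p) * avg (\<lambda>\<theta>. 1 - \<theta>) f11 (p :: real \<times> real)"

context
  fixes f f1 f2 f11 f12 :: "real \<times> real \<Rightarrow> complex" and n :: nat
  assumes d: "\<And>p. (f has_derivative (\<lambda>h. fst h *\<^sub>R f1 p + snd h *\<^sub>R f2 p)) (at p)"
    and d1: "\<And>p. (f1 has_derivative (\<lambda>h. fst h *\<^sub>R f11 p + snd h *\<^sub>R f12 p)) (at p)"
    and n: "n \<ge> 1"
begin

private definition \<psi> :: "real \<Rightarrow> nat \<Rightarrow> complex" where "\<psi> l j = f (\<bar>l\<bar> * real (2 * j + n), l)"
private definition lg :: "'n::finite heis \<Rightarrow> real \<Rightarrow> nat \<Rightarrow> complex" where
  "lg x l j = of_real (lagf (n - 1) j (\<bar>l\<bar> * (norm (fst x))\<^sup>2 / 2))"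

text \<open>The boundary term of the summation by parts over the rays.\<close>

private definition \<tau> :: "'n::finite heis \<Rightarrow> real \<Rightarrow> nat \<Rightarrow> complex" where
  "\<tau> x l j = (if l > 0 then of_nat j * \<psi> l (j - 1) * lg x l j
     else if j = 0 then 0 else of_nat (j + (n - 1)) * \<psi> l j * lg x l (j - 1))"

text \<open>The left-hand side is \<lambda> times the \<lambda>-derivative of a ray term, with
  |\<lambda>|^n exp(i\<lambda>t) taken out. A ladder relation moves the Laguerre function by one
  index, up for \<lambda> > 0 and down for \<lambda> < 0; Taylor's formula moves f by one ray in the
  opposite direction. What does not match is the difference of \<tau> at j + 1 and j.\<close>

private lemma bracket:
  fixes x :: "'n::finite heis" and j :: nat
  assumes l: "l \<noteq> 0"
  defines "p \<equiv> (\<bar>l\<bar> * real (2 * j + n), l)" and "s \<equiv> \<bar>l\<bar> * (norm (fst x))\<^sup>2 / 2"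
  shows "of_nat n * \<psi> l j * lg x l j + of_real l * (of_real (sgn l * real (2 * j + n)) * f1 p + f2 p) * lg x l j
     + \<psi> l j * of_real (s * lagd 1 (n - 1) j s) + \<i> * of_real (l * snd x) * \<psi> l j * lg x l j
    = of_real l * heis_A x * \<psi> l j * lg x l j - of_real l * M_op n f1 f2 f11 p * lg x l j + (\<tau> x l (Suc j) - \<tau> x l j)"
proof -
  have n': "n - 1 + 1 = n" using n by simp
  have ta: "of_real (4 * l\<^sup>2) * avg (\<lambda>\<theta>. 1 - \<theta>) f11 p = f (fst p - 2 * l, l) - \<psi> l j + of_real (2 * l) * f1 p"
    using avg_taylor[OF d d1, of l "fst p"] by (simp add: p_def \<psi>_def)
  have ls: "lg x l j = of_real (lagf (n - 1) j s)" for j by (simp add: lg_def s_def)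
  show ?thesis
  proof (cases "l > 0")
    case True
    have e: "of_real l * M_op n f1 f2 f11 p = - of_real l * f2 p - of_nat n * of_real l * f1 p
       - of_nat j * (f (fst p - 2 * l, l) - \<psi> l j + of_real (2 * l) * f1 p)"
      unfolding ta[symmetric] M_op_def using True by (simp add: p_def power2_eq_square algebra_simps)
    have fs: "of_nat j * f (fst p - 2 * l, l) = of_nat j * \<psi> l (j - 1)"
      using True by (cases j) (simp_all add: p_def \<psi>_def algebra_simps)
    have lA: "of_real l * heis_A x = of_real (s / 2) + \<i> * of_real (l * snd x)"
      using True by (simp add: heis_A_def s_def field_simps)
    have dl: "complex_of_real (s * lagd 1 (n - 1) j s) = of_real (s / 2) * lg x l j - of_nat (j + n) * lg x l j + of_nat (Suc j) * lg x l (Suc j)"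
      unfolding lagd1_up ls using n' by (simp add: add.assoc)
    show ?thesis
      unfolding e dl lA \<tau>_def using True fs by (auto simp: algebra_simps)
  next
    case False
    with l have neg: "l < 0" by simp
    have e: "of_real l * M_op n f1 f2 f11 p = - of_real l * f2 p - of_nat n * of_real l * f1 p
       + of_nat (j + n) * (f (fst p - 2 * l, l) - \<psi> l j + of_real (2 * l) * f1 p)"
      unfolding ta[symmetric] M_op_def using neg by (simp add: p_def power2_eq_square algebra_simps)
    have fs: "f (fst p - 2 * l, l) = \<psi> l (Suc j)"
      using neg by (simp add: p_def \<psi>_def algebra_simps)
    have lA: "of_real l * heis_A x = - of_real (s / 2) + \<i> * of_real (l * snd x)"
      using neg by (simp add: heis_A_def s_def field_simps)
    have dl: "complex_of_real (s * lagd 1 (n - 1) j s) = - of_real (s / 2) * lg x l j + of_nat j * lg x l j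
        - (if j = 0 then 0 else of_nat (j + (n - 1)) * lg x l (j - 1))"
      unfolding lagd1_down ls by (cases j) simp_all
    have t1: "\<tau> x l (Suc j) = of_nat (j + n) * \<psi> l (Suc j) * lg x l j"
      using neg n' by (simp add: \<tau>_def)
    show ?thesis
      unfolding e dl lA t1 fs using neg by (cases j) (simp_all add: \<tau>_def algebra_simps)
  qed
qed

private lemma ray_term_deriv:
  fixes x :: "'n::finite heis"
  assumes l: "l \<noteq> 0"
  shows "(ray_term n f x j has_vector_derivative (heis_A x * ray_term n f x j l - ray_term n (M_op n f1 f2 f11) x j l
    + of_real (\<bar>l\<bar> ^ n / l) * exp (\<i> * of_real (l * snd x)) * (\<tau> x l (Suc j) - \<tau> x l j))) (at l)"
proof -
  define \<sigma> where "\<sigma> = sgn l"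
  define m where "m = real (2 * j + n)"
  define r where "r = (norm (fst x))\<^sup>2 / 2"
  define p where "p = (\<bar>l\<bar> * real (2 * j + n), l)"
  define E where "E = exp (\<i> * of_real (l * snd x))"
  have \<sigma>: "\<sigma> * l = \<bar>l\<bar>" by (simp add: \<sigma>_def sgn_mult_abs abs_sgn mult.commute)
  \<comment> \<open>On the half-line of the sign of l the modulus is linear, |l'| = \<sigma> l', so
    that the product rule applies to \<open>T\<close> without absolute values.\<close>
  define S where "S = {l'. \<sigma> * l' > 0}"
  have S: "open S" "l \<in> S" using l by (auto simp: S_def \<sigma> intro!: open_Collect_less continuous_intros)
  have abs: "\<bar>l'\<bar> = \<sigma> * l'" if "l' \<in> S" for l'
    using that by (auto simp: S_def \<sigma>_def sgn_if split: if_splits)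
  define T where "T l' = of_real ((\<sigma> * l') ^ n) * f (\<sigma> * l' * m, l') * of_real (lagf (n - 1) j (\<sigma> * l' * r)) * exp (\<i> * of_real (l' * snd x))" for l'
  have T: "T l' = ray_term n f x j l'" if "l' \<in> S" for l'
    using abs[OF that] by (simp add: T_def ray_term_def m_def r_def)
  have p': "(\<sigma> * l * m, l) = p" by (simp add: p_def m_def \<sigma>)
  have a1: "((\<lambda>l'. complex_of_real ((\<sigma> * l') ^ n)) has_vector_derivative of_real (real n * (\<sigma> * l) ^ (n - 1) * \<sigma>)) (at l)"
    by (intro has_vector_derivative_of_real) (auto intro!: derivative_eq_intros)
  have P: "((\<lambda>l'. (\<sigma> * l' * m, l')) has_derivative (\<lambda>h. (\<sigma> * h * m, h))) (at l)"
    by (auto intro!: derivative_eq_intros)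
  have a2: "((\<lambda>l'. f (\<sigma> * l' * m, l')) has_vector_derivative (of_real (\<sigma> * m) * f1 p + f2 p)) (at l)"
    unfolding has_vector_derivative_def
    by (rule has_derivative_eq_rhs[OF has_derivative_compose[OF P d]], unfold p') (auto simp: scaleR_conv_of_real algebra_simps)
  have "((\<lambda>l'. lagf (n - 1) j (\<sigma> * l' * r)) has_real_derivative lagd 1 (n - 1) j (\<sigma> * l * r) * (\<sigma> * r)) (at l)"
    by (intro DERIV_chain2[OF lagf_deriv]) (auto intro!: derivative_eq_intros)
  then have a3: "((\<lambda>l'. complex_of_real (lagf (n - 1) j (\<sigma> * l' * r))) has_vector_derivative of_real (lagd 1 (n - 1) j (\<sigma> * l * r) * (\<sigma> * r))) (at l)"
    by (rule has_vector_derivative_of_real)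
  have a4: "((\<lambda>l'. exp (\<i> * of_real (l' * snd x))) has_vector_derivative \<i> * of_real (snd x) * E) (at l)"
    unfolding of_real_mult E_def
    by (rule field_vector_diff_chain_at[where f = "\<lambda>l'. \<i> * (of_real l' * of_real (snd x))" and g = exp, unfolded comp_def, THEN has_vector_derivative_eq_rhs] derivative_eq_intros refl | simp)+
  let ?s = "\<bar>l\<bar> * r"
  define pw where "pw = complex_of_real (\<bar>l\<bar> ^ n / l)"
  have pn: "complex_of_real (\<bar>l\<bar> ^ n) = pw * of_real l" using l by (simp add: pw_def)
  have pn1: "complex_of_real (real n * (\<sigma> * l) ^ (n - 1) * \<sigma>) = of_nat n * pw"
  proof -
    have "\<bar>l\<bar> ^ n = \<bar>l\<bar> ^ (n - 1) * (\<sigma> * l)" using n by (simp add: \<sigma> power_eq_if mult.commute)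
    then have "(\<sigma> * l) ^ (n - 1) * \<sigma> = \<bar>l\<bar> ^ n / l"
      unfolding \<sigma>[symmetric] by (simp only: mult.assoc[symmetric] nonzero_mult_div_cancel_right[OF l])
    then show ?thesis unfolding pw_def by (simp only: mult.assoc of_real_mult of_real_of_nat_eq)
  qed
  define Ld where "Ld = complex_of_real (lagd 1 (n - 1) j (\<sigma> * l * r) * (\<sigma> * r))"
  define Sd where "Sd = complex_of_real (?s * lagd 1 (n - 1) j ?s)"
  have "of_real l * Ld = Sd"
    unfolding Ld_def Sd_def of_real_mult[symmetric] \<sigma>[symmetric] by (simp only: mult_ac)
  then have sr': "pw * of_real l * \<psi> l j * Ld * E = pw * E * (\<psi> l j * Sd)" by auto
  have br: "of_nat n * \<psi> l j * lg x l j + of_real l * (of_real (\<sigma> * m) * f1 p + f2 p) * lg x l j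
     + \<psi> l j * Sd + \<i> * of_real (l * snd x) * \<psi> l j * lg x l j
    = of_real l * heis_A x * \<psi> l j * lg x l j - of_real l * M_op n f1 f2 f11 p * lg x l j + (\<tau> x l (Suc j) - \<tau> x l j)"
    using bracket[OF l, of j x] by (simp only: \<sigma>_def m_def p_def r_def Sd_def times_divide_eq_right)
  have lgr: "complex_of_real (lagf (n - 1) j ?s) = lg x l j" by (simp add: lg_def r_def)
  have fp: "f p = \<psi> l j" by (simp add: \<psi>_def p_def)
  have ft: "ray_term n g x j l = pw * of_real l * g p * lg x l j * E" for g
    by (simp add: ray_term_def pn[symmetric] p_def lg_def E_def)
  have "(T has_vector_derivative (pw * E * (of_nat n * \<psi> l j * lg x l j + of_real l * (of_real (\<sigma> * m) * f1 p + f2 p) * lg x l j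
     + \<psi> l j * Sd + \<i> * of_real (l * snd x) * \<psi> l j * lg x l j))) (at l)"
    unfolding T_def[abs_def]
    by (rule has_vector_derivative_eq_rhs[OF has_vector_derivative_mult[OF has_vector_derivative_mult[OF has_vector_derivative_mult[OF a1 a2] a3[folded Ld_def]] a4]], unfold p' pn1)
       (use sr' in \<open>simp only: fp E_def[symmetric] \<sigma> pn lgr, simp add: algebra_simps\<close>)
  then have "(T has_vector_derivative (heis_A x * ray_term n f x j l - ray_term n (M_op n f1 f2 f11) x j l
    + pw * E * (\<tau> x l (Suc j) - \<tau> x l j))) (at l)"
    unfolding br ft fp by (rule has_vector_derivative_eq_rhs) (simp add: algebra_simps)
  then show ?thesis
    unfolding pw_def E_def
    by (rule has_vector_derivative_transform_within_open[OF _ S]) (rule T)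
qed

lemma ray_sum_deriv:
  fixes x :: "'n::finite heis"
  assumes s: "box_supp R f" and sM: "box_supp R' (M_op n f1 f2 f11)" and l: "l \<noteq> 0"
  shows "(ray_sum n f x has_vector_derivative (heis_A x * ray_sum n f x l - ray_sum n (M_op n f1 f2 f11) x l)) (at l)"
proof -
  let ?g = "M_op n f1 f2 f11"
  obtain J where "J \<ge> 1" and J: "\<And>l'. \<bar>l'\<bar> > \<bar>l\<bar> / 2 \<Longrightarrow> \<bar>l'\<bar> * real (2 * (J - 1)) > max R R'"
    using obtain_index[OF l] by metis
  have big: "\<bar>l'\<bar> * real (2 * J' + n) > max R R'" if "\<bar>l'\<bar> > \<bar>l\<bar> / 2" "J' \<ge> J - 1" for l' J'
  proof -
    have "\<bar>l'\<bar> * real (2 * (J - 1)) \<le> \<bar>l'\<bar> * real (2 * J' + n)" using that by (intro mult_left_mono) auto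
    then show ?thesis using J[OF that(1)] by linarith
  qed
  have l2: "\<bar>l\<bar> > \<bar>l\<bar> / 2" using l by simp
  \<comment> \<open>The telescoping sum leaves \<tau> at 0 and at J. At 0 it vanishes by its
    definition. At J it contains the coefficient of ray J - 1 if l > 0 and of ray J if l < 0; both
    lie outside the support.\<close>
  have \<psi>0: "\<psi> l J' = 0" if "J' \<ge> J - 1" for J'
    using big[OF l2 that] s by (auto simp: \<psi>_def box_supp_def)
  have \<tau>: "\<tau> x l J = 0" "\<tau> x l 0 = 0" using \<psi>0[of J] \<psi>0[of "J - 1"] by (auto simp: \<tau>_def)
  have e1: "ray_sum n f x l' = (\<Sum>j<J. ray_term n f x j l')" if "\<bar>l'\<bar> > \<bar>l\<bar> / 2" for l'
    using big[OF that, of J] by (intro ray_sum_eq_sum[OF s]) auto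
  have e2: "ray_sum n ?g x l = (\<Sum>j<J. ray_term n ?g x j l)"
    using big[OF l2, of J] by (intro ray_sum_eq_sum[OF sM]) auto
  define c where "c = of_real (\<bar>l\<bar> ^ n / l) * exp (\<i> * of_real (l * snd x))"
  have "((\<lambda>l'. \<Sum>j<J. ray_term n f x j l') has_vector_derivative
     (\<Sum>j<J. heis_A x * ray_term n f x j l - ray_term n ?g x j l + c * (\<tau> x l (Suc j) - \<tau> x l j))) (at l)"
    unfolding c_def by (intro has_vector_derivative_sum ray_term_deriv l)
  also have "(\<Sum>j<J. heis_A x * ray_term n f x j l - ray_term n ?g x j l + c * (\<tau> x l (Suc j) - \<tau> x l j))
     = heis_A x * ray_sum n f x l - ray_sum n ?g x l + c * (\<Sum>j<J. \<tau> x l (Suc j) - \<tau> x l j)"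
    unfolding e1[OF l2] e2 by (simp only: right_diff_distrib sum.distrib sum_subtractf sum_distrib_left)
  also have "(\<Sum>j<J. \<tau> x l (Suc j) - \<tau> x l j) = 0"
    unfolding sum_lessThan_telescope \<tau> by simp
  finally have "((\<lambda>l'. \<Sum>j<J. ray_term n f x j l') has_vector_derivative (heis_A x * ray_sum n f x l - ray_sum n ?g x l)) (at l)" by simp
  then show ?thesis
    by (rule has_vector_derivative_transform_within_open[OF _ open_near_nonzero[of l]]) (use l2 e1 in auto)
qed

end

text \<open>About R/(2\<epsilon>) rays meet the box, and each multiplicity is at most (2M+n)^(n-1),
  with M just above that number. The factor \<epsilon>^n compensates the count and the
  multiplicities exactly, so the bound does not depend on \<epsilon>.\<close>

lemma ray_term_bound:
  assumes \<epsilon>: "0 < \<epsilon>" "\<epsilon> \<le> 1" and n: "n \<ge> 1" and R: "0 < R"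
    and h: "\<And>j. cmod (h j) \<le> K" "\<And>j. \<epsilon> * real (2 * j + n) > R \<Longrightarrow> h j = 0"
    and u: "\<And>j. \<bar>u j\<bar> \<le> fan_mult n (j, \<epsilon>)"
  shows "cmod (\<Sum>j<J. of_real (\<epsilon> ^ n) * h j * of_real (u j)) \<le> K * (R + real n + 2) ^ n"
proof -
  define M where "M = nat \<lfloor>R / (2 * \<epsilon>)\<rfloor> + 1"
  have fl: "R / (2 * \<epsilon>) < real M" and fl2: "real M \<le> R / (2 * \<epsilon>) + 1"
    using R \<epsilon> by (auto simp: M_def) linarith+
  have M: "h j = 0" if "j \<ge> M" for j
  proof (rule h(2))
    have "R < \<epsilon> * real (2 * M)" using fl \<epsilon> by (simp add: pos_divide_less_eq mult_ac)
    also have "\<dots> \<le> \<epsilon> * real (2 * j + n)" using that \<epsilon> by (intro mult_left_mono) auto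
    finally show "R < \<epsilon> * real (2 * j + n)" .
  qed
  have K: "0 \<le> K" using order_trans[OF norm_ge_zero h(1)] .
  let ?T = "\<lambda>j. of_real (\<epsilon> ^ n) * h j * complex_of_real (u j)"
  have "(\<Sum>j<J. ?T j) = (\<Sum>j\<in>{..<J} \<inter> {..<M}. ?T j)"
    using M by (intro sum.mono_neutral_right) (auto simp: not_less)
  then have "cmod (\<Sum>j<J. ?T j) \<le> (\<Sum>j\<in>{..<J} \<inter> {..<M}. cmod (?T j))"
    by (simp only: norm_sum)
  also have "\<dots> \<le> (\<Sum>j<M. cmod (?T j))"
    by (intro sum_mono2) auto
  also have "\<dots> \<le> (\<Sum>j<M. \<epsilon> ^ n * K * (real (2 * M + n)) ^ (n - 1))"
  proof (rule sum_mono)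
    fix j assume j: "j \<in> {..<M}"
    have "\<bar>u j\<bar> \<le> real (2 * j + n) ^ (n - 1)" using u[of j] fan_mult_le_pow[OF n, of "(j, \<epsilon>)"] by simp
    also have "\<dots> \<le> real (2 * M + n) ^ (n - 1)" using j by (intro power_mono) auto
    finally have "\<epsilon> ^ n * cmod (h j) * \<bar>u j\<bar> \<le> \<epsilon> ^ n * K * (real (2 * M + n)) ^ (n - 1)"
      using \<epsilon> K by (intro mult_mono h) auto
    then show "cmod (?T j) \<le> \<epsilon> ^ n * K * (real (2 * M + n)) ^ (n - 1)"
      using \<epsilon> by (simp add: norm_mult norm_power)
  qed
  also have "\<dots> = K * \<epsilon> ^ n * (real M * real (2 * M + n) ^ (n - 1))" by simp
  also have "\<dots> \<le> K * \<epsilon> ^ n * (real (2 * M + n) * real (2 * M + n) ^ (n - 1))"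
    using \<epsilon> K by (intro mult_left_mono mult_right_mono) auto
  also have "\<dots> = K * (\<epsilon> * real (2 * M + n)) ^ n"
    using n power_minus_mult[of n "real (2 * M + n)"] by (simp add: power_mult_distrib mult_ac)
  also have "\<dots> \<le> K * (R + real n + 2) ^ n"
  proof (intro mult_left_mono power_mono K)
    have "\<epsilon> * real (2 * M + n) \<le> \<epsilon> * (2 * (R / (2 * \<epsilon>) + 1) + real n)"
      using fl2 \<epsilon> by (intro mult_left_mono) auto
    also have "\<dots> = R + \<epsilon> * (2 + real n)" using \<epsilon> by (simp add: algebra_simps)
    also have "\<dots> \<le> R + 1 * (2 + real n)" using \<epsilon> by (intro add_left_mono mult_right_mono) auto
    finally show "\<epsilon> * real (2 * M + n) \<le> R + real n + 2" by simp
  qed (use \<epsilon> in auto)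
  finally show ?thesis .
qed

text \<open>Both one-sided limits at \<open>\<lambda> = 0\<close> are nonzero in general, but they agree.\<close>

lemma ray_sum_jump:
  fixes x :: "'n::finite heis"
  assumes c: "CN (Suc 0) B f" and s: "box_supp R f" and n: "n \<ge> 1" and R: "0 < R" and \<epsilon>: "0 < \<epsilon>" "\<epsilon> \<le> 1"
  shows "cmod (ray_sum n f x \<epsilon> - ray_sum n f x (- \<epsilon>)) \<le> (2 * B * (\<bar>snd x\<bar> + 1) * \<epsilon>) * (R + real n + 2) ^ n"
proof -
  obtain f1 f2 where d: "\<And>p. (f has_derivative (\<lambda>h. fst h *\<^sub>R f1 p + snd h *\<^sub>R f2 p)) (at p)"
    and c12: "CN 0 B f1" "CN 0 B f2"
    using c unfolding CN.simps by blast
  have B: "0 \<le> B" using c CN_nonneg by blast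
  let ?a = "n - 1" and ?e = "\<lambda>l. exp (\<i> * of_real (l * snd x))"
  \<comment> \<open>At \<epsilon> and -\<epsilon> the rays have the same \<xi> and the same Laguerre
    functions. The two sums differ only through f and the exponential, and both differences are of
    order \<epsilon>.\<close>
  define h where "h j = f (\<epsilon> * real (2 * j + n), \<epsilon>) * ?e \<epsilon> - f (\<epsilon> * real (2 * j + n), - \<epsilon>) * ?e (- \<epsilon>)" for j
  define u where "u j = lagf ?a j (\<epsilon> * (norm (fst x))\<^sup>2 / 2)" for j
  obtain J where J: "\<And>l'. \<bar>l'\<bar> > \<bar>\<epsilon>\<bar> / 2 \<Longrightarrow> ray_sum n f x l' = (\<Sum>j<J. ray_term n f x j l')"
    using ray_sum_near[OF s, of \<epsilon>] \<epsilon> by (metis less_irrefl)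
  have "ray_sum n f x \<epsilon> - ray_sum n f x (- \<epsilon>) = (\<Sum>j<J. of_real (\<epsilon> ^ n) * h j * of_real (u j))"
    using J[of \<epsilon>] J[of "- \<epsilon>"] \<epsilon> by (simp add: ray_term_def h_def u_def sum_subtractf[symmetric] algebra_simps)
  also have "cmod \<dots> \<le> (2 * B * (\<bar>snd x\<bar> + 1) * \<epsilon>) * (R + real n + 2) ^ n"
  proof (rule ray_term_bound[OF \<epsilon> n R])
    show "h j = 0" if "\<epsilon> * real (2 * j + n) > R" for j
      using s that by (auto simp: h_def box_supp_def)
    show "\<bar>u j\<bar> \<le> fan_mult n (j, \<epsilon>)" for j
      using lagf_bound[of "\<epsilon> * (norm (fst x))\<^sup>2 / 2" ?a j] \<epsilon> by (simp add: u_def fan_mult_def)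
    show "cmod (h j) \<le> 2 * B * (\<bar>snd x\<bar> + 1) * \<epsilon>" for j
    proof -
      let ?\<xi> = "\<epsilon> * real (2 * j + n)"
      have 1: "cmod (?e \<epsilon> - ?e (- \<epsilon>)) \<le> 2 * \<bar>snd x\<bar> * \<epsilon>"
      proof -
        have "?e \<epsilon> - ?e (- \<epsilon>) = 2 * \<i> * of_real (sin (\<epsilon> * snd x))"
          unfolding cis_conv_exp[symmetric] by (simp add: complex_eq_iff)
        then have "cmod (?e \<epsilon> - ?e (- \<epsilon>)) = 2 * \<bar>sin (\<epsilon> * snd x)\<bar>" by (simp add: norm_mult)
        also have "\<dots> \<le> 2 * \<bar>\<epsilon> * snd x\<bar>" using abs_sin_x_le_abs_x by simp
        finally show ?thesis using \<epsilon> by (simp add: abs_mult mult_ac)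
      qed
      have 2: "cmod (f (?\<xi>, \<epsilon>) - f (?\<xi>, - \<epsilon>)) \<le> B * norm (\<epsilon> - (- \<epsilon>))"
      proof (rule differentiable_bound[of UNIV "\<lambda>l. f (?\<xi>, l)" "\<lambda>l h. h *\<^sub>R f2 (?\<xi>, l)"])
        fix l :: real
        have P: "((\<lambda>l. (?\<xi>, l)) has_derivative (\<lambda>h. (0, h))) (at l)" by (auto intro!: derivative_eq_intros)
        show "((\<lambda>l. f (?\<xi>, l)) has_derivative (\<lambda>h. h *\<^sub>R f2 (?\<xi>, l))) (at l within UNIV)"
          by (rule has_derivative_eq_rhs[OF has_derivative_compose[OF P d]]) auto
        show "onorm (\<lambda>h. h *\<^sub>R f2 (?\<xi>, l)) \<le> B"
          using CN_bound[OF c12(2)] onorm_scaleR_left[of "\<lambda>h. h" "f2 (?\<xi>, l)"] by (simp add: onorm_id bounded_linear_ident)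
      qed auto
      have "h j = f (?\<xi>, \<epsilon>) * (?e \<epsilon> - ?e (- \<epsilon>)) + (f (?\<xi>, \<epsilon>) - f (?\<xi>, - \<epsilon>)) * ?e (- \<epsilon>)"
        by (simp add: h_def algebra_simps)
      then have "cmod (h j) \<le> cmod (f (?\<xi>, \<epsilon>)) * cmod (?e \<epsilon> - ?e (- \<epsilon>)) + cmod (f (?\<xi>, \<epsilon>) - f (?\<xi>, - \<epsilon>)) * cmod (?e (- \<epsilon>))"
        by (simp only: norm_mult[symmetric] norm_triangle_ineq)
      also have "cmod (?e (- \<epsilon>)) = 1" by (rule norm_exp_i_times)
      also have "cmod (f (?\<xi>, \<epsilon>)) * cmod (?e \<epsilon> - ?e (- \<epsilon>)) + cmod (f (?\<xi>, \<epsilon>) - f (?\<xi>, - \<epsilon>)) * 1 \<le> B * (2 * \<bar>snd x\<bar> * \<epsilon>) + B * (2 * \<epsilon>)"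
        unfolding mult_1_right using 1 2 \<epsilon> B by (intro add_mono mult_mono CN_bound[OF c]) auto
      finally show ?thesis by (simp add: algebra_simps)
    qed
  qed
  finally show ?thesis .
qed

text \<open>On the box 1 + \<xi> is at most 1 + R, which brings in the integrable weight. The
  estimate is linear in B, as the growth in J will enter through B alone.\<close>

lemma fan_coeff_bound_box:
  assumes c: "continuous_on UNIV f" and b: "\<And>p. cmod (f p) \<le> B" and s: "box_supp R f" and n: "n \<ge> 1" and R: "0 < R"
  shows "adm n (fan_coeff n f)"
    and "(LINT q|nu. cmod (fan_coeff n f q) * fan_mult n q) \<le>
      B * ((1 + R) ^ (n + 2) * (LINT q|nu. \<bar>snd q\<bar> ^ n * fan_mult n q / (1 + xi n q) ^ (n + 2)))"
proof -
  have B: "0 \<le> B" using order_trans[OF norm_ge_zero b] .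
  have le: "cmod (f (\<xi>, l)) * (1 + \<xi>) ^ k \<le> B * (1 + R) ^ k" if "0 \<le> \<xi>" for \<xi> l k
  proof (cases "\<xi> > R")
    case True
    then show ?thesis using s B R by (simp add: box_supp_def)
  next
    case False
    then show ?thesis using that B by (intro mult_mono b power_mono) auto
  qed
  show adm: "adm n (fan_coeff n f)"
    by (rule adm_fan_coeff[OF borel_measurable_continuous_onI[OF c] n]) (use le in blast)
  have "(LINT q|nu. cmod (fan_coeff n f q) * fan_mult n q) \<le>
     (LINT q|nu. B * ((1 + R) ^ (n + 2) * (\<bar>snd q\<bar> ^ n * fan_mult n q / (1 + xi n q) ^ (n + 2))))"
  proof (rule integral_mono)
    show "integrable nu (\<lambda>q. cmod (fan_coeff n f q) * fan_mult n q)"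
      using adm unfolding adm_def by (auto dest!: spec[of _ 0])
    show "integrable nu (\<lambda>q. B * ((1 + R) ^ (n + 2) * (\<bar>snd q\<bar> ^ n * fan_mult n q / (1 + xi n q) ^ (n + 2))))"
      by (intro integrable_mult_right integrable_plancherel_weight n)
    fix q
    have x: "1 + xi n q > 0" using xi_nonneg[of n q] by linarith
    have pi: "1 \<le> (2 * pi) ^ (n + 1)" using pi_gt3 by (intro one_le_power) auto
    have "cmod (f (xi n q, snd q)) \<le> B * (1 + R) ^ (n + 2) / (1 + xi n q) ^ (n + 2)"
      using le[of "xi n q" "snd q" "n + 2"] x by (simp only: pos_le_divide_eq[OF zero_less_power[OF x]] xi_nonneg simp_thms)
    moreover have "\<bar>snd q\<bar> ^ n / (2 * pi) ^ (n + 1) \<le> \<bar>snd q\<bar> ^ n"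
      using divide_left_mono[OF pi, of "\<bar>snd q\<bar> ^ n"] by (simp only: div_by_1) simp
    ultimately have "(\<bar>snd q\<bar> ^ n / (2 * pi) ^ (n + 1) * cmod (f (xi n q, snd q))) * fan_mult n q
       \<le> (\<bar>snd q\<bar> ^ n * (B * (1 + R) ^ (n + 2) / (1 + xi n q) ^ (n + 2))) * fan_mult n q"
      by (intro mult_right_mono mult_mono) auto
    then show "cmod (fan_coeff n f q) * fan_mult n q \<le> B * ((1 + R) ^ (n + 2) * (\<bar>snd q\<bar> ^ n * fan_mult n q / (1 + xi n q) ^ (n + 2)))"
      unfolding cmod_fan_coeff by (simp add: mult_ac)
  qed
  then show "(LINT q|nu. cmod (fan_coeff n f q) * fan_mult n q) \<le>
      B * ((1 + R) ^ (n + 2) * (LINT q|nu. \<bar>snd q\<bar> ^ n * fan_mult n q / (1 + xi n q) ^ (n + 2)))"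
    by (simp only: integral_mult_right_zero)
qed

text \<open>Fubini's theorem with the sum over j inside, so that \<lambda> remains as the variable
  of integration.\<close>

lemma wave_eq_ray_sum:
  fixes x :: "'n::finite heis"
  assumes "adm CARD('n) (fan_coeff CARD('n) f)"
  shows "integrable lborel (ray_sum CARD('n) f x)"
    and "wave 0 (fan_coeff CARD('n) f) x = (LINT l|lborel. ray_sum CARD('n) f x l) / of_real ((2 * pi) ^ (CARD('n) + 1))"
proof -
  let ?n = "CARD('n)" and ?c = "complex_of_real ((2 * pi) ^ (CARD('n) + 1))"
  have c: "?c \<noteq> 0" by simp
  interpret P: pair_sigma_finite "count_space (UNIV :: nat set)" "lborel :: real measure" by (rule nu_pair)
  have eq: "ray_term ?n f x j l = ?c * (fan_coeff ?n f (j, l) * of_real (kern ?n 0 (j, l) x) * exp (\<i> * of_real (snd (j, l) * snd x)))" for j l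
    using c by (simp add: ray_term_def fan_coeff_def kern_def)
  have "integrable nu (\<lambda>q. ?c * (fan_coeff ?n f q * of_real (kern ?n 0 q x) * exp (\<i> * of_real (snd q * snd x))))"
    by (intro integrable_mult_right adm_integrable assms card_ge_1)
  then have int: "integrable (count_space UNIV \<Otimes>\<^sub>M lborel) (case_prod (ray_term ?n f x))"
    unfolding nu_def by (rule back_subst[of "integrable _"]) (auto simp: eq fun_eq_iff)
  show "integrable lborel (ray_sum ?n f x)"
    unfolding ray_sum_def[abs_def] by (rule P.integrable_snd[OF int])
  have "(LINT l|lborel. ray_sum ?n f x l) = (LINT q|nu. case_prod (ray_term ?n f x) q)"
    unfolding ray_sum_def nu_def by (rule P.integral_snd[OF int])
  also have "\<dots> = (LINT q|nu. ?c * (fan_coeff ?n f q * of_real (kern ?n 0 q x) * exp (\<i> * of_real (snd q * snd x))))"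
    by (intro Bochner_Integration.integral_cong) (auto simp: eq)
  also have "\<dots> = ?c * wave 0 (fan_coeff ?n f) x"
    unfolding wave_kern by (rule integral_mult_right_zero)
  finally show "wave 0 (fan_coeff ?n f) x = (LINT l|lborel. ray_sum ?n f x l) / ?c"
    using c by simp
qed

text \<open>Away from 0 the function \<open>h\<close>, that is \<A> times the ray sum of f minus the
  ray sum of g, is the derivative of the former. Over the region e \<le> |\<lambda>| \<le> b its
  integral reduces to the jump between e and -e, since the ray sum vanishes at b and -b. The jump
  tends to 0 with e, so the integral of \<open>h\<close> is 0. In the constant, 1 and n come from
  the two first derivatives, (2+2n)(3R+1) bounds the linear factor and its derivatives on the
  enlarged box, and 3^N comes from the average.\<close>

lemma A_wave:
  assumes c: "CN (Suc (Suc N)) B f" and s: "box_supp R f" and R: "0 < R"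
  obtains g where "CN N ((1 + real CARD('n) + (2 + 2 * real CARD('n)) * (3 * R + 1) * (real N + 1) * 3 ^ N) * B) g"
    "box_supp (3 * R) g" "\<And>x::'n::finite heis. heis_A x * wave 0 (fan_coeff CARD('n) f) x = wave 0 (fan_coeff CARD('n) g) x"
proof -
  let ?n = "CARD('n)"
  obtain f1 f2 where d: "\<And>p. (f has_derivative (\<lambda>h. fst h *\<^sub>R f1 p + snd h *\<^sub>R f2 p)) (at p)"
    and c12: "CN (Suc N) B f1" "CN (Suc N) B f2"
    using c unfolding CN.simps(2)[of "Suc N"] by blast
  obtain f11 f12 where d1: "\<And>p. (f1 has_derivative (\<lambda>h. fst h *\<^sub>R f11 p + snd h *\<^sub>R f12 p)) (at p)"
    and c11: "CN N B f11"
    using c12(1) unfolding CN.simps by blast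
  note s12 = box_supp_deriv[OF d s]
  note s11 = box_supp_deriv(1)[OF d1 s12(1)]
  define g where "g = M_op ?n f1 f2 f11"
  let ?L = "(2 + 2 * real ?n) * (3 * R + 1)"
  have sa: "box_supp (3 * R) (avg (\<lambda>\<theta>. 1 - \<theta>) f11)" using s11 R by (intro box_supp_avg) auto
  have ca: "CN N (3 ^ N * 1 * B) (avg (\<lambda>\<theta>. 1 - \<theta>) f11)"
    by (rule CN_avg[OF c11]) (auto intro!: continuous_intros)
  have L1: "2 \<le> ?L" and L2: "2 * real ?n \<le> ?L"
    using R mult_mono[of 1 "3 * R + 1" 2 "2 + 2 * real ?n"] mult_mono[of 1 "3 * R + 1" "2 * real ?n" "2 + 2 * real ?n"] by (auto simp: mult.commute)
  have cl: "CN N (?L * (real N + 1) * (3 ^ N * 1 * B)) (\<lambda>p. of_real (- 2 * fst p + 2 * real ?n * snd p) * avg (\<lambda>\<theta>. 1 - \<theta>) f11 p)"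
    by (rule CN_linear_mult[OF _ _ _ ca sa]) (use L1 L2 R in \<open>auto simp: algebra_simps\<close>)
  have cg: "CN N ((1 + real ?n + ?L * (real N + 1) * 3 ^ N) * B) g"
    using CN_add[OF CN_add[OF CN_cmult[OF CN_Suc_imp[OF c12(2)], of "- 1"] CN_cmult[OF CN_Suc_imp[OF c12(1)], of "- of_nat ?n"]] cl]
    unfolding g_def M_op_def[abs_def] by (simp add: algebra_simps)
  have sg: "box_supp (3 * R) g"
    using s12 sa R unfolding g_def M_op_def[abs_def] box_supp_def by auto
  have cg0: "continuous_on UNIV g" and cf0: "continuous_on UNIV f"
    using CN_continuous cg c by blast+
  have adm: "adm ?n (fan_coeff ?n f)" "adm ?n (fan_coeff ?n g)"
    using fan_coeff_bound_box(1)[OF cf0 CN_bound[OF c] s card_ge_1 R] fan_coeff_bound_box(1)[OF cg0 CN_bound[OF cg] sg card_ge_1] R by auto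
  have "heis_A x * wave 0 (fan_coeff ?n f) x = wave 0 (fan_coeff ?n g) x" for x :: "'n heis"
  proof -
    let ?F = "ray_sum ?n f x" and ?G = "ray_sum ?n g x"
    define h where "h l = heis_A x * ?F l - ?G l" for l
    have hint: "integrable lborel h"
      unfolding h_def[abs_def] using wave_eq_ray_sum(1)[OF adm(1)] wave_eq_ray_sum(1)[OF adm(2)] by auto
    have der: "(?F has_vector_derivative h l) (at l)" if "l \<noteq> 0" for l
      unfolding h_def g_def by (rule ray_sum_deriv[OF d d1 card_ge_1 s sg[unfolded g_def] that])
    have cont: "isCont h l" if "l \<noteq> 0" for l
      unfolding h_def[abs_def] by (intro continuous_intros ray_sum_isCont[OF cf0 s that] ray_sum_isCont[OF cg0 sg that])
    have ftc: "(LINT l|lborel. indicator {u..v} l *\<^sub>R h l) = ?F v - ?F u" if "u \<le> v" "0 \<notin> {u..v}" for u v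
    proof (rule integral_FTC_atLeastAtMost[OF that(1)])
      show "(?F has_vector_derivative h l) (at l within {u..v})" if "u \<le> l" "l \<le> v" for l
        by (rule has_vector_derivative_at_within[OF der]) (use that \<open>0 \<notin> {u..v}\<close> in auto)
      show "continuous_on {u..v} h"
        using that(2) by (intro continuous_at_imp_continuous_on ballI cont) auto
    qed
    define b where "b = 3 * R + 1"
    have b: "b > 1" using R by (simp add: b_def)
    have F0: "?F l = 0" if "\<bar>l\<bar> \<ge> b" for l using that R by (intro ray_sum_eq_0[OF s]) (simp add: b_def)
    have h0: "h l = 0" if "\<bar>l\<bar> \<ge> b" for l
      using F0[OF that] that R ray_sum_eq_0[OF sg, of l] by (simp add: h_def b_def)
    define e where "e m = 1 / real (Suc m)" for m
    have e: "0 < e m" "e m \<le> 1" for m by (auto simp: e_def)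
    define S where "S m = {- b..- e m} \<union> {e m..b}" for m
    have I: "(LINT l|lborel. indicator (S m) l *\<^sub>R h l) = - (?F (e m) - ?F (- e m))" for m
    proof -
      have "(LINT l|lborel. indicator {- b..- e m} l *\<^sub>R h l) = ?F (- e m) - ?F (- b)"
        using e[of m] b by (intro ftc) auto
      moreover have "(LINT l|lborel. indicator {e m..b} l *\<^sub>R h l) = ?F b - ?F (e m)"
        using e[of m] b by (intro ftc) auto
      moreover have "indicator (S m) l *\<^sub>R h l = indicator {- b..- e m} l *\<^sub>R h l + indicator {e m..b} l *\<^sub>R h l" for l
        using e[of m] by (auto simp: S_def indicator_def)
      moreover have "integrable lborel (\<lambda>l. indicator A l *\<^sub>R h l)" if "A \<in> sets borel" for A
        using that by (intro integrable_mult_indicator hint) auto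
      ultimately show ?thesis using F0[of b] F0[of "- b"] b by simp
    qed
    have "(\<lambda>m. LINT l|lborel. indicator (S m) l *\<^sub>R h l) \<longlonglongrightarrow> (LINT l|lborel. h l)"
    proof (rule integral_dominated_convergence[where w = "\<lambda>l. norm (h l)"])
      show "AE l in lborel. (\<lambda>m. indicator (S m) l *\<^sub>R h l) \<longlonglongrightarrow> h l"
        using AE_lborel_singleton[of "0::real"]
      proof eventually_elim
        case (elim l)
        show ?case
        proof (cases "\<bar>l\<bar> \<ge> b")
          case False
          have "e \<longlonglongrightarrow> 0" unfolding e_def[abs_def] by (rule LIMSEQ_Suc[OF lim_1_over_n])
          then have "\<forall>\<^sub>F m in sequentially. e m < \<bar>l\<bar>" using elim by (intro order_tendstoD) auto
          then have "\<forall>\<^sub>F m in sequentially. indicator (S m) l *\<^sub>R h l = h l"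
            by eventually_elim (use False in \<open>auto simp: S_def indicator_def abs_real_def split: if_splits\<close>)
          then show ?thesis by (rule tendsto_eventually)
        qed (simp add: h0)
      qed
    qed (use hint in \<open>auto simp: S_def indicator_def intro!: borel_measurable_scaleR borel_measurable_indicator\<close>)
    moreover have "(\<lambda>m. LINT l|lborel. indicator (S m) l *\<^sub>R h l) \<longlonglongrightarrow> 0"
    proof (rule tendsto_norm_zero_cancel, rule Lim_null_comparison)
      let ?K = "2 * B * (\<bar>snd x\<bar> + 1) * (R + real ?n + 2) ^ ?n"
      show "\<forall>\<^sub>F m in sequentially. norm (norm (LINT l|lborel. indicator (S m) l *\<^sub>R h l)) \<le> ?K * (1 / real (Suc m))"
        unfolding I norm_minus_cancel real_norm_def abs_norm_cancel
        using ray_sum_jump[OF CN_le[OF c] s card_ge_1 R e] by (intro always_eventually allI) (simp add: e_def mult_ac)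
      show "(\<lambda>m. ?K * (1 / real (Suc m))) \<longlonglongrightarrow> 0"
        by (rule tendsto_mult_right_zero) (rule LIMSEQ_Suc[OF lim_1_over_n])
    qed
    ultimately have "(LINT l|lborel. h l) = 0" by (rule LIMSEQ_unique)
    then have "heis_A x * (LINT l|lborel. ?F l) = (LINT l|lborel. ?G l)"
      unfolding h_def using wave_eq_ray_sum(1)[OF adm(1), of x] wave_eq_ray_sum(1)[OF adm(2), of x] by simp
    then show ?thesis unfolding wave_eq_ray_sum(2)[OF adm(1)] wave_eq_ray_sum(2)[OF adm(2)] by simp
  qed
  then show ?thesis using that[OF cg sg] by blast
qed

section \<open>The upper bound\<close>

text \<open>The order of the quantifiers matters: the constant and the new box depend on R, N and k,
  but neither on f nor on B. The lemma will be applied to \<xi>^J g for all J at once, with B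
  depending on J.\<close>

lemma A_pow_wave:
  assumes "0 < R"
  shows "\<exists>C R'. 0 \<le> C \<and> 0 < R' \<and> (\<forall>f B. CN (N + 2 * k) B f \<and> box_supp R f \<longrightarrow>
     (\<exists>g. CN N (C * B) g \<and> box_supp R' g \<and>
       (\<forall>x::'n::finite heis. heis_A x ^ k * wave 0 (fan_coeff CARD('n) f) x = wave 0 (fan_coeff CARD('n) g) x)))"
  using assms
proof (induction k arbitrary: R)
  case 0
  then show ?case by (intro exI[of _ 1] exI[of _ R]) auto
next
  case (Suc k)
  let ?n = "CARD('n)"
  obtain C R' where C: "0 \<le> C" "0 < R'" and IH: "\<And>f B. CN (N + 2 * k) B f \<Longrightarrow> box_supp (3 * R) f \<Longrightarrow>
     (\<exists>g. CN N (C * B) g \<and> box_supp R' g \<and>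
       (\<forall>x::'n heis. heis_A x ^ k * wave 0 (fan_coeff ?n f) x = wave 0 (fan_coeff ?n g) x))"
    using Suc.IH[of "3 * R"] Suc.prems by auto
  define K where "K = 1 + real ?n + (2 + 2 * real ?n) * (3 * R + 1) * (real (N + 2 * k) + 1) * 3 ^ (N + 2 * k)"
  have K: "0 \<le> K" using Suc.prems by (simp add: K_def)
  show ?case
  proof (rule exI[of _ "C * K"], rule exI[of _ R'], intro conjI allI impI)
    show "0 \<le> C * K" "0 < R'" using C K by auto
    fix f B assume "CN (N + 2 * Suc k) B f \<and> box_supp R f"
    then have f: "CN (Suc (Suc (N + 2 * k))) B f" "box_supp R f" by (auto simp del: CN.simps)
    obtain g where g: "CN (N + 2 * k) (K * B) g" "box_supp (3 * R) g"
      "\<And>x::'n heis. heis_A x * wave 0 (fan_coeff ?n f) x = wave 0 (fan_coeff ?n g) x"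
      using A_wave[OF f Suc.prems, where 'n = 'n] unfolding K_def by blast
    obtain g' where g': "CN N (C * (K * B)) g'" "box_supp R' g'"
       "\<And>x::'n heis. heis_A x ^ k * wave 0 (fan_coeff ?n g) x = wave 0 (fan_coeff ?n g') x"
      using IH[OF g(1,2)] by blast
    show "\<exists>g. CN N (C * K * B) g \<and> box_supp R' g \<and>
       (\<forall>x::'n heis. heis_A x ^ Suc k * wave 0 (fan_coeff ?n f) x = wave 0 (fan_coeff ?n g) x)"
    proof (intro exI[of _ g'] conjI allI)
      fix x :: "'n heis"
      have "heis_A x ^ Suc k * wave 0 (fan_coeff ?n f) x = heis_A x ^ k * (heis_A x * wave 0 (fan_coeff ?n f) x)"
        by (simp only: power_Suc2 mult.assoc)
      then show "heis_A x ^ Suc k * wave 0 (fan_coeff ?n f) x = wave 0 (fan_coeff ?n g') x"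
        unfolding g(3) g'(3) .
    qed (use g' in \<open>simp_all add: mult.assoc\<close>)
  qed
qed

lemma wave_box_bound:
  assumes R: "0 < R"
  shows "\<exists>C\<ge>0. \<forall>f B. CN N B f \<and> box_supp R f \<longrightarrow> (\<forall>x::'n::finite heis. cmod (wave 0 (fan_coeff CARD('n) f) x) \<le> C * B)"
proof -
  let ?n = "CARD('n)"
  let ?I = "(1 + R) ^ (?n + 2) * (LINT q|nu. \<bar>snd q\<bar> ^ ?n * fan_mult ?n q / (1 + xi ?n q) ^ (?n + 2))"
  have "0 \<le> ?I"
    using R by (intro mult_nonneg_nonneg integral_nonneg_AE AE_I2) (auto intro!: divide_nonneg_nonneg zero_le_power add_nonneg_nonneg)
  moreover have "cmod (wave 0 (fan_coeff ?n f) x) \<le> ?I * B" if "CN N B f" "box_supp R f" for f B and x :: "'n heis"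
  proof -
    note fb = fan_coeff_bound_box[OF CN_continuous[OF that(1)] CN_bound[OF that(1)] that(2) card_ge_1[where 'n = 'n] R]
    show ?thesis using wave_bound[OF fb(1), of x] fb(2) by (simp add: mult_ac)
  qed
  ultimately show ?thesis by blast
qed

section \<open>Cut-offs of finite smoothness\<close>

text \<open>An exponent of at least 2 makes the difference quotient at 0 vanish in the limit. Powers
  of the positive part are the building blocks of the cut-offs and of the bump function.\<close>

lemma pos_part_power_deriv:
  "((\<lambda>x::real. max 0 x ^ Suc (Suc k)) has_real_derivative real (Suc (Suc k)) * max 0 x ^ Suc k) (at x)"
proof -
  consider "x < 0" | "x = 0" | "x > 0" by linarith
  then show ?thesis
  proof cases
    case 1
    have "((\<lambda>_. 0) has_real_derivative 0) (at x)" by simp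
    then have "((\<lambda>x::real. max 0 x ^ Suc (Suc k)) has_real_derivative 0) (at x)"
      by (rule has_field_derivative_transform_within_open[where S = "{..<0}"]) (use 1 in auto)
    then show ?thesis using 1 by (simp add: max_def)
  next
    case 2
    have "((\<lambda>h::real. (max 0 (0 + h) ^ Suc (Suc k) - max 0 0 ^ Suc (Suc k)) / h) \<longlongrightarrow> 0) (at 0)"
    proof (rule Lim_null_comparison[where g = "\<lambda>h. \<bar>h\<bar> ^ Suc k"])
      show "\<forall>\<^sub>F h in at 0. norm ((max 0 (0 + h) ^ Suc (Suc k) - max 0 0 ^ Suc (Suc k)) / h) \<le> \<bar>h\<bar> ^ Suc k"
      proof (intro always_eventually allI)
        fix h :: real
        show "norm ((max 0 (0 + h) ^ Suc (Suc k) - max 0 0 ^ Suc (Suc k)) / h) \<le> \<bar>h\<bar> ^ Suc k"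
          by (cases "h > 0") (simp_all add: max_absorb1 max_absorb2 del: power_Suc, simp)
      qed
      have "((\<lambda>h::real. \<bar>h\<bar> ^ Suc k) \<longlongrightarrow> \<bar>0\<bar> ^ Suc k) (at 0)" by (intro tendsto_intros)
      then show "((\<lambda>h::real. \<bar>h\<bar> ^ Suc k) \<longlongrightarrow> 0) (at 0)" by simp
    qed
    then show ?thesis using 2 by (simp add: DERIV_def)
  next
    case 3
    have "((\<lambda>x. x ^ Suc (Suc k)) has_real_derivative real (Suc (Suc k)) * x ^ Suc k) (at x)"
      using DERIV_pow[of "Suc (Suc k)" x] by simp
    then have "((\<lambda>x::real. max 0 x ^ Suc (Suc k)) has_real_derivative real (Suc (Suc k)) * x ^ Suc k) (at x)"
      by (rule has_field_derivative_transform_within_open[where S = "{0<..}"]) (use 3 in auto)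
    then show ?thesis using 3 by (simp add: max_def)
  qed
qed

text \<open>\<open>step_cut a 0 b\<close> is a step function of finite smoothness: \<open>1\<close> on the negative axis, \<open>0\<close> beyond \<open>1\<close>.
  The factor \<open>y\<^sub>+ ^ c\<close> makes the family closed under differentiation.\<close>

definition step_cut :: "nat \<Rightarrow> nat \<Rightarrow> nat \<Rightarrow> real \<Rightarrow> real" where
  "step_cut a c b y = max 0 y ^ c * max 0 (1 - max 0 y ^ a) ^ b"

lemma step_cut_bound: "0 < b \<Longrightarrow> 0 < a \<Longrightarrow> \<bar>step_cut a c b y\<bar> \<le> 1"
proof -
  assume ab: "0 < b" "0 < a"
  show ?thesis
  proof (cases "y \<le> 1")
    case True
    have 1: "max 0 y ^ c \<le> 1" using True by (intro power_le_one) auto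
    have 0: "0 \<le> max 0 y ^ a" by simp
    have 2: "max 0 (1 - max 0 y ^ a) ^ b \<le> 1" by (rule power_le_one) (use 0 in auto)
    have "0 \<le> step_cut a c b y" unfolding step_cut_def by simp
    moreover have "step_cut a c b y \<le> 1" unfolding step_cut_def by (rule mult_le_one[OF 1 _ 2]) simp
    ultimately show ?thesis by simp
  next
    case False
    then have "1 \<le> max 0 y ^ a" by (intro one_le_power) auto
    then show ?thesis using ab by (simp add: step_cut_def zero_power)
  qed
qed

lemma step_cut_deriv:
  assumes "c = 0 \<or> 2 \<le> c" "2 \<le> b" "2 \<le> a"
  shows "(step_cut a c b has_real_derivative (real c * step_cut a (c - 1) b y - real (a * b) * step_cut a (c + a - 1) (b - 1) y)) (at y)"
proof -
  have pp: "((\<lambda>y::real. max 0 y ^ k) has_real_derivative real k * max 0 y ^ (k - 1)) (at y)" if "2 \<le> k" for k y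
  proof -
    have "2 \<le> k" by (rule that)
    then obtain j where "k = 2 + j" unfolding le_iff_add by blast
    then show ?thesis using pos_part_power_deriv[of j y] by simp
  qed
  have c: "((\<lambda>y::real. max 0 y ^ c) has_real_derivative real c * max 0 y ^ (c - 1)) (at y)"
    using assms(1)
  proof
    assume "c = 0" then show ?thesis by simp
  qed (rule pp)
  have i: "((\<lambda>y::real. 1 - max 0 y ^ a) has_real_derivative - (real a * max 0 y ^ (a - 1))) (at y)"
    using DERIV_diff[OF DERIV_const pp[OF assms(3)]] by simp
  have e: "max 0 y ^ (c + a - 1) = max 0 y ^ c * max 0 y ^ (a - 1)"
    using assms(3) by (simp add: power_add[symmetric])
  show ?thesis
    unfolding step_cut_def[abs_def]
    by (rule DERIV_cong[OF DERIV_mult[OF c DERIV_chain2[OF pp[OF assms(2)] i]]], unfold e)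
       (simp add: algebra_simps)
qed

text \<open>The hypothesis is stable under differentiation. Of the two terms of the derivative, one
  lowers c by 1, or drops out if c = 0; the other lowers b by 1 and raises c by a - 1, which keeps
  it above the remaining order.\<close>

lemma CN_step_cut:
  assumes "c = 0 \<or> N < c" "N < b" "N < a"
  shows "\<exists>B. CN N B (\<lambda>p. of_real (step_cut a c b (u * fst p + v * snd p + w)))"
  using assms
proof (induction N arbitrary: c b)
  case 0
  have "continuous_on UNIV (step_cut a c b)" unfolding step_cut_def[abs_def] by (intro continuous_intros)
  then have "continuous_on UNIV (\<lambda>p::real \<times> real. complex_of_real (step_cut a c b (u * fst p + v * snd p + w)))"
    by (rule continuous_on_of_real[OF continuous_on_compose2]) (auto intro!: continuous_intros)
  then show ?case using step_cut_bound[of b a c] 0 by (intro exI[of _ 1]) auto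
next
  case (Suc N)
  let ?L = "\<lambda>p::real \<times> real. u * fst p + v * snd p + w"
  let ?D = "\<lambda>y. real c * step_cut a (c - 1) b y - real (a * b) * step_cut a (c + a - 1) (b - 1) y"
  obtain B1 where B1: "CN N B1 (\<lambda>p. of_real (step_cut a (c - 1) b (?L p)))"
    using Suc.IH[of "c - 1" b] Suc.prems by (cases "c = 0") (auto simp: less_diff_conv)
  obtain B2 where B2: "CN N B2 (\<lambda>p. of_real (step_cut a (c + a - 1) (b - 1) (?L p)))"
    using Suc.IH[of "c + a - 1" "b - 1"] Suc.prems by (auto simp: less_diff_conv)
  obtain B where B: "CN N B (\<lambda>p. of_real (?D (?L p)))"
    using CN_add[OF CN_cmult[OF B1, of "of_nat c"] CN_cmult[OF B2, of "- of_nat (a * b)"]] by (auto simp: algebra_simps)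
  have d: "(step_cut a c b has_real_derivative ?D y) (at y)" for y
    by (rule step_cut_deriv) (use Suc.prems in auto)
  have B3: "CN N (cmod (of_real t) * B) (\<lambda>p. of_real t * of_real (?D (?L p)))" for t
    by (rule CN_cmult[OF B])
  have "CN (Suc N) (max 1 (max (cmod (of_real u) * B) (cmod (of_real v) * B))) (\<lambda>p. of_real (step_cut a c b (?L p)))"
  proof (rule CN_SucI)
    show "CN N (max 1 (max (cmod (of_real u) * B) (cmod (of_real v) * B))) (\<lambda>p. of_real u * of_real (?D (?L p)))"
      "CN N (max 1 (max (cmod (of_real u) * B) (cmod (of_real v) * B))) (\<lambda>p. of_real v * of_real (?D (?L p)))"
      by (rule CN_mono[OF B3], simp)+
    show "cmod (of_real (step_cut a c b (?L p))) \<le> max 1 (max (cmod (of_real u) * B) (cmod (of_real v) * B))" for p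
      using step_cut_bound[of b a c "?L p"] Suc.prems by (auto simp: le_max_iff_disj)
    show "((\<lambda>p. complex_of_real (step_cut a c b (?L p))) has_derivative
       (\<lambda>h. fst h *\<^sub>R (of_real u * of_real (?D (?L p))) + snd h *\<^sub>R (of_real v * of_real (?D (?L p))))) (at p)" for p
    proof -
      have L: "(?L has_derivative (\<lambda>h. u * fst h + v * snd h)) (at p)" by (auto intro!: derivative_eq_intros)
      have "((\<lambda>p. step_cut a c b (?L p)) has_derivative (\<lambda>h. ?D (?L p) * (u * fst h + v * snd h))) (at p)"
        using has_derivative_compose[OF L d[unfolded has_field_derivative_def]] by simp
      from has_derivative_of_real[OF this] show ?thesis
        by (rule has_derivative_eq_rhs) (auto simp: scaleR_conv_of_real algebra_simps)
    qed
  qed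
  then show ?case by blast
qed

lemma fan_abs_le: "p \<in> fan n \<Longrightarrow> n \<ge> 1 \<Longrightarrow> \<bar>snd p\<bar> \<le> fst p"
proof -
  assume p: "p \<in> fan n" and n: "n \<ge> 1"
  have "\<bar>snd p\<bar> * 1 \<le> \<bar>snd p\<bar> * real (2 * j + n)" for j using n by (intro mult_left_mono) auto
  then show ?thesis using p by (auto simp: fan_def)
qed

text \<open>Between neighbouring points of the fan an arbitrary extension of \<open>F\<close> may be large; cutting it
  off just outside the support of \<open>F\<close> does not change it on the fan.\<close>

lemma fan_cutoff:
  assumes f: "schwartz f" and F: "\<And>p. p \<in> fan n \<Longrightarrow> F p = f p" and n: "n \<ge> 1"
    and \<rho>: "\<And>p. p \<in> fan n \<Longrightarrow> F p \<noteq> 0 \<Longrightarrow> fst p \<le> \<rho>" and R: "0 \<le> \<rho>" "\<rho> < R"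
  shows "\<exists>g B. CN N B g \<and> box_supp R g \<and> (\<forall>p\<in>fan n. F p = g p)"
proof -
  define \<delta> where "\<delta> = R - \<rho>"
  have \<delta>: "\<delta> > 0" using R by (simp add: \<delta>_def)
  define k where "k u v w p = complex_of_real (step_cut (Suc N) 0 (Suc N) (u * fst p + v * snd p + w))" for u v w :: real and p :: "real \<times> real"
  \<comment> \<open>The four sides of the box. \<open>k1\<close> falls from 1 to 0 between \<xi> =
    \<rho> and R, \<open>k2\<close> between 0 and -\<delta>, where \<delta> is at most R, and
    \<open>k3\<close>, \<open>k4\<close> do so for |\<lambda>| between \<rho> and R. On the fan
    |\<lambda>| is at most \<xi>, so all four equal 1 where F is nonzero.\<close>
  define k1 k2 k3 k4 where "k1 = k (1/\<delta>) 0 (- \<rho>/\<delta>)" and "k2 = k (- 1/\<delta>) 0 0" and "k3 = k 0 (1/\<delta>) (- \<rho>/\<delta>)" and "k4 = k 0 (- 1/\<delta>) (- \<rho>/\<delta>)"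
  define g where "g p = f p * (k1 p * (k2 p * (k3 p * k4 p)))" for p
  obtain B0 where B0: "CN N B0 f" using schwartz_CN[OF f] by blast
  have kc: "\<exists>B. CN N B (k u v w)" for u v w
    unfolding k_def[abs_def] by (rule CN_step_cut) auto
  obtain B1 B2 B3 B4 where B: "CN N B1 k1" "CN N B2 k2" "CN N B3 k3" "CN N B4 k4"
    unfolding k1_def k2_def k3_def k4_def using kc by metis
  have "\<exists>B. CN N B g"
    unfolding g_def[abs_def] using CN_mult[OF B0 CN_mult[OF B(1) CN_mult[OF B(2) CN_mult[OF B(3) B(4)]]]] by blast
  moreover have "box_supp R g"
    unfolding box_supp_def
  proof (intro allI impI)
    have k0: "k u v w p = 0" if "u * fst p + v * snd p + w \<ge> 1" for u v w p
    proof -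
      have "1 \<le> max 0 (u * fst p + v * snd p + w) ^ Suc N" using that by (intro one_le_power) auto
      then show ?thesis by (simp add: k_def step_cut_def del: power_Suc)
    qed
    fix p :: "real \<times> real" assume "\<bar>fst p\<bar> > R \<or> \<bar>snd p\<bar> > R"
    then consider "fst p > R" | "fst p < - R" | "snd p > R" | "snd p < - R" by linarith
    then show "g p = 0"
    proof cases
      case 1
      then have "k1 p = 0" unfolding k1_def using \<delta> R by (intro k0) (simp add: \<delta>_def divide_simps)
      then show ?thesis by (simp add: g_def)
    next
      case 2
      then have "k2 p = 0" unfolding k2_def using \<delta> R by (intro k0) (simp add: \<delta>_def divide_simps)
      then show ?thesis by (simp add: g_def)
    next
      case 3
      then have "k3 p = 0" unfolding k3_def using \<delta> R by (intro k0) (simp add: \<delta>_def divide_simps)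
      then show ?thesis by (simp add: g_def)
    next
      case 4
      then have "k4 p = 0" unfolding k4_def using \<delta> R by (intro k0) (simp add: \<delta>_def divide_simps)
      then show ?thesis by (simp add: g_def)
    qed
  qed
  moreover have "F p = g p" if p: "p \<in> fan n" for p
  proof (cases "F p = 0")
    case True
    then show ?thesis using F[OF p] by (simp add: g_def)
  next
    case False
    have k1: "k u v w p = 1" if "u * fst p + v * snd p + w \<le> 0" for u v w
      using that by (simp add: k_def step_cut_def max_absorb1)
    have "fst p \<le> \<rho>" "\<bar>snd p\<bar> \<le> fst p" using \<rho>[OF p False] fan_abs_le[OF p n] by auto
    then have "k1 p = 1" "k2 p = 1" "k3 p = 1" "k4 p = 1"
      unfolding k1_def k2_def k3_def k4_def using \<delta> by (auto intro!: k1 simp: divide_simps)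
    then show ?thesis using F[OF p] by (simp add: g_def)
  qed
  ultimately show ?thesis by blast
qed

lemma inv_gelfand_wave_pow:
  fixes F :: "real \<times> real \<Rightarrow> complex"
  assumes g: "continuous_on UNIV g" and F: "\<And>p. p \<in> fan CARD('n) \<Longrightarrow> F p = g p"
    and adm: "adm CARD('n) (fan_coeff CARD('n) g)"
  shows "(sublaplacian ^^ J) (inv_gelfand F :: 'n::finite heis \<Rightarrow> complex)
     = wave 0 (fan_coeff CARD('n) (\<lambda>p. of_real (fst p ^ J) * g p))"
proof -
  have "inv_gelfand F = (wave 0 (fan_coeff CARD('n) g) :: 'n heis \<Rightarrow> complex)"
    by (intro ext inv_gelfand_eq_wave borel_measurable_continuous_onI g F)
  moreover have "fan_coeff CARD('n) (\<lambda>p. of_real (fst p ^ J) * g p) = (\<lambda>q. of_real (xi CARD('n) q ^ J) * fan_coeff CARD('n) g q)"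
    by (simp add: fun_eq_iff fan_coeff_def xi_def)
  ultimately show ?thesis using sublaplacian_pow_wave[OF adm, of J] by simp
qed

lemma inv_gelfand_upper_bound:
  assumes f: "schwartz_fan CARD('n) F"
    and \<rho>: "\<And>p. p \<in> fan CARD('n) \<Longrightarrow> F p \<noteq> 0 \<Longrightarrow> fst p \<le> \<rho>" and R: "0 \<le> \<rho>" "\<rho> < R"
  shows "\<exists>C\<ge>0. \<forall>J (x::'n::finite heis). (1 + cmod (heis_A x)) ^ k * cmod ((sublaplacian ^^ J) (inv_gelfand F) x)
     \<le> C * (1 + real J / R) ^ (2 * k) * R ^ J"
proof -
  let ?n = "CARD('n)"
  have R0: "0 < R" using R by linarith
  have *: "\<exists>C\<ge>0. \<forall>J (x::'n heis). cmod (heis_A x) ^ k * cmod ((sublaplacian ^^ J) (inv_gelfand F) x)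
     \<le> C * ((1 + real J / R) ^ (2 * k) * R ^ J)" for k
  proof -
    obtain f0 where "schwartz f0" "\<And>p. p \<in> fan ?n \<Longrightarrow> F p = f0 p" using f by (auto simp: schwartz_fan_def)
    then obtain g B where g: "CN (0 + 2 * k) B g" "box_supp R g" "\<And>p. p \<in> fan ?n \<Longrightarrow> F p = g p"
      using fan_cutoff[of f0 ?n F \<rho> R "0 + 2 * k"] \<rho> R card_ge_1[where 'n = 'n] by blast
    have B: "0 \<le> B" using g(1) CN_nonneg by blast
    obtain C1 R' where C1: "0 \<le> C1" "0 < R'" and AP: "\<And>f B. CN (0 + 2 * k) B f \<Longrightarrow> box_supp R f \<Longrightarrow>
     (\<exists>g. CN 0 (C1 * B) g \<and> box_supp R' g \<and>
       (\<forall>x::'n heis. heis_A x ^ k * wave 0 (fan_coeff ?n f) x = wave 0 (fan_coeff ?n g) x))"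
      using A_pow_wave[OF R0, of 0 k, where 'n = 'n] by blast
    obtain C2 where C2: "0 \<le> C2" and WB: "\<And>f B (x::'n heis). CN 0 B f \<Longrightarrow> box_supp R' f \<Longrightarrow> cmod (wave 0 (fan_coeff ?n f) x) \<le> C2 * B"
      using wave_box_bound[OF C1(2), of 0, where 'n = 'n] by blast
    have gc: "continuous_on UNIV g" using CN_continuous[OF g(1)] .
    note adm = fan_coeff_bound_box(1)[OF gc CN_bound[OF g(1)] g(2) card_ge_1[where 'n = 'n] R0]
    show ?thesis
    proof (intro exI[of _ "C2 * C1 * B"] conjI allI)
      show "0 \<le> C2 * C1 * B" using C1 C2 B by simp
      fix J and x :: "'n heis"
      \<comment> \<open>The power \<xi>^J is inserted before \<A> acts, while the support is still
        in the box of size R. Hence R^J and not a power of the larger R' appears; R' enters only the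
        constant \<open>C2\<close>.\<close>
      let ?g = "\<lambda>p. of_real (fst p ^ J) * g p"
      have s: "box_supp R ?g" using g(2) by (auto simp: box_supp_def)
      obtain g' where g': "CN 0 (C1 * (B * R ^ J * (1 + real J / R) ^ (0 + 2 * k))) g'" "box_supp R' g'"
        "\<And>x::'n heis. heis_A x ^ k * wave 0 (fan_coeff ?n ?g) x = wave 0 (fan_coeff ?n g') x"
        using AP[OF CN_fst_power[OF R0 g(1,2), of J] s] by blast
      have "cmod (heis_A x) ^ k * cmod ((sublaplacian ^^ J) (inv_gelfand F) x) = cmod (wave 0 (fan_coeff ?n g') x)"
      proof -
        have "(sublaplacian ^^ J) (inv_gelfand F) x = wave 0 (fan_coeff ?n ?g) x"
          by (simp only: inv_gelfand_wave_pow[OF gc g(3) adm])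
        then show ?thesis by (simp only: g'(3)[symmetric] norm_mult norm_power)
      qed
      also have "\<dots> \<le> C2 * (C1 * (B * R ^ J * (1 + real J / R) ^ (0 + 2 * k)))"
        by (rule WB[OF g'(1,2)])
      finally show "cmod (heis_A x) ^ k * cmod ((sublaplacian ^^ J) (inv_gelfand F) x)
         \<le> C2 * C1 * B * ((1 + real J / R) ^ (2 * k) * R ^ J)"
        by (simp add: mult_ac)
    qed
  qed
  obtain C0 Ck where C: "0 \<le> C0" "0 \<le> Ck"
    and b0: "\<And>J (x::'n heis). cmod ((sublaplacian ^^ J) (inv_gelfand F) x) \<le> C0 * R ^ J"
    and bk: "\<And>J (x::'n heis). cmod (heis_A x) ^ k * cmod ((sublaplacian ^^ J) (inv_gelfand F) x) \<le> Ck * ((1 + real J / R) ^ (2 * k) * R ^ J)"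
    using *[of 0] *[of k] by auto
  show ?thesis
  proof (intro exI[of _ "2 ^ k * (C0 + Ck)"] conjI allI)
    show "0 \<le> 2 ^ k * (C0 + Ck)" using C by simp
    fix J and x :: "'n heis"
    let ?a = "cmod (heis_A x)" and ?u = "cmod ((sublaplacian ^^ J) (inv_gelfand F) x)"
    have "(1 + ?a) ^ k \<le> (2 * max 1 ?a) ^ k" by (intro power_mono) auto
    also have "\<dots> \<le> 2 ^ k * (1 + ?a ^ k)"
      unfolding power_mult_distrib by (intro mult_left_mono) (auto simp: max_def)
    finally have "(1 + ?a) ^ k * ?u \<le> 2 ^ k * (1 + ?a ^ k) * ?u" by (intro mult_right_mono) auto
    also have "\<dots> = 2 ^ k * (?u + ?a ^ k * ?u)" by (simp add: algebra_simps)
    also have "\<dots> \<le> 2 ^ k * (C0 * R ^ J + Ck * ((1 + real J / R) ^ (2 * k) * R ^ J))"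
      by (intro mult_left_mono add_mono b0 bk) auto
    also have "\<dots> \<le> 2 ^ k * (C0 * ((1 + real J / R) ^ (2 * k) * R ^ J) + Ck * ((1 + real J / R) ^ (2 * k) * R ^ J))"
      using R0 C mult_right_mono[OF one_le_power[of "1 + real J / R" "2 * k"], of "R ^ J"]
      by (intro mult_left_mono add_mono) auto
    finally show "(1 + ?a) ^ k * ?u \<le> 2 ^ k * (C0 + Ck) * (1 + real J / R) ^ (2 * k) * R ^ J"
      by (simp add: algebra_simps)
  qed
qed

section \<open>Radial integrals and orthogonality\<close>

lemma lagf_decay: "\<exists>C\<ge>0. \<forall>s\<ge>0. \<bar>lagf a j s\<bar> * (1 + s) ^ N \<le> C"
proof -
  define K where "K = (\<Sum>i\<le>j. real ((j + a) choose (i + a)) / fact i)"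
  have K: "0 \<le> K" by (simp add: K_def sum_nonneg)
  show ?thesis
  proof (intro exI[of _ "K * (fact (j + N) * 2 ^ (j + N) * exp (1 / 2))"] conjI allI impI)
    show "0 \<le> K * (fact (j + N) * 2 ^ (j + N) * exp (1 / 2))" using K by simp
    fix s :: real assume s: "0 \<le> s"
    have "\<bar>lag a j s\<bar> \<le> (\<Sum>i\<le>j. real ((j + a) choose (i + a)) / fact i * (1 + s) ^ j)"
      unfolding lag_def
    proof (rule order_trans[OF sum_abs sum_mono])
      fix i assume "i \<in> {..j}"
      then have "s ^ i \<le> (1 + s) ^ j" using s by (intro order_trans[OF power_mono[of s "1 + s" i] power_increasing]) auto
      then show "\<bar>(- 1) ^ i * real ((j + a) choose (i + a)) / fact i * s ^ i\<bar> \<le> real ((j + a) choose (i + a)) / fact i * (1 + s) ^ j"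
        using s by (simp add: abs_mult divide_right_mono mult_left_mono)
    qed
    then have l: "\<bar>lag a j s\<bar> \<le> K * (1 + s) ^ j" by (simp only: K_def sum_distrib_right)
    have "((1 + s) / 2) ^ (j + N) / fact (j + N) \<le> exp ((1 + s) / 2)" using s by (intro power_le_exp) simp
    then have e: "(1 + s) ^ (j + N) \<le> fact (j + N) * 2 ^ (j + N) * exp ((1 + s) / 2)"
      by (simp add: power_divide pos_divide_le_eq mult_ac)
    have "\<bar>lagf a j s\<bar> * (1 + s) ^ N = exp (- s / 2) * (\<bar>lag a j s\<bar> * (1 + s) ^ N)"
      by (simp add: lagf_def abs_mult)
    also have "\<dots> \<le> exp (- s / 2) * (K * (1 + s) ^ j * (1 + s) ^ N)"
      using s by (intro mult_left_mono mult_right_mono l) auto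
    also have "\<dots> = exp (- s / 2) * K * (1 + s) ^ (j + N)" by (simp add: power_add)
    also have "\<dots> \<le> exp (- s / 2) * K * (fact (j + N) * 2 ^ (j + N) * exp ((1 + s) / 2))"
      using K by (intro mult_left_mono e) auto
    also have "\<dots> = K * (fact (j + N) * 2 ^ (j + N) * (exp (- s / 2) * exp ((1 + s) / 2)))" by (simp only: mult_ac)
    also have "exp (- s / 2) * exp ((1 + s) / 2) = exp (1 / 2)" unfolding exp_add[symmetric] by (simp add: add_divide_distrib)
    finally show "\<bar>lagf a j s\<bar> * (1 + s) ^ N \<le> K * (fact (j + N) * 2 ^ (j + N) * exp (1 / 2))" .
  qed
qed

lemma lagd_decay: "\<exists>C\<ge>0. \<forall>s\<ge>0. \<bar>lagd m a j s\<bar> * (1 + s) ^ N \<le> C"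
proof (induction m arbitrary: a j)
  case 0
  then show ?case using lagf_decay by simp
next
  case (Suc m)
  show ?case
  proof (cases j)
    case 0
    obtain C where C: "0 \<le> C" "\<And>s. 0 \<le> s \<Longrightarrow> \<bar>lagd m a 0 s\<bar> * (1 + s) ^ N \<le> C" using Suc.IH[of a 0] by blast
    have "\<bar>lagd (Suc m) a 0 s\<bar> * (1 + s) ^ N \<le> C" if "0 \<le> s" for s
      using C(1) C(2)[OF that] by (simp add: field_simps)
    then show ?thesis using 0 C(1) by blast
  next
    case (Suc k)
    obtain C where C: "0 \<le> C" "\<And>s. 0 \<le> s \<Longrightarrow> \<bar>lagd m a j s\<bar> * (1 + s) ^ N \<le> C" using Suc.IH[of a j] by blast
    obtain D where D: "0 \<le> D" "\<And>s. 0 \<le> s \<Longrightarrow> \<bar>lagd m (Suc a) k s\<bar> * (1 + s) ^ N \<le> D" using Suc.IH[of "Suc a" k] by blast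
    show ?thesis
    proof (intro exI[of _ "C + D"] conjI allI impI)
      fix s :: real assume s: "0 \<le> s"
      have "\<bar>lagd (Suc m) a j s\<bar> \<le> \<bar>lagd m a j s\<bar> + \<bar>lagd m (Suc a) k s\<bar>" using Suc by simp
      then have "\<bar>lagd (Suc m) a j s\<bar> * (1 + s) ^ N \<le> (\<bar>lagd m a j s\<bar> + \<bar>lagd m (Suc a) k s\<bar>) * (1 + s) ^ N"
        using s by (intro mult_right_mono) auto
      also have "\<dots> \<le> C + D" using C(2)[OF s] D(2)[OF s] by (simp add: distrib_right)
      finally show "\<bar>lagd (Suc m) a j s\<bar> * (1 + s) ^ N \<le> C + D" .
    qed (use C D in auto)
  qed
qed

text \<open>Half the area of the unit sphere in real dimension 2n, because r^(2n-1) dr = s^(n-1) ds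
  / 2 for s = r^2.\<close>

definition sphere_const :: "nat \<Rightarrow> real" where
  "sphere_const n = real n * unit_ball_vol (2 * real n)"

text \<open>Polar coordinates for radial functions, read off from the volumes of balls: it is enough
  to compare the two measures on half-lines, and the volume of the ball of radius sqrt a is a
  multiple of a^n.\<close>

lemma distr_norm_square:
  "distr lborel borel (\<lambda>z :: complex ^ 'n::finite. (norm z)\<^sup>2) =
   density lborel (\<lambda>s. ennreal (sphere_const CARD('n) * s ^ (CARD('n) - 1)) * indicator {0..} s)"
  (is "?M = ?N")
proof (rule measure_eqI_generator_eq[where E = "range (\<lambda>a::real. {..a})" and A = "\<lambda>i. {..real i}" and \<Omega> = UNIV])
  let ?n = "CARD('n)"
  have v: "0 \<le> unit_ball_vol (2 * real ?n)" by simp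
  have M: "emeasure ?M {..a} = ennreal (unit_ball_vol (2 * real ?n) * a ^ ?n)" if "0 \<le> a" for a
  proof -
    have "emeasure ?M {..a} = emeasure lborel {z :: complex ^ 'n. (norm z)\<^sup>2 \<le> a}"
      by (subst emeasure_distr) (auto simp: vimage_def)
    also have "{z :: complex ^ 'n. (norm z)\<^sup>2 \<le> a} = cball 0 (sqrt a)"
    proof -
      have "(norm z)\<^sup>2 \<le> a \<longleftrightarrow> norm z \<le> sqrt a" for z :: "complex ^ 'n"
        unfolding real_sqrt_le_iff[symmetric, of "(norm z)\<^sup>2" a] real_sqrt_abs abs_norm_cancel ..
      then show ?thesis by (simp only: set_eq_iff mem_Collect_eq mem_cball dist_0_norm simp_thms)
    qed
    also have "emeasure lborel \<dots> = ennreal (unit_ball_vol (real DIM(complex ^ 'n)) * sqrt a ^ DIM(complex ^ 'n))"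
      using that by (intro emeasure_cball) simp
    also have "\<dots> = ennreal (unit_ball_vol (2 * real ?n) * a ^ ?n)"
      using that by (simp add: mult.commute[of ?n] power_mult)
    finally show ?thesis .
  qed
  have N: "emeasure ?N {..a} = ennreal (unit_ball_vol (2 * real ?n) * a ^ ?n)" if "0 \<le> a" for a
  proof -
    have "emeasure ?N {..a} = (\<integral>\<^sup>+ s. ennreal (sphere_const ?n * s ^ (?n - 1)) * indicator {0..a} s \<partial>lborel)"
      by (subst emeasure_density) (auto intro!: nn_integral_cong simp: indicator_def)
    also have "\<dots> = ennreal (unit_ball_vol (2 * real ?n) * a ^ ?n - unit_ball_vol (2 * real ?n) * 0 ^ ?n)"
    proof (rule nn_integral_FTC_Icc[where F = "\<lambda>a. unit_ball_vol (2 * real ?n) * a ^ ?n"])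
      show "((\<lambda>a. unit_ball_vol (2 * real ?n) * a ^ ?n) has_real_derivative sphere_const ?n * s ^ (?n - 1)) (at s)" for s
        unfolding sphere_const_def by (auto intro!: derivative_eq_intros)
      show "0 \<le> sphere_const ?n * s ^ (?n - 1)" if "s \<in> {0..a}" for s using that v by (simp add: sphere_const_def)
    qed (use that in auto)
    also have "(0::real) ^ ?n = 0" by (rule zero_power) simp
    finally show ?thesis by simp
  qed
  show "Int_stable (range (\<lambda>a::real. {..a}))" by (auto simp: Int_stable_def)
  show "emeasure ?M X = emeasure ?N X" if "X \<in> range (\<lambda>a::real. {..a})" for X
  proof -
    from that obtain a where a: "X = {..a}" by blast
    show ?thesis
    proof (cases "0 \<le> a")
      case False
      have "{z :: complex ^ 'n. (norm z)\<^sup>2 \<le> a} = {}"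
        using False zero_le_power2 order_trans by blast
      then have "emeasure ?M {..a} = 0" by (subst emeasure_distr) (auto simp: vimage_def)
      moreover have "emeasure ?N {..a} = 0" using False by (subst emeasure_density) (auto simp: nn_integral_0_iff_AE indicator_def)
      ultimately show ?thesis using a by simp
    next
      case True
      then show ?thesis unfolding a by (simp only: M N)
    qed
  qed
  show "sets ?M = sigma_sets UNIV (range (\<lambda>a::real. {..a}))" "sets ?N = sigma_sets UNIV (range (\<lambda>a::real. {..a}))"
    by (simp_all add: borel_eq_atMost)
  show "(\<Union>i. {..real i}) = (UNIV :: real set)" by (auto intro: real_arch_simple)
  show "emeasure ?M {..real i} \<noteq> \<infinity>" for i using M by simp
qed auto

lemma nn_integral_radial:
  assumes [measurable]: "f \<in> borel_measurable borel"
  shows "(\<integral>\<^sup>+ z. f ((norm (z :: complex ^ 'n::finite))\<^sup>2) \<partial>lborel) =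
    (\<integral>\<^sup>+ s. ennreal (sphere_const CARD('n) * s ^ (CARD('n) - 1)) * indicator {0..} s * f s \<partial>lborel)"
proof -
  have "(\<integral>\<^sup>+ z. f ((norm (z :: complex ^ 'n))\<^sup>2) \<partial>lborel) = (\<integral>\<^sup>+ s. f s \<partial>distr lborel borel (\<lambda>z :: complex ^ 'n. (norm z)\<^sup>2))"
    by (subst nn_integral_distr) auto
  then show ?thesis unfolding distr_norm_square by (subst (asm) nn_integral_density) auto
qed

lemma integral_radial:
  fixes f :: "real \<Rightarrow> real"
  assumes [measurable]: "f \<in> borel_measurable borel"
  shows "(LINT z|lborel. f ((norm (z :: complex ^ 'n::finite))\<^sup>2)) =
    (LINT s|lborel. indicator {0..} s *\<^sub>R (sphere_const CARD('n) * s ^ (CARD('n) - 1) * f s))"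
proof -
  have w: "ennreal (sphere_const CARD('n) * s ^ (CARD('n) - 1)) * indicator {0..} s = ennreal (indicator {0..} s * (sphere_const CARD('n) * s ^ (CARD('n) - 1)))" for s
    by (auto simp: indicator_def)
  have "(LINT z|lborel. f ((norm (z :: complex ^ 'n))\<^sup>2)) = (LINT s|distr lborel borel (\<lambda>z :: complex ^ 'n. (norm z)\<^sup>2). f s)"
    by (subst integral_distr) auto
  also have "\<dots> = (LINT s|lborel. (indicator {0..} s * (sphere_const CARD('n) * s ^ (CARD('n) - 1))) *\<^sub>R f s)"
    unfolding distr_norm_square w by (subst integral_density) (auto simp: indicator_def sphere_const_def)
  finally show ?thesis by (simp add: mult.assoc)
qed

lemma integrable_radial:
  "integrable lborel (\<lambda>z :: complex ^ 'n::finite. 1 / (1 + (norm z)\<^sup>2) ^ (CARD('n) + 1))"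
proof (rule integrableI_bounded)
  let ?n = "CARD('n)"
  have c: "0 \<le> sphere_const ?n" by (simp add: sphere_const_def)
  have "(\<integral>\<^sup>+ z. ennreal (norm (1 / (1 + (norm (z :: complex ^ 'n))\<^sup>2) ^ (?n + 1))) \<partial>lborel) =
    (\<integral>\<^sup>+ s. ennreal (sphere_const ?n * s ^ (?n - 1)) * indicator {0..} s * ennreal (norm (1 / (1 + s) ^ (?n + 1))) \<partial>lborel)"
    by (rule nn_integral_radial) measurable
  also have "\<dots> \<le> (\<integral>\<^sup>+ s. ennreal (sphere_const ?n * (1 / (1 + s\<^sup>2))) \<partial>lborel)"
  proof (rule nn_integral_mono)
    fix s :: real
    show "ennreal (sphere_const ?n * s ^ (?n - 1)) * indicator {0..} s * ennreal (norm (1 / (1 + s) ^ (?n + 1))) \<le> ennreal (sphere_const ?n * (1 / (1 + s\<^sup>2)))"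
    proof (cases "0 \<le> s")
      case True
      have "s ^ (?n - 1) * (1 + s\<^sup>2) \<le> (1 + s) ^ (?n - 1) * (1 + s)\<^sup>2"
        using True by (intro mult_mono power_mono) (auto simp: power2_sum)
      also have "\<dots> = (1 + s) ^ (?n + 1)" unfolding power_add[symmetric] using card_ge_1[where 'n = 'n] by simp
      finally have "s ^ (?n - 1) / (1 + s) ^ (?n + 1) \<le> 1 / (1 + s\<^sup>2)"
        using True add_pos_nonneg[of 1 "s\<^sup>2"] by (simp add: divide_simps)
      then have "sphere_const ?n * (s ^ (?n - 1) / (1 + s) ^ (?n + 1)) \<le> sphere_const ?n * (1 / (1 + s\<^sup>2))"
        using c by (rule mult_left_mono)
      then show ?thesis using True c by (simp add: ennreal_mult[symmetric] abs_of_nonneg)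
    qed simp
  qed
  also have "\<dots> < \<infinity>"
    using integrable_mult_right[OF integrable_inverse_1_square, of "sphere_const ?n"] c
    by (simp add: integrable_iff_bounded abs_mult add_nonneg_nonneg)
  finally show "(\<integral>\<^sup>+ z. ennreal (norm (1 / (1 + (norm (z :: complex ^ 'n))\<^sup>2) ^ (?n + 1))) \<partial>lborel) < \<infinity>" .
qed measurable

text \<open>Laguerre's equation in Sturm-Liouville form: in the derivative of the Wronskian,
  weighted by s^n, all terms cancel except those with the eigenvalues i and j.\<close>

lemma lagd_wronskian:
  fixes i j :: nat and s :: real
  assumes n: "n \<ge> 1"
  defines "a \<equiv> n - 1"
  defines "W \<equiv> \<lambda>s. s ^ n * (lagd 1 a i s * lagf a j s - lagf a i s * lagd 1 a j s)"
  shows "(W has_real_derivative (real j - real i) * (s ^ (n - 1) * (lagf a i s * lagf a j s))) (at s)"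
proof -
  have an: "a + 1 = n" using n by (simp add: a_def)
  have sn: "s ^ n = s ^ (n - 1) * s" using n power_minus_mult[of n s] by simp
  have d2: "(lagd 1 a j has_real_derivative lagd 2 a j s) (at s)" for j
    using lagd_deriv[of 1 a j s] by (simp add: numeral_2_eq_2)
  have o: "s * lagd 2 a j s = - real n * lagd 1 a j s - (real j + real n / 2 - s / 4) * lagf a j s" for j
    using lagd_ode[of s a j] unfolding an by (simp add: algebra_simps)
  have "(W has_real_derivative (real n * s ^ (n - 1)) * (lagd 1 a i s * lagf a j s - lagf a i s * lagd 1 a j s)
     + s ^ n * (lagd 2 a i s * lagf a j s + lagd 1 a i s * lagd 1 a j s - (lagd 1 a i s * lagd 1 a j s + lagf a i s * lagd 2 a j s))) (at s)"
    unfolding W_def by (rule derivative_eq_intros lagf_deriv d2 refl)+ (simp add: algebra_simps)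
  also have "(real n * s ^ (n - 1)) * (lagd 1 a i s * lagf a j s - lagf a i s * lagd 1 a j s)
     + s ^ n * (lagd 2 a i s * lagf a j s + lagd 1 a i s * lagd 1 a j s - (lagd 1 a i s * lagd 1 a j s + lagf a i s * lagd 2 a j s))
    = s ^ (n - 1) * (real n * (lagd 1 a i s * lagf a j s - lagf a i s * lagd 1 a j s) + (s * lagd 2 a i s) * lagf a j s - lagf a i s * (s * lagd 2 a j s))"
    unfolding sn by (simp add: algebra_simps)
  also have "\<dots> = (real j - real i) * (s ^ (n - 1) * (lagf a i s * lagf a j s))"
    unfolding o by (simp add: algebra_simps)
  finally show ?thesis .
qed

text \<open>The integrand is a multiple of the derivative of the weighted Wronskian at ys. This
  vanishes at 0 because of the factor s^n with n \<ge> 1, and at infinity by the decay of Laguerre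
  functions; the multiple is nonzero for i \<noteq> j.\<close>

lemma lagf_orthogonal:
  assumes n: "n \<ge> 1" and y: "0 < y" and ij: "i \<noteq> j"
  shows "(LINT s|lborel. indicator {0..} s *\<^sub>R (s ^ (n - 1) * (lagf (n - 1) i (y * s) * lagf (n - 1) j (y * s)))) = 0"
proof -
  let ?a = "n - 1"
  let ?h = "\<lambda>s. s ^ (n - 1) * (lagf ?a i (y * s) * lagf ?a j (y * s))"
  define W where "W s = s ^ n * (lagd 1 ?a i s * lagf ?a j s - lagf ?a i s * lagd 1 ?a j s)" for s
  have cf: "continuous_on UNIV ?h"
    by (intro continuous_intros continuous_on_compose2[OF lagf_continuous]) auto
  obtain C where C: "0 \<le> C" "\<And>s. 0 \<le> s \<Longrightarrow> \<bar>lagf ?a i s\<bar> * (1 + s) ^ (n + 1) \<le> C"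
    using lagf_decay by blast
  obtain D where D: "0 \<le> D" "\<And>s. 0 \<le> s \<Longrightarrow> \<bar>lagd 1 ?a i s\<bar> * (1 + s) ^ (n + 1) \<le> D"
    using lagd_decay by blast
  obtain E where E: "0 \<le> E" "\<And>s. 0 \<le> s \<Longrightarrow> \<bar>lagf ?a j s\<bar> \<le> E" using lagf_decay[of ?a j 0] by auto
  obtain G where G: "0 \<le> G" "\<And>s. 0 \<le> s \<Longrightarrow> \<bar>lagd 1 ?a j s\<bar> \<le> G" using lagd_decay[of 1 ?a j 0] by auto
  define K where "K = D * E + C * G"
  have Wb: "\<bar>W s\<bar> \<le> K / (1 + s)" if s: "0 \<le> s" for s
  proof -
    have "\<bar>W s\<bar> * (1 + s) = (s ^ n * (1 + s)) * \<bar>lagd 1 ?a i s * lagf ?a j s - lagf ?a i s * lagd 1 ?a j s\<bar>"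
      using s by (simp add: W_def abs_mult)
    also have "\<dots> \<le> (1 + s) ^ (n + 1) * (\<bar>lagd 1 ?a i s\<bar> * E + \<bar>lagf ?a i s\<bar> * G)"
    proof (rule mult_mono)
      show "s ^ n * (1 + s) \<le> (1 + s) ^ (n + 1)"
        using s mult_right_mono[OF power_mono[of s "1 + s" n], of "1 + s"] by (simp add: mult.commute)
      show "\<bar>lagd 1 ?a i s * lagf ?a j s - lagf ?a i s * lagd 1 ?a j s\<bar> \<le> \<bar>lagd 1 ?a i s\<bar> * E + \<bar>lagf ?a i s\<bar> * G"
        using E(2)[OF s] G(2)[OF s] by (intro order_trans[OF abs_triangle_ineq4]) (auto simp: abs_mult intro!: add_mono mult_left_mono)
    qed (use s in auto)
    also have "\<dots> = (\<bar>lagd 1 ?a i s\<bar> * (1 + s) ^ (n + 1)) * E + (\<bar>lagf ?a i s\<bar> * (1 + s) ^ (n + 1)) * G"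
      by (simp add: algebra_simps)
    also have "\<dots> \<le> K" unfolding K_def using C D E G s by (intro add_mono mult_right_mono) auto
    finally show ?thesis using s by (simp add: pos_le_divide_eq)
  qed
  have dW: "(W has_real_derivative (real j - real i) * (s ^ (n - 1) * (lagf ?a i s * lagf ?a j s))) (at s)" for s
    unfolding W_def[abs_def] by (rule lagd_wronskian[OF n])
  define H where "H s = W (y * s)" for s
  have dH: "(H has_real_derivative y ^ n * (real j - real i) * ?h s) (at s)" for s
  proof -
    have "((\<lambda>s. W (y * s)) has_real_derivative (real j - real i) * ((y * s) ^ (n - 1) * (lagf ?a i (y * s) * lagf ?a j (y * s))) * y) (at s)"
      by (rule DERIV_chain2[OF dW]) (auto intro!: derivative_eq_intros)
    also have "(real j - real i) * ((y * s) ^ (n - 1) * (lagf ?a i (y * s) * lagf ?a j (y * s))) * y = y ^ n * (real j - real i) * ?h s"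
      using n power_minus_mult[of n y] by (simp add: power_mult_distrib mult_ac)
    finally show ?thesis unfolding H_def[abs_def] .
  qed
  have int: "integrable lborel (\<lambda>s. indicator {0..} s *\<^sub>R ?h s)"
  proof (rule Bochner_Integration.integrable_bound[OF integrable_mult_right[OF integrable_inverse_1_square, of "C * E * (1 / min 1 y) ^ (n + 1)"]])
    show "(\<lambda>s. indicator {0..} s *\<^sub>R ?h s) \<in> borel_measurable lborel"
      using borel_measurable_continuous_onI[OF cf] by measurable
    have m: "0 < min 1 y" using y by simp
    show "AE s in lborel. norm (indicator {0..} s *\<^sub>R ?h s) \<le> norm (C * E * (1 / min 1 y) ^ (n + 1) * (1 / (1 + s\<^sup>2)))"
    proof (rule AE_I2)
      fix s :: real
      show "norm (indicator {0..} s *\<^sub>R ?h s) \<le> norm (C * E * (1 / min 1 y) ^ (n + 1) * (1 / (1 + s\<^sup>2)))"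
      proof (cases "0 \<le> s")
        case True
        have ys: "0 \<le> y * s" using True y by simp
        have "min 1 y * (1 + s) \<le> 1 + y * s"
          using True mult_right_mono[of "min 1 y" y s] by (simp add: distrib_left add_mono)
        then have "1 + s \<le> (1 / min 1 y) * (1 + y * s)" using m by (simp add: field_simps)
        then have "(1 + s) ^ (n + 1) \<le> ((1 / min 1 y) * (1 + y * s)) ^ (n + 1)" using True by (intro power_mono) auto
        then have 1: "(1 + s) ^ (n + 1) \<le> (1 / min 1 y) ^ (n + 1) * (1 + y * s) ^ (n + 1)" by (simp only: power_mult_distrib)
        have "s ^ (n - 1) * (1 + s\<^sup>2) \<le> (1 + s) ^ (n - 1) * (1 + s)\<^sup>2"
          using True by (intro mult_mono power_mono) (auto simp: power2_sum)
        also have "\<dots> = (1 + s) ^ (n + 1)" unfolding power_add[symmetric] using n by simp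
        also note 1
        finally have 2: "s ^ (n - 1) * (1 + s\<^sup>2) \<le> (1 / min 1 y) ^ (n + 1) * (1 + y * s) ^ (n + 1)" .
        have "\<bar>?h s\<bar> * (1 + s\<^sup>2) = (s ^ (n - 1) * (1 + s\<^sup>2)) * (\<bar>lagf ?a i (y * s)\<bar> * \<bar>lagf ?a j (y * s)\<bar>)"
          using True by (simp add: abs_mult)
        also have "\<dots> \<le> ((1 / min 1 y) ^ (n + 1) * (1 + y * s) ^ (n + 1)) * (\<bar>lagf ?a i (y * s)\<bar> * E)"
          using True ys m by (intro mult_mono 2 E) auto
        also have "\<dots> = (\<bar>lagf ?a i (y * s)\<bar> * (1 + y * s) ^ (n + 1)) * (E * (1 / min 1 y) ^ (n + 1))" by (simp only: mult_ac)
        also have "\<dots> \<le> C * (E * (1 / min 1 y) ^ (n + 1))"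
          using C(2)[OF ys] E m by (intro mult_right_mono) auto
        finally have "\<bar>?h s\<bar> \<le> C * E * (1 / min 1 y) ^ (n + 1) * (1 / (1 + s\<^sup>2))"
          using pos_le_divide_eq[OF add_pos_nonneg[of 1 "s\<^sup>2"]] by (simp only: times_divide_eq_right mult_1_right mult.assoc zero_less_one zero_le_power2)
        then show ?thesis using True by (simp only: indicator_simps atLeast_iff scaleR_one real_norm_def) linarith
      qed simp
    qed
  qed
  let ?q = "y ^ n * (real j - real i)"
  have q: "?q \<noteq> 0" using y ij by simp
  let ?f = "\<lambda>s. indicator {0..} s *\<^sub>R ?h s"
  have "((\<lambda>T. LINT s|lborel. indicator {..T} s *\<^sub>R (?q * ?f s)) \<longlongrightarrow> (LINT s|lborel. ?q * ?f s)) at_top"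
    by (rule tendsto_integral_at_top) (use int in auto)
  moreover have "((\<lambda>T. LINT s|lborel. indicator {..T} s *\<^sub>R (?q * ?f s)) \<longlongrightarrow> 0) at_top"
  proof -
    have "LINT s|lborel. indicator {..T} s *\<^sub>R (?q * ?f s) = H T" if T: "0 \<le> T" for T
    proof -
      have "(LINT s|lborel. indicator {..T} s *\<^sub>R (?q * ?f s)) = (LINT s|lborel. indicator {0..T} s *\<^sub>R (?q * ?h s))"
        by (intro Bochner_Integration.integral_cong) (auto simp: indicator_def)
      also have "\<dots> = H T - H 0"
      proof (rule integral_FTC_atLeastAtMost[OF T])
        show "(H has_vector_derivative ?q * ?h s) (at s within {0..T})" for s
          using dH[of s] by (simp only: has_real_derivative_iff_has_vector_derivative has_vector_derivative_at_within)
        show "continuous_on {0..T} (\<lambda>s. ?q * ?h s)"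
          by (intro continuous_on_mult continuous_on_const continuous_on_subset[OF cf]) auto
      qed
      also have "H 0 = 0" using n by (simp add: H_def W_def)
      finally show ?thesis by simp
    qed
    then have ev: "\<forall>\<^sub>F T in at_top. (LINT s|lborel. indicator {..T} s *\<^sub>R (?q * ?f s)) = H T"
      by (rule eventually_mono[OF eventually_ge_at_top[of "0::real"]])
    have "(H \<longlongrightarrow> 0) at_top"
    proof (rule Lim_null_comparison)
      show "\<forall>\<^sub>F T in at_top. norm (H T) \<le> K / (1 + y * T)"
        using eventually_ge_at_top[of "0::real"] by eventually_elim (use Wb y in \<open>simp add: H_def\<close>)
      show "((\<lambda>T. K / (1 + y * T)) \<longlongrightarrow> 0) at_top"
        by (intro tendsto_divide_0[OF tendsto_const] filterlim_at_top_imp_at_infinity filterlim_tendsto_add_at_top[OF tendsto_const]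
            filterlim_tendsto_pos_mult_at_top[OF tendsto_const y] filterlim_ident)
    qed
    then show ?thesis by (subst tendsto_cong[OF ev])
  qed
  ultimately have "(LINT s|lborel. ?q * ?f s) = 0" by (rule tendsto_unique[OF trivial_limit_at_top_linorder])
  then show ?thesis using q unfolding integral_mult_right_zero by (simp only: mult_eq_0_iff simp_thms)
qed

section \<open>Fourier inversion and duality\<close>

definition ftrans :: "real \<Rightarrow> real \<Rightarrow> (real \<Rightarrow> complex) \<Rightarrow> real \<Rightarrow> complex" where
  "ftrans \<alpha> \<beta> w t = (LINT x|lborel. indicator {\<alpha>..\<beta>} x *\<^sub>R (w x * exp (\<i> * of_real (- (t * x)))))"

lemma integrable_Icc:
  "continuous_on UNIV f \<Longrightarrow> integrable lborel (\<lambda>x. indicator {\<alpha>..\<beta>} x *\<^sub>R f x)" for f :: "real \<Rightarrow> 'a :: {banach, second_countable_topology}"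
  using borel_integrable_atLeastAtMost'[of \<alpha> \<beta> f] continuous_on_subset[of UNIV f "{\<alpha>..\<beta>}"]
  by (simp add: set_integrable_def)

text \<open>Two integrations by parts at once: \<open>?G\<close> vanishes at both ends and has
  derivative (w2 + t^2 w) exp(-itx). Hence (1 + t^2) times the transform of w is the transform of w
  - w2.\<close>

lemma ftrans_decay:
  assumes \<alpha>\<beta>: "\<alpha> \<le> \<beta>"
    and d: "\<And>x. (w has_vector_derivative w1 x) (at x)" and d1: "\<And>x. (w1 has_vector_derivative w2 x) (at x)"
    and c2: "continuous_on UNIV w2"
    and z: "w \<alpha> = 0" "w \<beta> = 0" "w1 \<alpha> = 0" "w1 \<beta> = 0"
  shows "(1 + t\<^sup>2) * cmod (ftrans \<alpha> \<beta> w t) \<le> (LINT x|lborel. indicator {\<alpha>..\<beta>} x *\<^sub>R (cmod (w x) + cmod (w2 x)))"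
proof -
  let ?e = "\<lambda>x. exp (\<i> * of_real (- (t * x)))"
  have cw: "continuous_on UNIV w"
    using d by (auto intro!: continuous_at_imp_continuous_on dest: has_vector_derivative_continuous)
  have ce: "continuous_on UNIV ?e" by (intro continuous_intros)
  have de: "(?e has_vector_derivative - (\<i> * of_real t) * ?e x) (at x)" for x
    unfolding of_real_mult of_real_minus
    by (rule field_vector_diff_chain_at[where f = "\<lambda>x. \<i> * - (of_real t * of_real x)" and g = exp, unfolded comp_def, THEN has_vector_derivative_eq_rhs] derivative_eq_intros refl | simp)+
  let ?G = "\<lambda>x. (w1 x + \<i> * of_real t * w x) * ?e x"
  have dG: "(?G has_vector_derivative (w2 x + of_real (t\<^sup>2) * w x) * ?e x) (at x)" for x
    by (rule has_vector_derivative_eq_rhs[OF has_vector_derivative_mult[OF has_vector_derivative_add[OF d1 has_vector_derivative_mult_right[OF d]] de]])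
       (simp add: algebra_simps power2_eq_square)
  have cG: "continuous_on UNIV (\<lambda>x. (w2 x + of_real (t\<^sup>2) * w x) * ?e x)"
    by (intro continuous_intros c2 cw ce)
  have "(LINT x|lborel. indicator {\<alpha>..\<beta>} x *\<^sub>R ((w2 x + of_real (t\<^sup>2) * w x) * ?e x)) = ?G \<beta> - ?G \<alpha>"
    by (rule integral_FTC_atLeastAtMost[OF \<alpha>\<beta> has_vector_derivative_at_within[OF dG] continuous_on_subset[OF cG subset_UNIV]])
  then have 0: "(LINT x|lborel. indicator {\<alpha>..\<beta>} x *\<^sub>R ((w2 x + of_real (t\<^sup>2) * w x) * ?e x)) = 0" using z by simp
  have "of_real (1 + t\<^sup>2) * ftrans \<alpha> \<beta> w t = (LINT x|lborel. of_real (1 + t\<^sup>2) * (indicator {\<alpha>..\<beta>} x *\<^sub>R (w x * ?e x)))"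
    unfolding ftrans_def by (rule integral_mult_right_zero[symmetric])
  also have "\<dots> = (LINT x|lborel. of_real (1 + t\<^sup>2) * (indicator {\<alpha>..\<beta>} x *\<^sub>R (w x * ?e x))) -
     (LINT x|lborel. indicator {\<alpha>..\<beta>} x *\<^sub>R ((w2 x + of_real (t\<^sup>2) * w x) * ?e x))"
    using 0 by simp
  also have "\<dots> = (LINT x|lborel. of_real (1 + t\<^sup>2) * (indicator {\<alpha>..\<beta>} x *\<^sub>R (w x * ?e x)) -
     indicator {\<alpha>..\<beta>} x *\<^sub>R ((w2 x + of_real (t\<^sup>2) * w x) * ?e x))"
    by (rule Bochner_Integration.integral_diff[symmetric])
       (intro integrable_mult_right integrable_Icc continuous_intros c2 cw ce)+
  also have "\<dots> = (LINT x|lborel. indicator {\<alpha>..\<beta>} x *\<^sub>R ((w x - w2 x) * ?e x))"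
    by (intro Bochner_Integration.integral_cong) (auto simp: indicator_def algebra_simps)
  finally have eq: "of_real (1 + t\<^sup>2) * ftrans \<alpha> \<beta> w t = (LINT x|lborel. indicator {\<alpha>..\<beta>} x *\<^sub>R ((w x - w2 x) * ?e x))" .
  have "(1 + t\<^sup>2) * cmod (ftrans \<alpha> \<beta> w t) = cmod (of_real (1 + t\<^sup>2) * ftrans \<alpha> \<beta> w t)"
    by (simp only: norm_mult norm_of_real) (simp add: add_nonneg_nonneg)
  also have "\<dots> \<le> (LINT x|lborel. norm (indicator {\<alpha>..\<beta>} x *\<^sub>R ((w x - w2 x) * ?e x)))"
    unfolding eq by (rule integral_norm_bound)
  also have "\<dots> \<le> (LINT x|lborel. indicator {\<alpha>..\<beta>} x *\<^sub>R (cmod (w x) + cmod (w2 x)))"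
  proof (rule integral_mono)
    show "integrable lborel (\<lambda>x. norm (indicator {\<alpha>..\<beta>} x *\<^sub>R ((w x - w2 x) * ?e x)))"
      by (intro integrable_norm integrable_Icc continuous_intros c2 cw ce)
    show "integrable lborel (\<lambda>x. indicator {\<alpha>..\<beta>} x *\<^sub>R (cmod (w x) + cmod (w2 x)))"
      by (intro integrable_Icc continuous_intros c2 cw)
    show "norm (indicator {\<alpha>..\<beta>} x *\<^sub>R ((w x - w2 x) * ?e x)) \<le> indicator {\<alpha>..\<beta>} x *\<^sub>R (cmod (w x) + cmod (w2 x))" for x
      using norm_triangle_ineq4[of "w x" "w2 x"] norm_exp_i_times[of "- (t * x)"]
      by (auto simp: indicator_def norm_mult simp del: of_real_minus of_real_mult norm_exp_i_times)
  qed
  finally show ?thesis .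
qed

lemma gaussian_integral:
  assumes \<epsilon>: "0 < \<epsilon>"
  shows "(LINT t|lborel. exp (\<i> * of_real (u * t)) * of_real (std_normal_density (\<epsilon> * t)))
    = of_real (exp (- (u / \<epsilon>)\<^sup>2 / 2) / \<epsilon>)"
proof -
  have "(LINT x|lborel. std_normal_density x *\<^sub>R exp (\<i> * of_real (u / \<epsilon> * x))) = char std_normal_distribution (u / \<epsilon>)"
    unfolding char_def by (subst integral_density) auto
  also have "\<dots> = of_real (exp (- (u / \<epsilon>)\<^sup>2 / 2))" unfolding char_std_normal_distribution ..
  also have "(LINT x|lborel. std_normal_density x *\<^sub>R exp (\<i> * of_real (u / \<epsilon> * x)))
    = \<bar>\<epsilon>\<bar> *\<^sub>R (LINT t|lborel. std_normal_density (0 + \<epsilon> * t) *\<^sub>R exp (\<i> * of_real (u / \<epsilon> * (0 + \<epsilon> * t))))"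
    using \<epsilon> by (intro lborel_integral_real_affine) simp
  also have "\<dots> = of_real \<epsilon> * (LINT t|lborel. exp (\<i> * of_real (u * t)) * of_real (std_normal_density (\<epsilon> * t)))"
    using \<epsilon> by (simp add: scaleR_conv_of_real mult.commute)
  finally show ?thesis using \<epsilon> by (simp add: field_simps)
qed

text \<open>Gaussian summation. Damped by the normal density at et, the double integral may be
  interchanged and becomes, up to a constant, the Gaussian mean of w(y + es). Both sides converge as
  e tends to 0, one by integrability of the transform, the other by continuity and boundedness of
  w.\<close>

lemma fourier_inversion:
  assumes cw: "continuous_on UNIV w" and supp: "\<And>x. x \<notin> {\<alpha>..\<beta>} \<Longrightarrow> w x = 0"
    and int: "integrable lborel (ftrans \<alpha> \<beta> w)"
  shows "(LINT t|lborel. exp (\<i> * of_real (y * t)) * ftrans \<alpha> \<beta> w t) = of_real (2 * pi) * w y"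
proof -
  let ?\<phi> = "std_normal_density"
  define e where "e m = 1 / real (Suc m)" for m
  have e: "0 < e m" for m by (simp add: e_def)
  have e0: "e \<longlonglongrightarrow> 0" unfolding e_def[abs_def] by (rule LIMSEQ_Suc[OF lim_1_over_n])
  have c\<phi>: "continuous_on UNIV ?\<phi>" unfolding std_normal_density_def[abs_def] by (intro continuous_intros) auto
  let ?E = "\<lambda>t. exp (\<i> * of_real (y * t))"
  have E: "continuous_on UNIV ?E" by (intro continuous_intros)
  have nE: "cmod (?E t) = 1" for t by (rule norm_exp_i_times)
  have [measurable]: "w \<in> borel_measurable borel" "?E \<in> borel_measurable borel"
    by (intro borel_measurable_continuous_onI cw E)+
  have "\<exists>M. \<forall>x. cmod (w x) \<le> M"
  proof -
    have "bounded (w ` {\<alpha>..\<beta>})"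
      by (intro compact_imp_bounded compact_continuous_image continuous_on_subset[OF cw]) auto
    then obtain M where M: "\<And>x. x \<in> {\<alpha>..\<beta>} \<Longrightarrow> cmod (w x) \<le> M" unfolding bounded_iff by blast
    have "cmod (w x) \<le> max M 0" for x using M[of x] supp[of x] by (cases "x \<in> {\<alpha>..\<beta>}") auto
    then show ?thesis by blast
  qed
  then obtain M where M: "\<And>x. cmod (w x) \<le> M" by blast
  have \<phi>0: "?\<phi> 0 = 1 / sqrt (2 * pi)" by (simp add: std_normal_density_def)
  have \<phi>le: "?\<phi> x \<le> ?\<phi> 0" for x by (simp add: std_normal_density_def divide_right_mono)
  have \<phi>pos: "0 \<le> ?\<phi> x" for x by simp
  have main: "(LINT t|lborel. ?E t * ftrans \<alpha> \<beta> w t * of_real (?\<phi> (e m * t))) =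
    of_real (sqrt (2 * pi)) * (LINT s|lborel. of_real (?\<phi> s) * w (y + e m * s))" for m
  proof -
    let ?F = "\<lambda>t x. indicator {\<alpha>..\<beta>} x *\<^sub>R (w x * (exp (\<i> * of_real ((y - x) * t)) * of_real (?\<phi> (e m * t))))"
    have i\<phi>: "integrable lborel (\<lambda>t. ?\<phi> (e m * t))"
      using lborel_integrable_real_affine[of ?\<phi> "e m" 0] e[of m] by simp
    have F: "integrable (lborel \<Otimes>\<^sub>M lborel) (case_prod ?F)"
    proof (rule lborel_pair.Fubini_integrable)
      have "(\<lambda>p::real \<times> real. indicator {\<alpha>..\<beta>} (snd p) *\<^sub>R (w (snd p) * (exp (\<i> * of_real ((y - snd p) * fst p)) * of_real (?\<phi> (e m * fst p))))) \<in> borel_measurable (lborel \<Otimes>\<^sub>M lborel)"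
        by measurable
      then show "case_prod ?F \<in> borel_measurable (lborel \<Otimes>\<^sub>M lborel)" by (simp add: case_prod_beta)
      have n: "norm (?F t x) = ?\<phi> (e m * t) * norm (indicator {\<alpha>..\<beta>} x *\<^sub>R w x)" for t x
        using norm_exp_i_times[of "(y - x) * t"] by (simp add: norm_mult del: norm_exp_i_times)
      show "integrable lborel (\<lambda>t. LINT x|lborel. norm (case_prod ?F (t, x)))"
        unfolding case_prod_conv n using i\<phi> by simp
      show "AE t in lborel. integrable lborel (\<lambda>x. case_prod ?F (t, x))"
      proof (rule AE_I2)
        fix t
        have "integrable lborel (\<lambda>x. indicator {\<alpha>..\<beta>} x *\<^sub>R (w x * (exp (\<i> * of_real ((y - x) * t)) * of_real (?\<phi> (e m * t)))))"
          by (intro integrable_Icc continuous_intros cw)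
        then show "integrable lborel (\<lambda>x. case_prod ?F (t, x))" by simp
      qed
    qed
    have "(LINT t|lborel. ?E t * ftrans \<alpha> \<beta> w t * of_real (?\<phi> (e m * t))) = (LINT t|lborel. LINT x|lborel. ?F t x)"
    proof (rule Bochner_Integration.integral_cong[OF refl])
      fix t
      have "?E t * ftrans \<alpha> \<beta> w t * of_real (?\<phi> (e m * t)) =
         (LINT x|lborel. (?E t * of_real (?\<phi> (e m * t))) * (indicator {\<alpha>..\<beta>} x *\<^sub>R (w x * exp (\<i> * of_real (- (t * x))))))"
        unfolding ftrans_def integral_mult_right_zero by (simp only: mult_ac)
      also have "\<dots> = (LINT x|lborel. ?F t x)"
      proof (rule Bochner_Integration.integral_cong[OF refl])
        fix x
        have "exp (\<i> * of_real ((y - x) * t)) = ?E t * exp (\<i> * of_real (- (t * x)))"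
          unfolding exp_add[symmetric] by (simp add: algebra_simps)
        then show "(?E t * of_real (?\<phi> (e m * t))) * (indicator {\<alpha>..\<beta>} x *\<^sub>R (w x * exp (\<i> * of_real (- (t * x))))) = ?F t x"
          by (simp only: mult_scaleR_right mult_ac)
      qed
      finally show "?E t * ftrans \<alpha> \<beta> w t * of_real (?\<phi> (e m * t)) = (LINT x|lborel. ?F t x)" .
    qed
    also have "\<dots> = (LINT x|lborel. LINT t|lborel. ?F t x)"
      using lborel_pair.Fubini_integral[OF F] by simp
    also have "\<dots> = (LINT x|lborel. w x * of_real (exp (- ((y - x) / e m)\<^sup>2 / 2) / e m))"
    proof (rule Bochner_Integration.integral_cong[OF refl])
      fix x
      have "(LINT t|lborel. ?F t x) = indicator {\<alpha>..\<beta>} x *\<^sub>R (w x * of_real (exp (- ((y - x) / e m)\<^sup>2 / 2) / e m))"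
        by (simp only: gaussian_integral[OF e] integral_scaleR_right integral_mult_right_zero)
      then show "(LINT t|lborel. ?F t x) = w x * of_real (exp (- ((y - x) / e m)\<^sup>2 / 2) / e m)"
        using supp[of x] by (cases "x \<in> {\<alpha>..\<beta>}") simp_all
    qed
    also have "\<dots> = \<bar>e m\<bar> *\<^sub>R (LINT s|lborel. w (y + e m * s) * of_real (exp (- ((y - (y + e m * s)) / e m)\<^sup>2 / 2) / e m))"
      using e[of m] by (intro lborel_integral_real_affine) simp
    also have "\<dots> = (LINT s|lborel. \<bar>e m\<bar> *\<^sub>R (w (y + e m * s) * of_real (exp (- ((y - (y + e m * s)) / e m)\<^sup>2 / 2) / e m)))"
      by simp
    also have "\<dots> = (LINT s|lborel. of_real (sqrt (2 * pi)) * (of_real (?\<phi> s) * w (y + e m * s)))"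
    proof (rule Bochner_Integration.integral_cong[OF refl])
      fix s
      have "(y - (y + e m * s)) / e m = - s" using e[of m] by simp
      then have "\<bar>e m\<bar> * (exp (- ((y - (y + e m * s)) / e m)\<^sup>2 / 2) / e m) = sqrt (2 * pi) * ?\<phi> s"
        using e[of m] by (simp add: std_normal_density_def)
      then have "\<bar>e m\<bar> *\<^sub>R (of_real (exp (- ((y - (y + e m * s)) / e m)\<^sup>2 / 2) / e m) * w (y + e m * s)) =
        of_real (sqrt (2 * pi) * ?\<phi> s) * w (y + e m * s)"
        unfolding scaleR_conv_of_real mult.assoc[symmetric] of_real_mult[symmetric] by (simp only:)
      then show "\<bar>e m\<bar> *\<^sub>R (w (y + e m * s) * of_real (exp (- ((y - (y + e m * s)) / e m)\<^sup>2 / 2) / e m)) =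
        of_real (sqrt (2 * pi)) * (of_real (?\<phi> s) * w (y + e m * s))"
        by (simp only: of_real_mult mult_ac)
    qed
    finally show ?thesis by simp
  qed
  have "(\<lambda>m. LINT t|lborel. ?E t * ftrans \<alpha> \<beta> w t * of_real (?\<phi> (e m * t))) \<longlonglongrightarrow>
     (LINT t|lborel. ?E t * ftrans \<alpha> \<beta> w t * of_real (?\<phi> 0))"
  proof (rule integral_dominated_convergence[where w = "\<lambda>t. cmod (ftrans \<alpha> \<beta> w t) * ?\<phi> 0"])
    have [measurable]: "ftrans \<alpha> \<beta> w \<in> borel_measurable borel" using int by auto
    show "(\<lambda>t. ?E t * ftrans \<alpha> \<beta> w t * of_real (?\<phi> 0)) \<in> borel_measurable lborel"
      "(\<lambda>t. ?E t * ftrans \<alpha> \<beta> w t * of_real (?\<phi> (e m * t))) \<in> borel_measurable lborel" for m by measurable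
    show "integrable lborel (\<lambda>t. cmod (ftrans \<alpha> \<beta> w t) * ?\<phi> 0)" using int by simp
    show "AE t in lborel. (\<lambda>m. ?E t * ftrans \<alpha> \<beta> w t * of_real (?\<phi> (e m * t))) \<longlonglongrightarrow> ?E t * ftrans \<alpha> \<beta> w t * of_real (?\<phi> 0)"
    proof (rule AE_I2)
      fix t
      have "(\<lambda>m. e m * t) \<longlonglongrightarrow> 0" using tendsto_mult_left_zero[OF e0] by simp
      moreover have "isCont ?\<phi> 0" using c\<phi> by (simp add: continuous_on_eq_continuous_at)
      ultimately have "(\<lambda>m. ?\<phi> (e m * t)) \<longlonglongrightarrow> ?\<phi> 0" by (rule isCont_tendsto_compose[rotated])
      then show "(\<lambda>m. ?E t * ftrans \<alpha> \<beta> w t * of_real (?\<phi> (e m * t))) \<longlonglongrightarrow> ?E t * ftrans \<alpha> \<beta> w t * of_real (?\<phi> 0)"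
        by (intro tendsto_intros)
    qed
    show "AE t in lborel. norm (?E t * ftrans \<alpha> \<beta> w t * of_real (?\<phi> (e m * t))) \<le> cmod (ftrans \<alpha> \<beta> w t) * ?\<phi> 0" for m
      using \<phi>le by (intro AE_I2) (simp only: norm_mult nE mult_1 norm_of_real abs_of_nonneg[OF \<phi>pos] mult_left_mono norm_ge_zero)
  qed
  moreover have "(\<lambda>m. of_real (sqrt (2 * pi)) * (LINT s|lborel. of_real (?\<phi> s) * w (y + e m * s))) \<longlonglongrightarrow>
     of_real (sqrt (2 * pi)) * (LINT s|lborel. of_real (?\<phi> s) * w y)"
  proof (intro tendsto_intros integral_dominated_convergence[where w = "\<lambda>s. ?\<phi> s * M"])
    show "AE s in lborel. (\<lambda>m. complex_of_real (?\<phi> s) * w (y + e m * s)) \<longlonglongrightarrow> of_real (?\<phi> s) * w y"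
    proof (rule AE_I2)
      fix s
      have "(\<lambda>m. y + e m * s) \<longlonglongrightarrow> y + 0" by (intro tendsto_intros tendsto_mult_left_zero[OF e0])
      then have 1: "(\<lambda>m. y + e m * s) \<longlonglongrightarrow> y" by simp
      have "isCont w y" using cw by (simp add: continuous_on_eq_continuous_at)
      from isCont_tendsto_compose[OF this 1]
      show "(\<lambda>m. complex_of_real (?\<phi> s) * w (y + e m * s)) \<longlonglongrightarrow> of_real (?\<phi> s) * w y" by (intro tendsto_intros)
    qed
    show "AE s in lborel. norm (complex_of_real (?\<phi> s) * w (y + e m * s)) \<le> ?\<phi> s * M" for m
      using M by (intro AE_I2) (simp only: norm_mult norm_of_real abs_of_nonneg[OF \<phi>pos] mult_left_mono \<phi>pos)
    show "integrable lborel (\<lambda>s. ?\<phi> s * M)" by simp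
  qed measurable
  moreover have "(LINT s|lborel. of_real (?\<phi> s) * w y) = w y"
  proof -
    have "(LINT s|lborel. complex_of_real (?\<phi> s)) = of_real (LINT s|lborel. ?\<phi> s)"
      by (rule integral_of_real) (rule integrable_normal_density, simp)
    then show ?thesis by simp
  qed
  ultimately have "(LINT t|lborel. ?E t * ftrans \<alpha> \<beta> w t * of_real (?\<phi> 0)) = of_real (sqrt (2 * pi)) * w y"
    unfolding main by (simp only: LIMSEQ_unique)
  then have "(LINT t|lborel. ?E t * ftrans \<alpha> \<beta> w t) * of_real (?\<phi> 0) = of_real (sqrt (2 * pi)) * w y" by simp
  moreover have "sqrt (2 * pi) * ?\<phi> 0 = 1" unfolding \<phi>0 by simp
  then have "of_real (?\<phi> 0) * complex_of_real (sqrt (2 * pi)) = 1"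
    by (metis mult.commute of_real_1 of_real_mult)
  ultimately have "(LINT t|lborel. ?E t * ftrans \<alpha> \<beta> w t) = of_real (sqrt (2 * pi)) * w y * of_real (sqrt (2 * pi))"
    by (metis mult.assoc mult_1_right)
  also have "\<dots> = of_real (sqrt (2 * pi) * sqrt (2 * pi)) * w y" by (simp only: of_real_mult mult_ac)
  finally show ?thesis by simp
qed

lemma integral_pos_on_open:
  fixes f :: "'a::euclidean_space \<Rightarrow> real"
  assumes f: "integrable lborel f" and nn: "\<And>x. 0 \<le> f x" and S: "open S" "S \<noteq> {}" and pos: "\<And>x. x \<in> S \<Longrightarrow> 0 < f x"
  shows "0 < integral\<^sup>L lborel f"
proof (rule ccontr)
  assume "\<not> 0 < integral\<^sup>L lborel f"
  moreover have "0 \<le> integral\<^sup>L lborel f" using nn by simp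
  ultimately have "AE x in lborel. f x = 0"
    using integral_nonneg_eq_0_iff_AE[OF f] nn by simp
  then have "AE x in lborel. x \<notin> S" by eventually_elim (use pos in force)
  then have "S \<in> null_sets lborel"
    using S by (simp add: AE_iff_null_sets)
  then have "negligible S" by (simp add: negligible_iff_null_sets null_sets_completionI)
  then show False using open_not_negligible[OF S] by blast
qed

text \<open>A substitute for Hoelder's inequality in which one constant serves all p. The integral
  is split at the level b, the norm of u: where |u| \<le> b the integrand is at most b|k|, elsewhere
  |u| is at most b^(1-r)|u|^r and |k| is at most K. The two parts contribute bI and bK. The summand
  1 keeps the constant positive, so that the bound also holds when the norm is infinite.\<close>

lemma Lp_norm_pairing:
  fixes u k :: "'n::finite heis \<Rightarrow> complex"
  assumes u [measurable]: "u \<in> borel_measurable lborel" and k [measurable]: "k \<in> borel_measurable lborel"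
    and K: "\<And>x. cmod (k x) \<le> K" and I: "(\<integral>\<^sup>+ x. ennreal (cmod (k x)) \<partial>lborel) \<le> ennreal I" "0 \<le> I" and p: "1 \<le> p"
  shows "(\<integral>\<^sup>+ x. ennreal (cmod (u x) * cmod (k x)) \<partial>lborel) \<le> Lp_norm p u * ennreal (I + K + 1)"
proof -
  have K0: "0 \<le> K" using order_trans[OF norm_ge_zero K] .
  show ?thesis
  proof (cases "p = \<infinity>")
    case True
    let ?M = "Lp_norm p u"
    have "AE x in lborel. ennreal (cmod (u x)) \<le> ?M"
      using esssup_AE[of "\<lambda>x. ennreal (cmod (u x))" lborel] True by (simp add: Lp_norm_def)
    then have "AE x in lborel. ennreal (cmod (u x) * cmod (k x)) \<le> ?M * ennreal (cmod (k x))"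
      by eventually_elim (simp add: ennreal_mult mult_right_mono)
    then have "(\<integral>\<^sup>+ x. ennreal (cmod (u x) * cmod (k x)) \<partial>lborel) \<le> (\<integral>\<^sup>+ x. ?M * ennreal (cmod (k x)) \<partial>lborel)"
      by (rule nn_integral_mono_AE)
    also have "\<dots> = ?M * (\<integral>\<^sup>+ x. ennreal (cmod (k x)) \<partial>lborel)" by (rule nn_integral_cmult) measurable
    also have "\<dots> \<le> ?M * ennreal (I + K + 1)"
      using I K0 by (intro mult_left_mono order_trans[OF I(1)] ennreal_leI) auto
    finally show ?thesis .
  next
    case False
    define r where "r = enn2real p"
    have r: "1 \<le> r"
      using p False unfolding r_def by (metis enn2real_1 enn2real_mono ennreal_less_top infinity_ennreal_def top.not_eq_extremum)
    define T where "T = (\<integral>\<^sup>+ x. ennreal (cmod (u x) powr r) \<partial>lborel)"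
    have L: "Lp_norm p u = ennpowr T (1 / r)" using False by (simp add: Lp_norm_def T_def r_def)
    show ?thesis
    proof (cases "T = \<infinity>")
      case True
      then show ?thesis unfolding L ennpowr_def using I K0 by (simp add: ennreal_top_mult ennreal_eq_0_iff)
    next
      case fin: False
      define \<tau> where "\<tau> = enn2real T"
      have T: "T = ennreal \<tau>" "0 \<le> \<tau>" using fin by (auto simp: \<tau>_def less_top)
      have L': "Lp_norm p u = ennreal (\<tau> powr (1 / r))" unfolding L ennpowr_def using fin by (simp add: \<tau>_def)
      show ?thesis
      proof (cases "\<tau> = 0")
        case True
        then have "T = 0" using T by simp
        then have "AE x in lborel. ennreal (cmod (u x) powr r) = 0"
          unfolding T_def by (subst (asm) nn_integral_0_iff_AE) auto
        then have "AE x in lborel. ennreal (cmod (u x) * cmod (k x)) = 0" by eventually_elim auto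
        then have "(\<integral>\<^sup>+ x. ennreal (cmod (u x) * cmod (k x)) \<partial>lborel) = 0" by (subst nn_integral_0_iff_AE) auto
        then show ?thesis by simp
      next
        case False
        define b where "b = \<tau> powr (1 / r)"
        have b: "0 < b" using False T by (simp add: b_def)
        have bt: "\<tau> * b powr (1 - r) = b"
        proof -
          have "\<tau> = b powr r" using r T False by (simp add: b_def powr_powr)
          then show ?thesis using b by (simp add: powr_add[symmetric])
        qed
        have pt: "cmod (u x) * cmod (k x) \<le> b * cmod (k x) + (b powr (1 - r) * K) * cmod (u x) powr r" for x
        proof (cases "cmod (u x) \<le> b")
          case True
          then have "cmod (u x) * cmod (k x) \<le> b * cmod (k x)" by (intro mult_right_mono) auto
          then show ?thesis using K0 by (simp add: add_increasing2)
        next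
          case False
          then have u0: "0 < cmod (u x)" using b by linarith
          have "cmod (u x) powr (1 - r) \<le> b powr (1 - r)" using False b r by (intro powr_mono2') auto
          then have "cmod (u x) powr r * cmod (u x) powr (1 - r) \<le> cmod (u x) powr r * b powr (1 - r)" by (intro mult_left_mono) auto
          then have "cmod (u x) \<le> cmod (u x) powr r * b powr (1 - r)" using u0 by (simp add: powr_add[symmetric])
          then have "cmod (u x) * cmod (k x) \<le> (cmod (u x) powr r * b powr (1 - r)) * K" by (intro mult_mono K) auto
          then show ?thesis using b by (simp add: mult_ac add_increasing)
        qed
        have "(\<integral>\<^sup>+ x. ennreal (cmod (u x) * cmod (k x)) \<partial>lborel)
          \<le> (\<integral>\<^sup>+ x. ennreal b * ennreal (cmod (k x)) + ennreal (b powr (1 - r) * K) * ennreal (cmod (u x) powr r) \<partial>lborel)"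
          using pt b K0 by (intro nn_integral_mono) (simp add: ennreal_mult[symmetric] ennreal_plus[symmetric] del: ennreal_plus)
        also have "\<dots> = ennreal b * (\<integral>\<^sup>+ x. ennreal (cmod (k x)) \<partial>lborel) + ennreal (b powr (1 - r) * K) * T"
          unfolding T_def by (subst nn_integral_add) (auto simp: nn_integral_cmult)
        also have "\<dots> \<le> ennreal b * ennreal I + ennreal (b powr (1 - r) * K) * T"
          by (intro add_mono mult_left_mono I) auto
        also have "\<dots> = ennreal (b * I + b powr (1 - r) * K * \<tau>)"
          using b K0 I T by (simp add: ennreal_mult[symmetric] ennreal_plus[symmetric] del: ennreal_plus)
        also have "b * I + b powr (1 - r) * K * \<tau> = b * (I + K)"
          using bt by (simp add: algebra_simps)
        also have "ennreal (b * (I + K)) \<le> ennreal (b * (I + K + 1))"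
          using b by (intro ennreal_leI mult_left_mono) auto
        also have "\<dots> = Lp_norm p u * ennreal (I + K + 1)"
          unfolding L' b_def[symmetric] using b I K0 by (intro ennreal_mult) auto
        finally show ?thesis .
      qed
    qed
  qed
qed

section \<open>The lower bound\<close>

lemma sigma_finite_nu: "sigma_finite_measure nu"
proof -
  interpret P: pair_sigma_finite "count_space (UNIV :: nat set)" "lborel :: real measure" by (rule nu_pair)
  show ?thesis unfolding nu_def by (rule P.sigma_finite_measure_axioms)
qed

lemma norm_fst_measurable [measurable]: "(\<lambda>x :: 'n::finite heis. norm (fst x)) \<in> borel_measurable borel"
  by (intro borel_measurable_continuous_onI continuous_intros)

lemma snd_heis_measurable [measurable]: "(\<lambda>x :: 'n::finite heis. snd x) \<in> borel_measurable borel"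
  by (intro borel_measurable_continuous_onI continuous_intros)

lemma kern_exp_measurable:
  assumes [measurable]: "c \<in> borel_measurable nu"
  shows "(\<lambda>p. c (fst p) * of_real (kern n m (fst p) (snd p :: 'n::finite heis)) * exp (\<i> * of_real (snd (fst p) * snd (snd p)))) \<in> borel_measurable (nu \<Otimes>\<^sub>M lborel)"
proof -
  have [measurable]: "(\<lambda>p. norm (fst (snd p))) \<in> borel_measurable (nu \<Otimes>\<^sub>M (lborel :: 'n heis measure))"
    "(\<lambda>p. snd (snd p)) \<in> borel_measurable (nu \<Otimes>\<^sub>M (lborel :: 'n heis measure))"
    using measurable_compose[OF measurable_snd, of "\<lambda>x :: 'n heis. norm (fst x)"]
      measurable_compose[OF measurable_snd, of "\<lambda>x :: 'n heis. snd x"] by simp_all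
  have q: "(\<lambda>p. snd (fst p)) \<in> borel_measurable (nu \<Otimes>\<^sub>M (lborel :: 'n heis measure))"
     "(\<lambda>p. fst (fst p)) \<in> measurable (nu \<Otimes>\<^sub>M (lborel :: 'n heis measure)) (count_space UNIV)"
    by (rule measurable_compose[OF measurable_fst], measurable)+
  note q [measurable]
  have "(\<lambda>p. kern n m (fst p) (snd p)) \<in> borel_measurable (nu \<Otimes>\<^sub>M (lborel :: 'n heis measure))"
    unfolding kern_def by (intro borel_measurable_times lagd_measurable q) measurable
  note this [measurable]
  show ?thesis by measurable
qed

lemma wave_measurable:
  assumes "c \<in> borel_measurable nu"
  shows "(wave m c :: 'n::finite heis \<Rightarrow> complex) \<in> borel_measurable lborel"
proof -
  interpret N: sigma_finite_measure nu by (rule sigma_finite_nu)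
  have "(\<lambda>p. c (snd p) * of_real (kern CARD('n) m (snd p) (fst p :: 'n heis)) * exp (\<i> * of_real (snd (snd p) * snd (fst p)))) \<in> borel_measurable (lborel \<Otimes>\<^sub>M nu)"
    using measurable_compose[OF measurable_pair_swap' kern_exp_measurable[OF assms, where 'n = 'n]] by (simp add: case_prod_beta)
  then show ?thesis
    unfolding wave_kern[abs_def] by (intro N.borel_measurable_lebesgue_integral) (simp add: case_prod_beta)
qed

lemma integrable_fst_times_snd:
  fixes f :: "'a \<Rightarrow> real" and g :: "'b \<Rightarrow> real"
  assumes "pair_sigma_finite M1 M2" and f: "integrable M1 f" and g: "integrable M2 g"
  shows "integrable (M1 \<Otimes>\<^sub>M M2) (\<lambda>p. f (fst p) * g (snd p))"
proof -
  interpret pair_sigma_finite M1 M2 by fact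
  show ?thesis
  proof (rule Fubini_integrable)
    have "(\<lambda>p. f (fst p)) \<in> borel_measurable (M1 \<Otimes>\<^sub>M M2)" "(\<lambda>p. g (snd p)) \<in> borel_measurable (M1 \<Otimes>\<^sub>M M2)"
      using measurable_compose[OF measurable_fst] measurable_compose[OF measurable_snd] f g by (auto dest!: borel_measurable_integrable)
    then show "(\<lambda>p. f (fst p) * g (snd p)) \<in> borel_measurable (M1 \<Otimes>\<^sub>M M2)" by (rule borel_measurable_times)
  qed (use f g in \<open>simp_all add: abs_mult\<close>)
qed

text \<open>Fubini's theorem moves the pairing to the fan, where powers of the sublaplacian are
  powers of \<xi>.\<close>

lemma wave_pairing:
  fixes k :: "'n::finite heis \<Rightarrow> complex"
  assumes c: "adm CARD('n) c" and k: "integrable lborel k"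
  shows "(LINT x|lborel. wave 0 c x * k x) =
    (LINT q|nu. c q * (LINT x|lborel. of_real (kern CARD('n) 0 q x) * exp (\<i> * of_real (snd q * snd x)) * k x))"
    and "integrable nu (\<lambda>q. c q * (LINT x|lborel. of_real (kern CARD('n) 0 q x) * exp (\<i> * of_real (snd q * snd x)) * k x))"
proof -
  let ?n = "CARD('n)"
  interpret P: pair_sigma_finite nu "lborel :: 'n heis measure"
    by (intro pair_sigma_finite.intro sigma_finite_nu lborel.sigma_finite_measure_axioms)
  let ?F = "\<lambda>q x. c q * of_real (kern ?n 0 q x) * exp (\<i> * of_real (snd q * snd x)) * k x"
  have cm: "c \<in> borel_measurable nu" using c by (simp add: adm_def)
  have km: "(\<lambda>p. k (snd p)) \<in> borel_measurable (nu \<Otimes>\<^sub>M lborel)"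
    by (rule measurable_compose[OF measurable_snd]) (use k in simp)
  have Fm: "case_prod ?F \<in> borel_measurable (nu \<Otimes>\<^sub>M lborel)"
    unfolding case_prod_beta by (intro borel_measurable_times[OF _ km] kern_exp_measurable cm)
  have Fb: "norm (?F q x) \<le> (cmod (c q) * fan_mult ?n q) * cmod (k x)" for q x
    using kern_bound[of ?n 0 q x, OF card_ge_1] norm_exp_i_times[of "snd q * snd x"]
    by (simp add: norm_mult mult_left_mono mult_right_mono del: norm_exp_i_times of_real_mult)
  have cb: "integrable nu (\<lambda>q. cmod (c q) * fan_mult ?n q)"
    using c unfolding adm_def by (auto dest!: spec[of _ 0])
  have int: "integrable (nu \<Otimes>\<^sub>M lborel) (case_prod ?F)"
  proof (rule Bochner_Integration.integrable_bound[OF _ Fm])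
    show "integrable (nu \<Otimes>\<^sub>M lborel) (\<lambda>p. (cmod (c (fst p)) * fan_mult ?n (fst p)) * cmod (k (snd p)))"
      by (rule integrable_fst_times_snd[OF P.pair_sigma_finite_axioms cb integrable_norm[OF k]])
    show "AE p in nu \<Otimes>\<^sub>M lborel. norm (case_prod ?F p) \<le> norm ((cmod (c (fst p)) * fan_mult ?n (fst p)) * cmod (k (snd p)))"
    proof (rule AE_I2)
      fix p :: "(nat \<times> real) \<times> 'n heis"
      have "0 \<le> (cmod (c (fst p)) * fan_mult ?n (fst p)) * cmod (k (snd p))" by simp
      then show "norm (case_prod ?F p) \<le> norm ((cmod (c (fst p)) * fan_mult ?n (fst p)) * cmod (k (snd p)))"
        using Fb[of "fst p" "snd p"] unfolding real_norm_def case_prod_beta by linarith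
    qed
  qed
  have inner: "(LINT x|lborel. ?F q x) = c q * (LINT x|lborel. of_real (kern ?n 0 q x) * exp (\<i> * of_real (snd q * snd x)) * k x)" for q
    unfolding mult.assoc by (rule integral_mult_right_zero)
  have "(LINT x|lborel. wave 0 c x * k x) = (LINT x|lborel. LINT q|nu. ?F q x)"
    unfolding wave_kern by (intro Bochner_Integration.integral_cong refl integral_mult_left_zero[symmetric])
  also have "\<dots> = (LINT q|nu. LINT x|lborel. ?F q x)" by (rule P.Fubini_integral[OF int])
  finally show "(LINT x|lborel. wave 0 c x * k x) =
    (LINT q|nu. c q * (LINT x|lborel. of_real (kern ?n 0 q x) * exp (\<i> * of_real (snd q * snd x)) * k x))"
    unfolding inner .
  show "integrable nu (\<lambda>q. c q * (LINT x|lborel. of_real (kern ?n 0 q x) * exp (\<i> * of_real (snd q * snd x)) * k x))"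
    using P.integrable_fst[OF int] unfolding inner .
qed

section \<open>A test function for a single ray\<close>

text \<open>\<sigma> is the sign of the interval and \<delta> a lower bound for its distance from 0.
  On the interval |x| = \<sigma> x, so that the modulus of \<lambda> is replaced by a linear
  function, and \<sigma> x s is at least \<delta> s.\<close>

context
  fixes \<alpha> \<beta> \<delta> \<sigma> :: real and j0 n :: nat
  assumes \<alpha>\<beta>: "\<alpha> < \<beta>" and \<sigma>: "\<bar>\<sigma>\<bar> = 1" and \<delta>: "0 < \<delta>" and pos: "\<And>x. x \<in> {\<alpha>..\<beta>} \<Longrightarrow> \<delta> \<le> \<sigma> * x"
begin

text \<open>Third powers give two continuous derivatives, with the function and its first derivative
  vanishing at the ends; this is what decay of order 1/(1+t^2) of the Fourier transform asks
  for.\<close>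

definition bump :: "real \<Rightarrow> real" where "bump x = max 0 (x - \<alpha>) ^ 3 * max 0 (\<beta> - x) ^ 3"

definition profile :: "real \<Rightarrow> real \<Rightarrow> complex" where
  "profile s x = of_real (bump x * lagf (n - 1) j0 (\<sigma> * x * s))"

text \<open>A function on the group whose spherical transform is carried by a compact piece of a single
  ray of the fan.\<close>

definition test_fun :: "'n::finite heis \<Rightarrow> complex" where
  "test_fun x = ftrans \<alpha> \<beta> (profile ((norm (fst x))\<^sup>2 / 2)) (snd x)"

lemma bump_pos: "x \<in> {\<alpha><..<\<beta>} \<Longrightarrow> 0 < bump x"
  by (simp add: bump_def)

lemma bump_0: "x \<notin> {\<alpha><..<\<beta>} \<Longrightarrow> bump x = 0"
  by (auto simp: bump_def max_def)

lemma bump_derivs: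
  obtains b1 b2 where "\<And>x. (bump has_real_derivative b1 x) (at x)" "\<And>x. (b1 has_real_derivative b2 x) (at x)"
    "continuous_on UNIV b2" "b1 \<alpha> = 0" "b1 \<beta> = 0"
proof -
  let ?p = "\<lambda>k x. max 0 (x - \<alpha>) ^ k" and ?q = "\<lambda>k x. max 0 (\<beta> - x) ^ k"
  have P: "(?p (Suc (Suc k)) has_real_derivative real (Suc (Suc k)) * ?p (Suc k) x) (at x)" for k x
    by (rule DERIV_cong[OF DERIV_chain2[where f = "\<lambda>y. max 0 y ^ Suc (Suc k)" and g = "\<lambda>x. x - \<alpha>", OF pos_part_power_deriv]])
       (auto intro!: derivative_eq_intros)
  have Q: "(?q (Suc (Suc k)) has_real_derivative - real (Suc (Suc k)) * ?q (Suc k) x) (at x)" for k x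
    by (rule DERIV_cong[OF DERIV_chain2[where f = "\<lambda>y. max 0 y ^ Suc (Suc k)" and g = "\<lambda>x. \<beta> - x", OF pos_part_power_deriv]])
       (auto intro!: derivative_eq_intros)
  have p3: "(?p 3 has_real_derivative 3 * ?p 2 x) (at x)" and p2: "(?p 2 has_real_derivative 2 * ?p 1 x) (at x)"
    and q3: "(?q 3 has_real_derivative - 3 * ?q 2 x) (at x)" and q2: "(?q 2 has_real_derivative - 2 * ?q 1 x) (at x)" for x
    using P[of 1 x] P[of 0 x] Q[of 1 x] Q[of 0 x] by (simp_all add: numeral_2_eq_2 numeral_3_eq_3)
  have e: "bump = (\<lambda>x. ?p 3 x * ?q 3 x)" by (auto simp: bump_def)
  show ?thesis
  proof (rule that)
    show "(bump has_real_derivative 3 * ?p 2 x * ?q 3 x + - 3 * ?q 2 x * ?p 3 x) (at x)" for x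
      unfolding e by (rule DERIV_mult[OF p3 q3])
    show "((\<lambda>x. 3 * ?p 2 x * ?q 3 x + - 3 * ?q 2 x * ?p 3 x) has_real_derivative
       ((3 * (2 * ?p 1 x)) * ?q 3 x + (- 3 * ?q 2 x) * (3 * ?p 2 x)) + ((- 3 * (- 2 * ?q 1 x)) * ?p 3 x + (3 * ?p 2 x) * (- 3 * ?q 2 x))) (at x)" for x
      by (intro DERIV_add DERIV_mult DERIV_cmult p3 p2 q3 q2)
  qed (auto intro!: continuous_intros)
qed

lemma profile_0: "x \<notin> {\<alpha>..\<beta>} \<Longrightarrow> profile s x = 0"
  by (auto simp: profile_def intro!: bump_0)

lemma profile_continuous: "continuous_on UNIV (profile s)"
  unfolding profile_def[abs_def] bump_def
  by (intro continuous_intros continuous_on_compose2[OF lagf_continuous]) auto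

text \<open>Two derivatives in x can bring out the factor s^2 from the argument \<sigma> x s. Decay
  of the Laguerre functions of order n + 3 pays for it and leaves n + 1, enough for integrability in
  z. Since \<sigma> x is bounded below, decay in \<sigma> x s is decay in s.\<close>

lemma ftrans_profile_bound:
  "\<exists>C\<ge>0. \<forall>s\<ge>0. \<forall>t. cmod (ftrans \<alpha> \<beta> (profile s) t) \<le> C * (1 / (1 + t\<^sup>2)) * (1 / (1 + s) ^ (n + 1))"
proof -
  let ?a = "n - 1"
  obtain b1 b2 where b: "\<And>x. (bump has_real_derivative b1 x) (at x)" "\<And>x. (b1 has_real_derivative b2 x) (at x)"
    "continuous_on UNIV b2" "b1 \<alpha> = 0" "b1 \<beta> = 0" using bump_derivs by metis
  have cont: "continuous_on UNIV bump" "continuous_on UNIV b1"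
    using b(1,2) by (auto intro!: continuous_at_imp_continuous_on dest: DERIV_isCont)
  have bd: "\<exists>A\<ge>0. \<forall>x\<in>{\<alpha>..\<beta>}. \<bar>f x\<bar> \<le> A" if "continuous_on UNIV f" for f :: "real \<Rightarrow> real"
  proof -
    have "bounded (f ` {\<alpha>..\<beta>})"
      by (intro compact_imp_bounded compact_continuous_image continuous_on_subset[OF that]) auto
    then obtain A where "\<forall>y\<in>f ` {\<alpha>..\<beta>}. norm y \<le> A" unfolding bounded_iff by blast
    then show ?thesis by (intro exI[of _ "max A 0"]) (auto simp: le_max_iff_disj)
  qed
  obtain A0 A1 A2 where A: "0 \<le> A0" "0 \<le> A1" "0 \<le> A2" "\<And>x. x \<in> {\<alpha>..\<beta>} \<Longrightarrow> \<bar>bump x\<bar> \<le> A0"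
    "\<And>x. x \<in> {\<alpha>..\<beta>} \<Longrightarrow> \<bar>b1 x\<bar> \<le> A1" "\<And>x. x \<in> {\<alpha>..\<beta>} \<Longrightarrow> \<bar>b2 x\<bar> \<le> A2"
    using bd[OF cont(1)] bd[OF cont(2)] bd[OF b(3)] by metis
  define D where "D = A0 + A1 + A2"
  have D: "0 \<le> D" "\<And>x. x \<in> {\<alpha>..\<beta>} \<Longrightarrow> \<bar>bump x\<bar> \<le> D" "\<And>x. x \<in> {\<alpha>..\<beta>} \<Longrightarrow> \<bar>b1 x\<bar> \<le> D" "\<And>x. x \<in> {\<alpha>..\<beta>} \<Longrightarrow> \<bar>b2 x\<bar> \<le> D"
    unfolding D_def using A by (smt (verit))+
  obtain L0 where L0: "0 \<le> L0" "\<And>s. 0 \<le> s \<Longrightarrow> \<bar>lagd 0 ?a j0 s\<bar> * (1 + s) ^ (n + 3) \<le> L0" using lagd_decay by blast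
  obtain L1 where L1: "0 \<le> L1" "\<And>s. 0 \<le> s \<Longrightarrow> \<bar>lagd 1 ?a j0 s\<bar> * (1 + s) ^ (n + 3) \<le> L1" using lagd_decay by blast
  obtain L2 where L2: "0 \<le> L2" "\<And>s. 0 \<le> s \<Longrightarrow> \<bar>lagd 2 ?a j0 s\<bar> * (1 + s) ^ (n + 3) \<le> L2" using lagd_decay by blast
  define c where "c = max 1 (1 / \<delta>)"
  have c: "0 < c" by (simp add: c_def)
  have Lb: "s ^ i * \<bar>lagd m ?a j0 (\<sigma> * x * s)\<bar> \<le> L * c ^ (n + 3) / (1 + s) ^ (n + 1)"
    if x: "x \<in> {\<alpha>..\<beta>}" and s: "0 \<le> s" and i: "i \<le> 2" and L: "\<And>s. 0 \<le> s \<Longrightarrow> \<bar>lagd m ?a j0 s\<bar> * (1 + s) ^ (n + 3) \<le> L" for x s i m L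
  proof -
    let ?u = "\<sigma> * x * s"
    have u: "0 \<le> ?u" by (rule mult_nonneg_nonneg) (use pos[OF x] \<delta> s in auto)
    have "\<delta> * s \<le> ?u" using pos[OF x] s by (intro mult_right_mono) auto
    then have "s \<le> (1 / \<delta>) * ?u" using \<delta> by (simp add: field_simps)
    also have "\<dots> \<le> c * ?u" using u by (intro mult_right_mono) (auto simp: c_def)
    finally have "1 + s \<le> c * (1 + ?u)" using max.cobounded1[of 1 "1 / \<delta>"] unfolding c_def[symmetric] by (simp add: distrib_left add_mono)
    then have "(1 + s) ^ (n + 3) \<le> (c * (1 + ?u)) ^ (n + 3)" using s by (intro power_mono) auto
    then have 1: "(1 + s) ^ (n + 3) \<le> c ^ (n + 3) * (1 + ?u) ^ (n + 3)" by (simp only: power_mult_distrib)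
    have "s ^ i \<le> (1 + s) ^ 2" using s i by (intro order_trans[OF power_mono[of s "1 + s" i] power_increasing]) auto
    then have "s ^ i * \<bar>lagd m ?a j0 ?u\<bar> * (1 + s) ^ (n + 1) \<le> (1 + s) ^ 2 * \<bar>lagd m ?a j0 ?u\<bar> * (1 + s) ^ (n + 1)"
      using s by (intro mult_right_mono) auto
    also have "\<dots> = \<bar>lagd m ?a j0 ?u\<bar> * (1 + s) ^ (n + 3)" by (simp add: power_add power2_eq_square power3_eq_cube)
    also have "\<dots> \<le> \<bar>lagd m ?a j0 ?u\<bar> * (c ^ (n + 3) * (1 + ?u) ^ (n + 3))" by (intro mult_left_mono 1) auto
    also have "\<dots> = (\<bar>lagd m ?a j0 ?u\<bar> * (1 + ?u) ^ (n + 3)) * c ^ (n + 3)" by (simp only: mult_ac)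
    also have "\<dots> \<le> L * c ^ (n + 3)" using L[OF u] c by (intro mult_right_mono) auto
    finally show ?thesis using s by (simp add: pos_le_divide_eq)
  qed
  define Q where "Q = (2 * L0 + 2 * L1 + L2) * c ^ (n + 3)"
  have Q: "0 \<le> Q" using L0 L1 L2 c by (simp add: Q_def)
  show ?thesis
  proof (intro exI[of _ "(\<beta> - \<alpha>) * (D * Q)"] conjI allI impI)
    show "0 \<le> (\<beta> - \<alpha>) * (D * Q)" using \<alpha>\<beta> D(1) Q by simp
    fix s t :: real assume s: "0 \<le> s"
    let ?l = "\<lambda>m x. lagd m ?a j0 (\<sigma> * x * s)"
    define u1 where "u1 x = b1 x * ?l 0 x + bump x * (\<sigma> * s * ?l 1 x)" for x
    define u2 where "u2 x = b2 x * ?l 0 x + 2 * (b1 x * (\<sigma> * s * ?l 1 x)) + bump x * ((\<sigma> * s)\<^sup>2 * ?l 2 x)" for x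
    have dl: "(?l m has_real_derivative \<sigma> * s * ?l (Suc m) x) (at x)" for m x
      by (rule DERIV_cong[OF DERIV_chain2[OF lagd_deriv]]) (auto intro!: derivative_eq_intros)
    have d0: "((\<lambda>x. bump x * ?l 0 x) has_real_derivative u1 x) (at x)" for x
      unfolding u1_def by (rule DERIV_cong[OF DERIV_mult[OF b(1) dl]]) (simp add: mult_ac)
    have d1: "(u1 has_real_derivative u2 x) (at x)" for x
      unfolding u1_def[abs_def] u2_def
      by (rule DERIV_cong[OF DERIV_add[OF DERIV_mult[OF b(2) dl] DERIV_mult[OF b(1) DERIV_cmult[OF dl]]]])
         (simp add: numeral_2_eq_2 algebra_simps power2_eq_square)
    have cl: "continuous_on UNIV (?l m)" for m
      using dl by (auto intro!: continuous_at_imp_continuous_on dest: DERIV_isCont)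
    have c2: "continuous_on UNIV u2"
      unfolding u2_def[abs_def] by (intro continuous_intros b(3) cl cont)
    have z: "bump \<alpha> = 0" "bump \<beta> = 0" by (simp_all add: bump_0)
    have p: "profile s x = of_real (bump x * ?l 0 x)" for x by (simp add: profile_def)
    have "(1 + t\<^sup>2) * cmod (ftrans \<alpha> \<beta> (profile s) t) \<le> (LINT x|lborel. indicator {\<alpha>..\<beta>} x *\<^sub>R (cmod (profile s x) + cmod (of_real (u2 x))))"
    proof (rule ftrans_decay[where ?w1.0 = "\<lambda>x. of_real (u1 x)"])
      show "(profile s has_vector_derivative of_real (u1 x)) (at x)" for x
        unfolding p[abs_def] by (rule has_vector_derivative_of_real[OF d0])
      show "((\<lambda>x. complex_of_real (u1 x)) has_vector_derivative of_real (u2 x)) (at x)" for x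
        by (rule has_vector_derivative_of_real[OF d1])
    qed (use \<alpha>\<beta> z b c2 in \<open>auto simp: p u1_def intro!: continuous_intros\<close>)
    also have "\<dots> \<le> (LINT x|lborel. indicator {\<alpha>..\<beta>} x *\<^sub>R (D * Q / (1 + s) ^ (n + 1)))"
    proof (rule integral_mono)
      show "integrable lborel (\<lambda>x. indicator {\<alpha>..\<beta>} x *\<^sub>R (cmod (profile s x) + cmod (of_real (u2 x))))"
        by (intro integrable_Icc continuous_intros profile_continuous c2)
      show "integrable lborel (\<lambda>x. indicator {\<alpha>..\<beta>} x *\<^sub>R (D * Q / (1 + s) ^ (n + 1)))"
        by (intro integrable_Icc continuous_intros)
      fix x
      show "indicator {\<alpha>..\<beta>} x *\<^sub>R (cmod (profile s x) + cmod (of_real (u2 x))) \<le> indicator {\<alpha>..\<beta>} x *\<^sub>R (D * Q / (1 + s) ^ (n + 1))"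
      proof (cases "x \<in> {\<alpha>..\<beta>}")
        case True
        have "\<bar>u2 x\<bar> \<le> \<bar>b2 x\<bar> * \<bar>?l 0 x\<bar> + 2 * (\<bar>b1 x\<bar> * (s * \<bar>?l 1 x\<bar>)) + \<bar>bump x\<bar> * (s\<^sup>2 * \<bar>?l 2 x\<bar>)"
        proof -
          have "\<sigma>\<^sup>2 = 1" using \<sigma> by (simp add: power2_eq_1_iff abs_if split: if_splits)
          then show ?thesis
            unfolding u2_def using s \<sigma>
            by (intro order_trans[OF abs_triangle_ineq] add_mono order_trans[OF abs_triangle_ineq]) (auto simp: abs_mult power_mult_distrib)
        qed
        also have "\<dots> \<le> D * \<bar>?l 0 x\<bar> + 2 * (D * (s * \<bar>?l 1 x\<bar>)) + D * (s\<^sup>2 * \<bar>?l 2 x\<bar>)"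
          using D(2-4)[OF True] s by (intro add_mono mult_right_mono mult_left_mono) auto
        finally have 1: "\<bar>u2 x\<bar> \<le> \<dots>" .
        have 2: "cmod (profile s x) \<le> D * \<bar>?l 0 x\<bar>"
          unfolding p norm_of_real abs_mult using D(2)[OF True] by (intro mult_right_mono) auto
        have "cmod (profile s x) + \<bar>u2 x\<bar> \<le> D * (2 * (s ^ 0 * \<bar>?l 0 x\<bar>) + 2 * (s ^ 1 * \<bar>?l 1 x\<bar>) + s ^ 2 * \<bar>?l 2 x\<bar>)"
          using 1 2 by (simp add: algebra_simps)
        also have "\<dots> \<le> D * (2 * (L0 * c ^ (n + 3) / (1 + s) ^ (n + 1)) + 2 * (L1 * c ^ (n + 3) / (1 + s) ^ (n + 1)) + L2 * c ^ (n + 3) / (1 + s) ^ (n + 1))"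
          by (intro mult_left_mono add_mono Lb True s D(1) L0(2) L1(2) L2(2)) auto
        also have "\<dots> = D * Q / (1 + s) ^ (n + 1)"
          unfolding Q_def by (simp only: times_divide_eq_right add_divide_distrib distrib_right distrib_left mult.assoc)
        finally show ?thesis using True by simp
      qed simp
    qed
    also have "\<dots> = (\<beta> - \<alpha>) * (D * Q) / (1 + s) ^ (n + 1)"
      using \<alpha>\<beta> by simp
    finally have "(1 + t\<^sup>2) * cmod (ftrans \<alpha> \<beta> (profile s) t) \<le> (\<beta> - \<alpha>) * (D * Q) / (1 + s) ^ (n + 1)" .
    then have "cmod (ftrans \<alpha> \<beta> (profile s) t) \<le> (\<beta> - \<alpha>) * (D * Q) / (1 + s) ^ (n + 1) / (1 + t\<^sup>2)"
      using add_pos_nonneg[of 1 "t\<^sup>2"] by (simp only: pos_le_divide_eq mult.commute zero_le_power2 zero_less_one)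
    then show "cmod (ftrans \<alpha> \<beta> (profile s) t) \<le> (\<beta> - \<alpha>) * (D * Q) * (1 / (1 + t\<^sup>2)) * (1 / (1 + s) ^ (n + 1))"
      by (simp only: times_divide_eq_right mult_1_right divide_divide_eq_left mult.commute)
  qed
qed

lemma ftrans_profile_integrable:
  assumes "0 \<le> s" shows "integrable lborel (ftrans \<alpha> \<beta> (profile s))"
proof -
  obtain C where C: "\<And>t. cmod (ftrans \<alpha> \<beta> (profile s) t) \<le> C * (1 / (1 + t\<^sup>2)) * (1 / (1 + s) ^ (n + 1))"
    using ftrans_profile_bound assms by blast
  show ?thesis
  proof (rule Bochner_Integration.integrable_bound[OF integrable_mult_left[OF integrable_mult_right[OF integrable_inverse_1_square, of C], of "1 / (1 + s) ^ (n + 1)"]])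
    have [measurable]: "profile s \<in> borel_measurable borel" by (intro borel_measurable_continuous_onI profile_continuous)
    show "ftrans \<alpha> \<beta> (profile s) \<in> borel_measurable lborel"
      unfolding ftrans_def[abs_def] by measurable
    show "AE t in lborel. norm (ftrans \<alpha> \<beta> (profile s) t) \<le> norm (C * (1 / (1 + t\<^sup>2)) * (1 / (1 + s) ^ (n + 1)))"
      by (rule AE_I2, rule order_trans[OF C], unfold real_norm_def, rule abs_ge_self)
  qed
qed

context
  fixes ty :: "'n::finite itself"
  assumes n: "n = CARD('n)"
begin

lemma test_fun_bound:
  "\<exists>C\<ge>0. \<forall>x :: 'n heis. cmod (test_fun x) \<le> C * (1 / (1 + (norm (fst x))\<^sup>2) ^ (CARD('n) + 1) * (1 / (1 + (snd x)\<^sup>2)))"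
proof -
  obtain C where C: "0 \<le> C" "\<And>s t. 0 \<le> s \<Longrightarrow> cmod (ftrans \<alpha> \<beta> (profile s) t) \<le> C * (1 / (1 + t\<^sup>2)) * (1 / (1 + s) ^ (n + 1))"
    using ftrans_profile_bound by blast
  show ?thesis
  proof (intro exI[of _ "C * 2 ^ (n + 1)"] conjI allI)
    fix x :: "'n heis"
    let ?R = "(norm (fst x))\<^sup>2"
    have "(1 + ?R) ^ (n + 1) \<le> (2 * (1 + ?R / 2)) ^ (n + 1)" by (intro power_mono) auto
    then have "(1 + ?R) ^ (n + 1) \<le> 2 ^ (n + 1) * (1 + ?R / 2) ^ (n + 1)" by (simp only: power_mult_distrib)
    moreover have "0 < (1 + ?R) ^ (n + 1)" "0 < (1 + ?R / 2) ^ (n + 1)" by (intro zero_less_power add_pos_nonneg; simp)+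
    ultimately have le: "1 / (1 + ?R / 2) ^ (n + 1) \<le> 2 ^ (n + 1) * (1 / (1 + ?R) ^ (n + 1))"
      by (simp add: divide_simps)
    have "cmod (test_fun x) \<le> C * (1 / (1 + (snd x)\<^sup>2)) * (1 / (1 + ?R / 2) ^ (n + 1))"
      unfolding test_fun_def by (rule C(2)) simp
    also have "\<dots> \<le> C * (1 / (1 + (snd x)\<^sup>2)) * (2 ^ (n + 1) * (1 / (1 + ?R) ^ (n + 1)))"
      using C(1) add_pos_nonneg[of 1 "(snd x)\<^sup>2"] by (intro mult_left_mono le) simp
    finally show "cmod (test_fun x) \<le> C * 2 ^ (n + 1) * (1 / (1 + ?R) ^ (CARD('n) + 1) * (1 / (1 + (snd x)\<^sup>2)))"
      unfolding n[symmetric] by (simp only: mult_ac)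
  qed (use C in simp)
qed

lemma test_fun_measurable: "(test_fun :: 'n heis \<Rightarrow> complex) \<in> borel_measurable lborel"
proof -
  let ?F = "\<lambda>(h :: 'n heis) x. indicator {\<alpha>..\<beta>} x *\<^sub>R (profile ((norm (fst h))\<^sup>2 / 2) x * exp (\<i> * of_real (- (snd h * x))))"
  have "(\<lambda>p::'n heis \<times> real. profile ((norm (fst (fst p)))\<^sup>2 / 2) (snd p) * exp (\<i> * of_real (- (snd (fst p) * snd p)))) \<in> borel_measurable borel"
    unfolding profile_def bump_def
    by (intro borel_measurable_continuous_onI continuous_intros continuous_on_compose2[OF lagf_continuous]) auto
  then have [measurable]: "(\<lambda>p::'n heis \<times> real. profile ((norm (fst (fst p)))\<^sup>2 / 2) (snd p) * exp (\<i> * of_real (- (snd (fst p) * snd p)))) \<in> borel_measurable (lborel \<Otimes>\<^sub>M lborel)"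
    by (subst lborel_prod) simp
  have "case_prod ?F \<in> borel_measurable (lborel \<Otimes>\<^sub>M lborel)"
    unfolding case_prod_beta by measurable
  then show ?thesis
    unfolding test_fun_def[abs_def] ftrans_def by (rule lborel.borel_measurable_lebesgue_integral)
qed

lemma test_fun_integrable: "integrable lborel (test_fun :: 'n heis \<Rightarrow> complex)"
proof -
  obtain C where C: "0 \<le> C" "\<And>x :: 'n heis. cmod (test_fun x) \<le> C * (1 / (1 + (norm (fst x))\<^sup>2) ^ (CARD('n) + 1) * (1 / (1 + (snd x)\<^sup>2)))"
    using test_fun_bound by blast
  have "integrable (lborel \<Otimes>\<^sub>M lborel) (\<lambda>p::(complex ^ 'n) \<times> real. 1 / (1 + (norm (fst p))\<^sup>2) ^ (CARD('n) + 1) * (1 / (1 + (snd p)\<^sup>2)))"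
    by (rule integrable_fst_times_snd[OF pair_sigma_finite.intro[OF lborel.sigma_finite_measure_axioms lborel.sigma_finite_measure_axioms] integrable_radial integrable_inverse_1_square])
  then have "integrable lborel (\<lambda>x :: 'n heis. C * (1 / (1 + (norm (fst x))\<^sup>2) ^ (CARD('n) + 1) * (1 / (1 + (snd x)\<^sup>2))))"
    unfolding lborel_prod by (rule integrable_mult_right)
  then show ?thesis
    by (rule Bochner_Integration.integrable_bound[OF _ test_fun_measurable])
       (rule AE_I2, rule order_trans[OF C(2)], unfold real_norm_def, rule abs_ge_self)
qed

definition ray_norm :: "nat \<Rightarrow> real \<Rightarrow> real" where
  "ray_norm j y = (LINT z|lborel. lagf (n - 1) j (y * (norm (z :: complex ^ 'n))\<^sup>2 / 2) * lagf (n - 1) j0 (y * (norm z)\<^sup>2 / 2))"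

lemma ray_norm_orthogonal:
  assumes "0 < y" "j \<noteq> j0" shows "ray_norm j y = 0"
proof -
  let ?f = "\<lambda>s. lagf (n - 1) j (y / 2 * s) * lagf (n - 1) j0 (y / 2 * s)"
  have f: "?f \<in> borel_measurable borel"
    by (intro borel_measurable_continuous_onI continuous_intros continuous_on_compose2[OF lagf_continuous]) auto
  have "ray_norm j y = (LINT z|lborel. ?f ((norm (z :: complex ^ 'n))\<^sup>2))"
    unfolding ray_norm_def by simp
  also have "\<dots> = (LINT s|lborel. indicator {0..} s *\<^sub>R (sphere_const CARD('n) * s ^ (CARD('n) - 1) * ?f s))"
    by (rule integral_radial[OF f])
  also have "\<dots> = (LINT s|lborel. sphere_const n * (indicator {0..} s *\<^sub>R (s ^ (n - 1) * ?f s)))"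
    unfolding n[symmetric] by (intro Bochner_Integration.integral_cong) auto
  also have "\<dots> = 0"
    unfolding integral_mult_right_zero using lagf_orthogonal[of n "y / 2" j j0] assms n by simp
  finally show ?thesis .
qed

text \<open>At the origin the Laguerre function is a binomial coefficient, hence nonzero; by
  continuity its square is positive on a nonempty open set.\<close>

lemma ray_norm_pos:
  assumes y: "0 < y" shows "0 < ray_norm j0 y"
proof -
  let ?g = "\<lambda>z :: complex ^ 'n. lagf (n - 1) j0 (y * (norm z)\<^sup>2 / 2)"
  have cg: "continuous_on UNIV ?g"
    by (intro continuous_intros continuous_on_compose2[OF lagf_continuous]) auto
  obtain C where C: "0 \<le> C" "\<And>s. 0 \<le> s \<Longrightarrow> \<bar>lagf (n - 1) j0 s\<bar> * (1 + s) ^ (CARD('n) + 1) \<le> C" using lagf_decay by blast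
  obtain D where D: "0 \<le> D" "\<And>s. 0 \<le> s \<Longrightarrow> \<bar>lagf (n - 1) j0 s\<bar> \<le> D" using lagf_decay[of "n - 1" j0 0] by auto
  define c where "c = max 1 (2 / y)"
  have c: "0 < c" by (simp add: c_def)
  have int: "integrable lborel (\<lambda>z. ?g z * ?g z)"
  proof (rule Bochner_Integration.integrable_bound[OF integrable_mult_right[OF integrable_radial, of "C * c ^ (CARD('n) + 1) * D"]])
    show "(\<lambda>z. ?g z * ?g z) \<in> borel_measurable lborel"
      using borel_measurable_continuous_onI[OF cg] by measurable
    show "AE z in lborel. norm (?g z * ?g z) \<le> norm (C * c ^ (CARD('n) + 1) * D * (1 / (1 + (norm z)\<^sup>2) ^ (CARD('n) + 1)))"
    proof (rule AE_I2)
      fix z :: "complex ^ 'n"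
      let ?s = "(norm z)\<^sup>2" and ?u = "y * (norm z)\<^sup>2 / 2"
      have u: "0 \<le> ?u" using y by simp
      have "?s = (2 / y) * ?u" using y by simp
      also have "\<dots> \<le> c * ?u" using u by (intro mult_right_mono) (auto simp: c_def)
      finally have "1 + ?s \<le> c * (1 + ?u)" using max.cobounded1[of 1 "2 / y"] unfolding c_def[symmetric] by (simp add: distrib_left add_mono)
      then have "(1 + ?s) ^ (CARD('n) + 1) \<le> (c * (1 + ?u)) ^ (CARD('n) + 1)" by (intro power_mono) auto
      then have 1: "(1 + ?s) ^ (CARD('n) + 1) \<le> c ^ (CARD('n) + 1) * (1 + ?u) ^ (CARD('n) + 1)" by (simp only: power_mult_distrib)
      have "\<bar>?g z * ?g z\<bar> * (1 + ?s) ^ (CARD('n) + 1) \<le> (\<bar>?g z\<bar> * D) * (c ^ (CARD('n) + 1) * (1 + ?u) ^ (CARD('n) + 1))"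
        unfolding abs_mult using D u by (intro mult_mono 1 mult_left_mono) auto
      also have "\<dots> = (\<bar>?g z\<bar> * (1 + ?u) ^ (CARD('n) + 1)) * (c ^ (CARD('n) + 1) * D)" by (simp only: mult_ac)
      also have "\<dots> \<le> C * (c ^ (CARD('n) + 1) * D)" using C(2)[OF u] D c by (intro mult_right_mono) auto
      finally have "\<bar>?g z * ?g z\<bar> \<le> C * (c ^ (CARD('n) + 1) * D) / (1 + ?s) ^ (CARD('n) + 1)"
        using zero_less_power[OF add_pos_nonneg[of 1 ?s]] by (simp only: pos_le_divide_eq zero_less_one zero_le_power2)
      then show "norm (?g z * ?g z) \<le> norm (C * c ^ (CARD('n) + 1) * D * (1 / (1 + (norm z)\<^sup>2) ^ (CARD('n) + 1)))"
        unfolding real_norm_def by (intro order_trans[OF _ abs_ge_self]) (simp add: mult.assoc)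
    qed
  qed
  have "0 < (LINT z|lborel. ?g z * ?g z)"
  proof (rule integral_pos_on_open[OF int, where S = "{z. ?g z \<noteq> 0}"])
    show "open {z. ?g z \<noteq> 0}" by (intro open_Collect_neq cg continuous_intros)
    have "lagf (n - 1) j0 0 \<noteq> 0"
      by (simp add: lagf_def lag_def power_0_left sum.atMost_shift if_distrib cong: if_cong)
    then have "0 \<in> {z. ?g z \<noteq> 0}" by simp
    then show "{z. ?g z \<noteq> 0} \<noteq> {}" by blast
    show "0 \<le> ?g z * ?g z" for z by simp
    show "0 < ?g z * ?g z" if "z \<in> {z. ?g z \<noteq> 0}" for z using that by (simp add: zero_less_mult_iff) linarith
  qed
  then show ?thesis by (simp add: ray_norm_def)
qed

text \<open>Fourier inversion in t returns the profile at the frequency \<lambda> of q. The integral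
  over z is then the inner product of two Laguerre functions with the same scale
  |\<lambda>|.\<close>

lemma test_fun_transform:
  "(LINT x|lborel. of_real (kern CARD('n) 0 q (x :: 'n heis)) * exp (\<i> * of_real (snd q * snd x)) * test_fun x)
    = of_real (2 * pi * bump (snd q) * ray_norm (fst q) \<bar>snd q\<bar>)"
proof -
  let ?l = "snd q" and ?a = "n - 1"
  let ?f = "\<lambda>x :: 'n heis. of_real (kern CARD('n) 0 q x) * exp (\<i> * of_real (?l * snd x)) * test_fun x"
  have int: "integrable lborel ?f"
  proof (rule Bochner_Integration.integrable_bound[OF integrable_mult_right[OF integrable_norm[OF test_fun_integrable], of "fan_mult CARD('n) q"]])
    have "(\<lambda>x :: 'n heis. kern CARD('n) 0 q x) \<in> borel_measurable lborel"
      unfolding kern_def by (intro borel_measurable_times lagd_measurable) measurable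
    then show "?f \<in> borel_measurable lborel" using test_fun_measurable by measurable
    show "AE x in lborel. norm (?f x) \<le> norm (fan_mult CARD('n) q * norm (test_fun x :: complex))"
    proof (rule AE_I2)
      fix x :: "'n heis"
      have "norm (?f x) = \<bar>kern CARD('n) 0 q x\<bar> * norm (test_fun x :: complex)"
        using norm_exp_i_times[of "?l * snd x"] by (simp only: norm_mult norm_of_real mult_1_right)
      also have "\<dots> \<le> fan_mult CARD('n) q * norm (test_fun x :: complex)"
        using kern_bound[of "CARD('n)" 0 q x, OF card_ge_1] by (intro mult_right_mono) auto
      finally show "norm (?f x) \<le> norm (fan_mult CARD('n) q * norm (test_fun x :: complex))" by simp
    qed
  qed
  have "(LINT x|lborel. ?f x) = (LINT x|(lborel \<Otimes>\<^sub>M lborel). ?f x)" by (simp only: lborel_prod)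
  also have "\<dots> = (LINT z|lborel. LINT t|lborel. ?f (z, t))"
    by (rule lborel_pair.integral_fst'[symmetric]) (use int in \<open>simp only: lborel_prod\<close>)
  also have "\<dots> = (LINT z|lborel. of_real (2 * pi * bump ?l * (lagf ?a (fst q) (\<bar>?l\<bar> * (norm (z :: complex ^ 'n))\<^sup>2 / 2) * lagf ?a j0 (\<bar>?l\<bar> * (norm z)\<^sup>2 / 2))))"
  proof (rule Bochner_Integration.integral_cong[OF refl])
    fix z :: "complex ^ 'n"
    let ?s = "(norm z)\<^sup>2 / 2"
    have "(LINT t|lborel. ?f (z, t)) = (LINT t|lborel. of_real (lagf ?a (fst q) (\<bar>?l\<bar> * (norm z)\<^sup>2 / 2)) * (exp (\<i> * of_real (?l * t)) * ftrans \<alpha> \<beta> (profile ?s) t))"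
      unfolding kern_def test_fun_def n[symmetric] by (simp add: mult.assoc)
    also have "\<dots> = of_real (lagf ?a (fst q) (\<bar>?l\<bar> * (norm z)\<^sup>2 / 2)) * (of_real (2 * pi) * profile ?s ?l)"
      unfolding integral_mult_right_zero
      by (subst fourier_inversion[OF profile_continuous profile_0 ftrans_profile_integrable]) auto
    also have "profile ?s ?l = of_real (bump ?l * lagf ?a j0 (\<bar>?l\<bar> * (norm z)\<^sup>2 / 2))"
    proof (cases "bump ?l = 0")
      case False
      then have "?l \<in> {\<alpha><..<\<beta>}" using bump_0 by blast
      then have "0 < \<sigma> * ?l" using pos[of ?l] \<delta> by (simp add: less_imp_le)
      then have "\<sigma> * ?l = \<bar>?l\<bar>" using \<sigma> by (metis abs_mult abs_of_pos mult_1)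
      then show ?thesis by (simp add: profile_def)
    qed (simp add: profile_def)
    finally show "(LINT t|lborel. ?f (z, t)) = of_real (2 * pi * bump ?l * (lagf ?a (fst q) (\<bar>?l\<bar> * (norm z)\<^sup>2 / 2) * lagf ?a j0 (\<bar>?l\<bar> * (norm z)\<^sup>2 / 2)))"
      by (simp add: mult_ac)
  qed
  also have "\<dots> = of_real (LINT z|lborel. 2 * pi * bump ?l * (lagf ?a (fst q) (\<bar>?l\<bar> * (norm (z :: complex ^ 'n))\<^sup>2 / 2) * lagf ?a j0 (\<bar>?l\<bar> * (norm z)\<^sup>2 / 2)))"
    by (rule integral_complex_of_real)
  finally show ?thesis unfolding ray_norm_def integral_mult_right_zero .
qed

end

end

lemma ray_test_function:
  assumes \<alpha>\<beta>: "\<alpha> < \<beta>" and 0: "0 \<notin> {\<alpha>..\<beta>}"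
  obtains k :: "'n::finite heis \<Rightarrow> complex" and b K
  where "k \<in> borel_measurable lborel" "integrable lborel k" "\<And>x. cmod (k x) \<le> K"
    "\<And>l. l \<in> {\<alpha><..<\<beta>} \<Longrightarrow> 0 < b l" "\<And>l. l \<notin> {\<alpha><..<\<beta>} \<Longrightarrow> b l = 0"
    "\<And>q. (LINT x|lborel. of_real (kern CARD('n) 0 q x) * exp (\<i> * of_real (snd q * snd x)) * k x)
       = of_real (if fst q = j0 then b (snd q) else 0)"
proof -
  define \<sigma> :: real where "\<sigma> = (if 0 < \<alpha> then 1 else - 1)"
  define \<delta> where "\<delta> = (if 0 < \<alpha> then \<alpha> else - \<beta>)"
  have \<sigma>: "\<bar>\<sigma>\<bar> = 1" by (simp add: \<sigma>_def)
  have \<delta>: "0 < \<delta>" using 0 \<alpha>\<beta> by (auto simp: \<delta>_def)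
  have pos: "\<delta> \<le> \<sigma> * x" if "x \<in> {\<alpha>..\<beta>}" for x using that 0 by (auto simp: \<delta>_def \<sigma>_def)
  let ?k = "test_fun \<alpha> \<beta> \<sigma> j0 CARD('n) :: 'n heis \<Rightarrow> complex"
  define b where "b l = 2 * pi * bump \<alpha> \<beta> l * ray_norm TYPE('n) j0 CARD('n) j0 \<bar>l\<bar>" for l
  note ctx = \<alpha>\<beta> \<sigma> \<delta> pos
  obtain C where C: "0 \<le> C" "\<And>x :: 'n heis. cmod (?k x) \<le> C * (1 / (1 + (norm (fst x))\<^sup>2) ^ (CARD('n) + 1) * (1 / (1 + (snd x)\<^sup>2)))"
    using test_fun_bound[OF ctx refl, where 'n = 'n] by blast
  show ?thesis
  proof (rule that)
    show "?k \<in> borel_measurable lborel" by (rule test_fun_measurable[OF ctx refl])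
    show "integrable lborel ?k" by (rule test_fun_integrable[OF ctx refl])
    show "cmod (?k x) \<le> C" for x
    proof -
      have "1 / (1 + (norm (fst x))\<^sup>2) ^ (CARD('n) + 1) * (1 / (1 + (snd x)\<^sup>2)) \<le> 1 * 1"
      proof (intro mult_mono)
        have a: "1 / t \<le> 1" if "1 \<le> t" for t :: real using that by simp
        show "1 / (1 + (norm (fst x))\<^sup>2) ^ (CARD('n) + 1) \<le> 1" by (intro a one_le_power) (rule add_increasing2, simp_all)
        show "1 / (1 + (snd x)\<^sup>2) \<le> 1" by (rule a, rule add_increasing2, simp_all)
      qed simp_all
      then show ?thesis using order_trans[OF C(2) mult_left_mono[OF _ C(1)]] by fastforce
    qed
    show "0 < b l" if "l \<in> {\<alpha><..<\<beta>}" for l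
    proof -
      have "l \<noteq> 0" using that 0 by auto
      then show ?thesis
        unfolding b_def using bump_pos[OF ctx that] ray_norm_pos[OF ctx refl, of "\<bar>l\<bar>" j0, where 'n = 'n] by simp
    qed
    show "b l = 0" if "l \<notin> {\<alpha><..<\<beta>}" for l
      unfolding b_def using bump_0[OF ctx that] by simp
    fix q :: "nat \<times> real"
    \<comment> \<open>Orthogonality is available only for a positive scale; at \<lambda> = 0 the
      bump vanishes, as 0 lies outside the interval.\<close>
    have z: "bump \<alpha> \<beta> (snd q) * ray_norm TYPE('n) j0 CARD('n) (fst q) \<bar>snd q\<bar> = 0" if "fst q \<noteq> j0"
    proof (cases "snd q = 0")
      case True
      have "bump \<alpha> \<beta> 0 = 0" by (rule bump_0[OF ctx]) (use 0 in auto)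
      then show ?thesis using True by simp
    next
      case False
      then show ?thesis using ray_norm_orthogonal[OF ctx refl, of "\<bar>snd q\<bar>" "fst q" j0, where 'n = 'n] that by simp
    qed
    have "2 * pi * bump \<alpha> \<beta> (snd q) * ray_norm TYPE('n) j0 CARD('n) (fst q) \<bar>snd q\<bar>
        = (if fst q = j0 then b (snd q) else 0)"
      using z by (auto simp: b_def)
    note e = arg_cong[OF this, of complex_of_real]
    show "(LINT x|lborel. of_real (kern CARD('n) 0 q x) * exp (\<i> * of_real (snd q * snd x)) * ?k x)
       = of_real (if fst q = j0 then b (snd q) else 0)"
      by (rule trans[OF test_fun_transform[OF ctx refl] e])
  qed
qed

lemma adm_schwartz:
  assumes "schwartz f" and n: "n \<ge> 1" shows "adm n (fan_coeff n f)" "continuous_on UNIV f"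
proof -
  have "\<exists>B. CN 0 B f" by (rule schwartz_CN[OF assms(1)])
  then show c: "continuous_on UNIV f" using CN_continuous by blast
  show "adm n (fan_coeff n f)"
  proof (rule adm_fan_coeff[OF borel_measurable_continuous_onI[OF c] n])
    fix k
    have "bounded (range (\<lambda>x. (1 + norm x) ^ k *\<^sub>R f x))"
      using assms(1) unfolding schwartz_def by (auto dest!: bspec[of _ _ "[]"])
    then obtain C where C: "\<And>p. (1 + norm p) ^ k * cmod (f p) \<le> C" unfolding bounded_iff by auto
    have "cmod (f (\<xi>, l)) * (1 + \<xi>) ^ k \<le> C" if "0 \<le> \<xi>" for \<xi> l
    proof -
      have "\<xi> \<le> norm (\<xi>, l)" using norm_fst_le[of \<xi> l] that by simp
      then have "(1 + \<xi>) ^ k * cmod (f (\<xi>, l)) \<le> (1 + norm (\<xi>, l)) ^ k * cmod (f (\<xi>, l))"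
        using that by (intro mult_right_mono power_mono) auto
      then show ?thesis using C[of "(\<xi>, l)"] by (simp add: mult.commute)
    qed
    then show "\<exists>C. \<forall>\<xi> l. 0 \<le> \<xi> \<longrightarrow> cmod (f (\<xi>, l)) * (1 + \<xi>) ^ k \<le> C" by blast
  qed
qed

lemma integral_nu_single:
  fixes h :: "nat \<times> real \<Rightarrow> complex"
  assumes h: "integrable nu h" and z: "\<And>q. fst q \<noteq> j0 \<Longrightarrow> h q = 0"
  shows "(LINT q|nu. h q) = (LINT l|lborel. h (j0, l))" "integrable lborel (\<lambda>l. h (j0, l))"
proof -
  interpret P: pair_sigma_finite "count_space (UNIV :: nat set)" "lborel :: real measure" by (rule nu_pair)
  have int: "integrable (count_space UNIV \<Otimes>\<^sub>M lborel) (case_prod (\<lambda>j l. h (j, l)))" using h by (simp add: nu_def)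
  have inner: "(LINT j|count_space UNIV. h (j, l)) = h (j0, l)" for l
  proof -
    have s: "{j \<in> UNIV. h (j, l) \<noteq> 0} \<subseteq> {j0}" using z[of "(_, l)"] by auto
    have "(LINT j|count_space UNIV. h (j, l)) = (\<Sum>j\<in>{j \<in> UNIV. h (j, l) \<noteq> 0}. h (j, l))"
      by (rule lebesgue_integral_count_space_finite_support) (rule finite_subset[OF s], simp)
    also have "\<dots> = (\<Sum>j\<in>{j0}. h (j, l))" by (rule sum.mono_neutral_left[OF _ s]) auto
    finally show ?thesis by simp
  qed
  have "(LINT q|nu. h q) = (LINT q|(count_space UNIV \<Otimes>\<^sub>M lborel). case_prod (\<lambda>j l. h (j, l)) q)"
    by (simp add: nu_def)
  also have "\<dots> = (LINT l|lborel. LINT j|count_space UNIV. h (j, l))"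
    by (rule P.integral_snd[OF int, symmetric])
  finally show "(LINT q|nu. h q) = (LINT l|lborel. h (j0, l))" unfolding inner .
  show "integrable lborel (\<lambda>l. h (j0, l))" using P.integrable_snd[OF int] unfolding inner .
qed

text \<open>Multiplication by the conjugate of the value of f at the given point makes the real part
  of the pairing the integral of a nonnegative function times \<xi>^J. No cancellation can occur,
  and on its support \<xi> exceeds r, which gives c r^J with a constant independent of J.\<close>

lemma ray_lower_bound:
  assumes f: "schwartz f" and F: "\<And>p. p \<in> fan CARD('n) \<Longrightarrow> F p = f p"
    and l0: "l0 \<noteq> 0" and nz: "f (\<bar>l0\<bar> * real (2 * j0 + CARD('n)), l0) \<noteq> 0"
    and r: "0 \<le> r" "r < \<bar>l0\<bar> * real (2 * j0 + CARD('n))"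
  shows "\<exists>c>0. \<forall>J p. 1 \<le> p \<longrightarrow> ennreal (c * r ^ J) \<le> Lp_norm p ((sublaplacian ^^ J) (inv_gelfand F) :: 'n::finite heis \<Rightarrow> complex)"
proof -
  let ?n = "CARD('n)"
  define m where "m = real (2 * j0 + ?n)"
  define w where "w = cnj (f (\<bar>l0\<bar> * m, l0))"
  have w0: "w \<noteq> 0" using nz by (simp add: w_def m_def)
  note adm = adm_schwartz(1)[OF f card_ge_1[where 'n = 'n]] and cf = adm_schwartz(2)[OF f card_ge_1[where 'n = 'n]]
  \<comment> \<open>The open set on which the three requirements hold: away from 0, positive real
    part, and \<xi> > r. The interval of the test function is chosen inside it.\<close>
  define U where "U = {l. l \<noteq> 0 \<and> 0 < Re (w * f (\<bar>l\<bar> * m, l)) \<and> r < \<bar>l\<bar> * m}"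
  have "open U"
    unfolding U_def
    by (intro open_Collect_conj open_Collect_neq open_Collect_less continuous_intros continuous_on_compose2[OF cf]) auto
  moreover have "l0 \<in> U"
  proof -
    have "w * f (\<bar>l0\<bar> * m, l0) = of_real ((cmod (f (\<bar>l0\<bar> * m, l0)))\<^sup>2)"
      unfolding w_def by (subst mult.commute) (rule complex_norm_square[symmetric])
    then have "Re (w * f (\<bar>l0\<bar> * m, l0)) = (cmod (f (\<bar>l0\<bar> * m, l0)))\<^sup>2" by (simp only: Re_complex_of_real)
    also have "\<dots> > 0" using nz by (simp add: m_def)
    finally show ?thesis using l0 r(2) unfolding U_def m_def by blast
  qed
  ultimately obtain e where e: "0 < e" "cball l0 e \<subseteq> U" using open_contains_cball by blast
  define \<alpha> \<beta> where "\<alpha> = l0 - e" and "\<beta> = l0 + e"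
  have \<alpha>\<beta>: "\<alpha> < \<beta>" and sub: "{\<alpha>..\<beta>} \<subseteq> U"
    using e by (auto simp: \<alpha>_def \<beta>_def cball_def dist_real_def abs_le_iff subset_iff)
  have 0: "0 \<notin> {\<alpha>..\<beta>}" using sub by (auto simp: U_def)
  obtain k :: "'n heis \<Rightarrow> complex" and b K where k: "k \<in> borel_measurable lborel" "integrable lborel k" "\<And>x. cmod (k x) \<le> K"
    and b: "\<And>l. l \<in> {\<alpha><..<\<beta>} \<Longrightarrow> 0 < b l" "\<And>l. l \<notin> {\<alpha><..<\<beta>} \<Longrightarrow> b l = 0"
    and tr: "\<And>q. (LINT x|lborel. of_real (kern ?n 0 q x) * exp (\<i> * of_real (snd q * snd x)) * k x)
       = of_real (if fst q = j0 then b (snd q) else 0)"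
    by (rule ray_test_function[OF \<alpha>\<beta> 0, where 'n = 'n and ?j0.0 = j0]) (rule that)
  define \<Theta> where "\<Theta> l = Re (w * f (\<bar>l\<bar> * m, l)) * (\<bar>l\<bar> ^ ?n / (2 * pi) ^ (?n + 1) * b l)" for l
  let ?u = "\<lambda>J. (sublaplacian ^^ J) (inv_gelfand F) :: 'n heis \<Rightarrow> complex"
  let ?c = "\<lambda>J. fan_coeff ?n (\<lambda>p. of_real (fst p ^ J) * f p)"
  have u: "?u J = wave 0 (?c J)" for J by (rule inv_gelfand_wave_pow[OF cf F adm])
  have admJ: "adm ?n (?c J)" for J
  proof -
    have "?c J = (\<lambda>q. of_real (xi ?n q ^ J) * fan_coeff ?n f q)"
      by (simp add: fun_eq_iff fan_coeff_def xi_def)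
    then show ?thesis using sublaplacian_pow_wave[OF adm, of J] by simp
  qed
  have pair: "Re (w * (LINT x|lborel. ?u J x * k x)) = (LINT l|lborel. (\<bar>l\<bar> * m) ^ J * \<Theta> l)"
    and int: "integrable lborel (\<lambda>l. (\<bar>l\<bar> * m) ^ J * \<Theta> l)" for J
  proof -
    let ?h = "\<lambda>q. ?c J q * of_real (if fst q = j0 then b (snd q) else 0)"
    have hi: "integrable nu ?h" using wave_pairing(2)[OF admJ[of J] k(2)] unfolding tr .
    note hs = integral_nu_single[OF hi, of j0]
    have i: "integrable lborel (\<lambda>l. ?h (j0, l))" by (rule hs(2)) simp
    have h: "Re (w * ?h (j0, l)) = (\<bar>l\<bar> * m) ^ J * \<Theta> l" for l
    proof -
      let ?a = "\<bar>l\<bar> ^ ?n / (2 * pi) ^ (?n + 1)"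
      have eq: "w * (of_real a * (of_real M ^ J * z) * of_real y) = of_real (M ^ J * (a * y)) * (w * z)" for a M y and z :: complex
        by (simp add: mult_ac)
      have re: "Re (of_real v * z) = v * Re z" for v z by simp
      have h0: "?h (j0, l) = of_real ?a * (of_real (\<bar>l\<bar> * m) ^ J * f (\<bar>l\<bar> * m, l)) * of_real (b l)"
        unfolding fan_coeff_def fst_conv snd_conv m_def of_real_power by (simp only: if_True refl)
      show ?thesis unfolding \<Theta>_def h0 eq re by (simp only: mult_ac)
    qed
    have "(LINT x|lborel. ?u J x * k x) = (LINT l|lborel. ?h (j0, l))"
      unfolding u wave_pairing(1)[OF admJ k(2)] tr by (rule hs(1)) simp
    then have "w * (LINT x|lborel. ?u J x * k x) = (LINT l|lborel. w * ?h (j0, l))"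
      by (simp only: integral_mult_right_zero)
    then have "Re (w * (LINT x|lborel. ?u J x * k x)) = (LINT l|lborel. Re (w * ?h (j0, l)))"
      by (simp only: integral_Re[OF integrable_mult_right[OF i, of w]])
    then show "Re (w * (LINT x|lborel. ?u J x * k x)) = (LINT l|lborel. (\<bar>l\<bar> * m) ^ J * \<Theta> l)" unfolding h .
    show "integrable lborel (\<lambda>l. (\<bar>l\<bar> * m) ^ J * \<Theta> l)"
      using integrable_Re[OF integrable_mult_right[OF i, of w]] unfolding h .
  qed
  have \<Theta>pos: "0 < \<Theta> l" if "l \<in> {\<alpha><..<\<beta>}" for l
  proof -
    have "l \<in> U" using that sub by auto
    then show ?thesis unfolding \<Theta>_def U_def using b(1)[OF that] by (intro mult_pos_pos divide_pos_pos zero_less_power) auto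
  qed
  have \<Theta>nn: "0 \<le> \<Theta> l" for l
    by (cases "l \<in> {\<alpha><..<\<beta>}") (use \<Theta>pos[of l] b(2)[of l] in \<open>auto simp: \<Theta>_def less_imp_le\<close>)
  have \<Theta>i: "integrable lborel \<Theta>" using int[of 0] by simp
  define c0 where "c0 = (LINT l|lborel. \<Theta> l)"
  have c0: "0 < c0"
    unfolding c0_def using \<alpha>\<beta> by (intro integral_pos_on_open[OF \<Theta>i \<Theta>nn, of "{\<alpha><..<\<beta>}"] \<Theta>pos) auto
  define I where "I = (LINT x|lborel. cmod (k x))"
  have I0: "0 \<le> I" by (simp add: I_def)
  have I: "(\<integral>\<^sup>+ x. ennreal (cmod (k x)) \<partial>lborel) \<le> ennreal I"
    unfolding I_def using k(2) by (subst nn_integral_eq_integral) auto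
  have K0: "0 \<le> K" using order_trans[OF norm_ge_zero k(3)] .
  define D where "D = cmod w * (I + K + 1)"
  have D: "0 < D" using w0 I0 K0 by (simp add: D_def)
  show ?thesis
  proof (intro exI[of _ "c0 / D"] conjI allI impI)
    show "0 < c0 / D" using c0 D by simp
    fix J and p :: ennreal assume p: "1 \<le> p"
    have "r ^ J * c0 = (LINT l|lborel. r ^ J * \<Theta> l)" by (simp add: c0_def)
    also have "\<dots> \<le> (LINT l|lborel. (\<bar>l\<bar> * m) ^ J * \<Theta> l)"
    proof (rule integral_mono[OF integrable_mult_right[OF \<Theta>i] int])
      fix l
      show "r ^ J * \<Theta> l \<le> (\<bar>l\<bar> * m) ^ J * \<Theta> l"
      proof (cases "l \<in> {\<alpha><..<\<beta>}")
        case True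
        then have "l \<in> U" using sub by auto
        then show ?thesis using r \<Theta>nn by (intro mult_right_mono power_mono) (auto simp: U_def)
      qed (simp add: \<Theta>_def b(2))
    qed
    also have "\<dots> \<le> cmod (w * (LINT x|lborel. ?u J x * k x))"
      unfolding pair[symmetric] by (rule complex_Re_le_cmod)
    finally have 1: "r ^ J * c0 \<le> cmod w * cmod (LINT x|lborel. ?u J x * k x)" by (simp only: norm_mult)
    have um: "?u J \<in> borel_measurable lborel"
      unfolding u by (rule wave_measurable) (use admJ[of J] in \<open>simp add: adm_def\<close>)
    have "ennreal (cmod (LINT x|lborel. ?u J x * k x)) \<le> (\<integral>\<^sup>+ x. ennreal (cmod (?u J x) * cmod (k x)) \<partial>lborel)"
    proof (cases "integrable lborel (\<lambda>x. ?u J x * k x)")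
      case True
      then show ?thesis using integral_norm_bound_ennreal[OF True] by (simp add: norm_mult)
    next
      \<comment> \<open>The integral of a function that is not integrable is 0, so the inequality
        holds trivially.\<close>
      case False
      then show ?thesis by (simp add: not_integrable_integral_eq)
    qed
    also have "\<dots> \<le> Lp_norm p (?u J) * ennreal (I + K + 1)"
      by (rule Lp_norm_pairing[OF um k(1,3) I I0 p])
    finally have 2: "ennreal (cmod (LINT x|lborel. ?u J x * k x)) \<le> Lp_norm p (?u J) * ennreal (I + K + 1)" .
    show "ennreal (c0 / D * r ^ J) \<le> Lp_norm p (?u J)"
    proof (cases "Lp_norm p (?u J)")
      case (real v)
      have "ennreal (cmod (LINT x|lborel. ?u J x * k x)) \<le> ennreal (v * (I + K + 1))"
        using 2 real I0 K0 by (simp add: ennreal_mult)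
      then have "cmod (LINT x|lborel. ?u J x * k x) \<le> v * (I + K + 1)"
        using real I0 K0 by (subst (asm) ennreal_le_iff) auto
      then have "r ^ J * c0 \<le> cmod w * (v * (I + K + 1))"
        using 1 by (meson mult_left_mono norm_ge_zero order_trans)
      then have "r ^ J * c0 \<le> v * D" by (simp only: D_def mult_ac)
      then have "c0 / D * r ^ J \<le> v" using D by (simp add: pos_divide_le_eq mult.commute)
      then show ?thesis using real by (simp add: ennreal_leI)
    qed simp
  qed
qed

text \<open>A point with \<lambda> = 0 is the limit of the points with the same \<xi> and \<lambda>
  = \<xi>/(2j+n), which lie on the rays. By continuity of the extension the value is nonzero at one
  of them, so that a single ray is enough.\<close>

lemma inv_gelfand_lower_bound:
  assumes f: "schwartz_fan CARD('n) F" and p0: "p0 \<in> fan CARD('n)" "F p0 \<noteq> 0" and r: "0 \<le> r" "r < fst p0"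
  shows "\<exists>c>0. \<forall>J p. 1 \<le> p \<longrightarrow> ennreal (c * r ^ J) \<le> Lp_norm p ((sublaplacian ^^ J) (inv_gelfand F) :: 'n::finite heis \<Rightarrow> complex)"
proof -
  let ?n = "CARD('n)"
  obtain f0 where f0: "schwartz f0" "\<And>p. p \<in> fan ?n \<Longrightarrow> F p = f0 p" using f by (auto simp: schwartz_fan_def)
  have "\<exists>l j. l \<noteq> 0 \<and> f0 (\<bar>l\<bar> * real (2 * j + ?n), l) \<noteq> 0 \<and> r < \<bar>l\<bar> * real (2 * j + ?n)"
  proof (cases "snd p0 = 0")
    case False
    then obtain j where "fst p0 = \<bar>snd p0\<bar> * real (2 * j + ?n)" using p0(1) by (auto simp: fan_def)
    then show ?thesis using False p0 f0(2)[OF p0(1)] r by (metis prod.collapse)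
  next
    case True
    define l where "l j = fst p0 / real (2 * j + ?n)" for j
    have l: "l j \<noteq> 0" "\<bar>l j\<bar> * real (2 * j + ?n) = fst p0" for j
    proof -
      have "0 < real (2 * j + ?n)" unfolding of_nat_0_less_iff using card_ge_1[where 'n = 'n] by (rule trans_less_add2[OF less_le_trans[OF zero_less_one]])
      then show "l j \<noteq> 0" "\<bar>l j\<bar> * real (2 * j + ?n) = fst p0" using r by (simp_all add: l_def abs_divide del: of_nat_add)
    qed
    have "l \<longlonglongrightarrow> 0"
    proof (rule Lim_null_comparison)
      show "\<forall>\<^sub>F j in sequentially. norm (l j) \<le> fst p0 * (1 / real (Suc j))"
      proof (intro always_eventually allI)
        fix j
        have "real (Suc j) \<le> real (2 * j + ?n)" unfolding of_nat_le_iff using card_ge_1[where 'n = 'n] by linarith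
        then have "fst p0 / real (2 * j + ?n) \<le> fst p0 / real (Suc j)"
          using r by (intro divide_left_mono mult_pos_pos) (auto simp del: of_nat_add)
        then show "norm (l j) \<le> fst p0 * (1 / real (Suc j))" using r by (simp add: l_def)
      qed
      show "(\<lambda>j. fst p0 * (1 / real (Suc j))) \<longlonglongrightarrow> 0"
        by (rule tendsto_mult_right_zero[OF LIMSEQ_Suc[OF lim_1_over_n]])
    qed
    then have "(\<lambda>j. (fst p0, l j)) \<longlonglongrightarrow> (fst p0, 0)" by (intro tendsto_intros)
    then have "(\<lambda>j. (fst p0, l j)) \<longlonglongrightarrow> p0" using True by (metis prod.collapse)
    moreover have "isCont f0 p0"
      using adm_schwartz(2)[OF f0(1) card_ge_1[where 'n = 'n]] by (simp add: continuous_on_eq_continuous_at)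
    ultimately have "(\<lambda>j. f0 (fst p0, l j)) \<longlonglongrightarrow> f0 p0" by (rule isCont_tendsto_compose[rotated])
    then have "\<forall>\<^sub>F j in sequentially. f0 (fst p0, l j) \<noteq> 0"
      using p0 f0(2) by (intro tendsto_imp_eventually_ne) auto
    then obtain j where "f0 (fst p0, l j) \<noteq> 0" by (auto dest: eventually_happens)
    then show ?thesis using l r by metis
  qed
  then show ?thesis using ray_lower_bound[OF f0] r(1) by blast
qed

section \<open>The spectral radius formula\<close>

lemma norm_powr_of_real: "cmod (z powr of_real h) = cmod z powr h"
  by (cases "z = 0") (simp_all add: powr_def)

lemma ennpowr_mono: "a \<le> b \<Longrightarrow> 0 \<le> r \<Longrightarrow> ennpowr a r \<le> ennpowr b r"
  unfolding ennpowr_def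
  by (auto simp: top_unique less_top[symmetric] intro!: ennreal_leI powr_mono2 enn2real_mono)

lemma Lp_norm_mono_AE:
  assumes u: "(\<lambda>x. cmod (u x)) \<in> borel_measurable lborel" and uv: "AE x in lborel. cmod (u x) \<le> cmod (v x)"
  shows "Lp_norm p u \<le> Lp_norm p v"
proof (cases "p = \<infinity>")
  case True
  have "(\<lambda>x. ennreal (cmod (u x))) \<in> borel_measurable lborel" using u by measurable
  then show ?thesis
    using uv True by (auto simp: Lp_norm_def intro!: esssup_AE_mono ennreal_leI elim: eventually_mono)
next
  case False
  have "(\<integral>\<^sup>+ x. ennreal (cmod (u x) powr enn2real p) \<partial>lborel) \<le> (\<integral>\<^sup>+ x. ennreal (cmod (v x) powr enn2real p) \<partial>lborel)"
    by (intro nn_integral_mono_AE) (use uv in eventually_elim, simp add: ennreal_leI powr_mono2)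
  then show ?thesis using False by (simp add: Lp_norm_def ennpowr_mono)
qed

lemma heis_A_bounds:
  shows "(norm (fst x))\<^sup>2 \<le> 4 * cmod (heis_A x)" and "\<bar>snd x\<bar> \<le> cmod (heis_A x)"
    and "1 \<le> cmod (1 + heis_A x)" and "cmod (heis_A x) \<le> cmod (1 + heis_A x)"
proof -
  have re: "Re (heis_A x) = (norm (fst x))\<^sup>2 / 4" and im: "Im (heis_A x) = snd x" by (simp_all add: heis_A_def)
  show "(norm (fst x))\<^sup>2 \<le> 4 * cmod (heis_A x)" using complex_Re_le_cmod[of "heis_A x"] re by simp
  show "\<bar>snd x\<bar> \<le> cmod (heis_A x)" using abs_Im_le_cmod[of "heis_A x"] im by simp
  show "1 \<le> cmod (1 + heis_A x)" using complex_Re_le_cmod[of "1 + heis_A x"] re by simp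
      (metis add_increasing2 divide_nonneg_nonneg order_refl order_trans zero_le_numeral zero_le_power2)
  show "cmod (heis_A x) \<le> cmod (1 + heis_A x)"
    unfolding cmod_def by (rule real_sqrt_le_mono) (simp add: power2_sum re)
qed

lemma heis_A_continuous: "continuous_on UNIV heis_A"
  unfolding heis_A_def by (intro continuous_intros) auto

lemma heis_A_measurable [measurable]: "heis_A \<in> borel_measurable borel"
  by (rule borel_measurable_continuous_onI[OF heis_A_continuous])

text \<open>Origin of n + 3: 1 + |z|^2 is at most 4(1 + |\<A>|) and is needed to the power n + 1; 1
  + t^2 is at most (1 + |\<A>|)^2.\<close>

lemma heis_weight_integral:
  obtains G where "1 \<le> G" "(\<integral>\<^sup>+ x. ennreal (1 / (1 + cmod (heis_A x)) ^ (CARD('n) + 3)) \<partial>(lborel :: 'n::finite heis measure)) \<le> ennreal G"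
proof -
  let ?n = "CARD('n)"
  let ?P = "\<lambda>x :: 'n heis. 1 / (1 + (norm (fst x))\<^sup>2) ^ (?n + 1) * (1 / (1 + (snd x)\<^sup>2))"
  have "integrable (lborel \<Otimes>\<^sub>M lborel) ?P"
    by (rule integrable_fst_times_snd[OF pair_sigma_finite.intro[OF lborel.sigma_finite_measure_axioms lborel.sigma_finite_measure_axioms] integrable_radial integrable_inverse_1_square])
  then have int: "integrable lborel (\<lambda>x. 4 ^ (?n + 1) * ?P x)" unfolding lborel_prod by (rule integrable_mult_right)
  have le: "1 / (1 + cmod (heis_A x)) ^ (?n + 3) \<le> 4 ^ (?n + 1) * ?P x" for x :: "'n heis"
  proof -
    let ?a = "cmod (heis_A x)"
    have "(1 + (norm (fst x))\<^sup>2) ^ (?n + 1) \<le> (4 * (1 + ?a)) ^ (?n + 1)"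
      using heis_A_bounds(1)[of x] by (intro power_mono) auto
    moreover have "1 + (snd x)\<^sup>2 \<le> (1 + ?a)\<^sup>2"
    proof -
      have "\<bar>snd x\<bar>\<^sup>2 \<le> ?a\<^sup>2" by (rule power_mono[OF heis_A_bounds(2)]) simp
      then show ?thesis unfolding power2_sum power2_abs by simp (metis add_increasing2 mult_nonneg_nonneg norm_ge_zero zero_le_numeral)
    qed
    ultimately have "(1 + (norm (fst x))\<^sup>2) ^ (?n + 1) * (1 + (snd x)\<^sup>2) \<le> (4 * (1 + ?a)) ^ (?n + 1) * (1 + ?a)\<^sup>2"
      by (intro mult_mono) (simp_all add: add_nonneg_nonneg del: power_Suc)
    also have "\<dots> = 4 ^ (?n + 1) * (1 + ?a) ^ (?n + 3)"
      by (simp only: power_mult_distrib mult.assoc power_add[symmetric]) (simp add: numeral_eq_Suc)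
    finally have "(1 + (norm (fst x))\<^sup>2) ^ (?n + 1) * (1 + (snd x)\<^sup>2) \<le> 4 ^ (?n + 1) * (1 + ?a) ^ (?n + 3)" .
    moreover have "1 / b \<le> c * (1 / a)" if "a \<le> c * b" "0 < a" "0 < b" for a b c :: real
      using that by (simp add: divide_simps mult.commute)
    moreover have "0 < (1 + (norm (fst x))\<^sup>2) ^ (?n + 1) * (1 + (snd x)\<^sup>2)" "0 < (1 + ?a) ^ (?n + 3)"
      by (intro mult_pos_pos zero_less_power add_pos_nonneg; simp)+
    ultimately show ?thesis by (metis mult.right_neutral times_divide_times_eq)
  qed
  show ?thesis
  proof (rule that)
    show "1 \<le> max 1 (LINT x|lborel. 4 ^ (?n + 1) * ?P x)" by simp
    have "(\<integral>\<^sup>+ x. ennreal (1 / (1 + cmod (heis_A x)) ^ (?n + 3)) \<partial>(lborel :: 'n heis measure)) \<le> (\<integral>\<^sup>+ x. ennreal (4 ^ (?n + 1) * ?P x) \<partial>lborel)"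
      by (intro nn_integral_mono ennreal_leI le)
    also have "\<dots> = ennreal (LINT x|lborel. 4 ^ (?n + 1) * ?P x)"
      by (intro nn_integral_eq_integral[OF int] AE_I2) simp
    finally show "(\<integral>\<^sup>+ x. ennreal (1 / (1 + cmod (heis_A x)) ^ (?n + 3)) \<partial>(lborel :: 'n heis measure)) \<le> ennreal (max 1 (LINT x|lborel. 4 ^ (?n + 1) * ?P x))"
      by (rule order_trans) (simp add: ennreal_leI)
  qed
qed

text \<open>The constant is uniform in p for two reasons: the inverse weight is at most 1, so its
  r-th power is dominated by the weight itself, and G \<ge> 1 gives G^(1/r) \<le> G.\<close>

lemma Lp_norm_le_weight:
  "\<exists>G>0. \<forall>p D (v :: 'n::finite heis \<Rightarrow> complex). 1 \<le> p \<longrightarrow> 0 \<le> D \<longrightarrow> (\<lambda>x. cmod (v x)) \<in> borel_measurable lborel \<longrightarrow>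
    (\<forall>x. (1 + cmod (heis_A x)) ^ (CARD('n) + 3) * cmod (v x) \<le> D) \<longrightarrow> Lp_norm p v \<le> ennreal (D * G)"
proof -
  let ?W = "\<lambda>x :: 'n heis. 1 / (1 + cmod (heis_A x)) ^ (CARD('n) + 3)"
  obtain G where G: "1 \<le> G" "(\<integral>\<^sup>+ x. ennreal (?W x) \<partial>lborel) \<le> ennreal G"
    by (rule heis_weight_integral[where 'n = 'n])
  have W: "0 < ?W x" "?W x \<le> 1" for x
  proof -
    have "1 \<le> (1 + cmod (heis_A x)) ^ (CARD('n) + 3)" by (rule one_le_power) simp
    moreover have "0 < 1 / t" "1 / t \<le> 1" if "1 \<le> t" for t :: real using that by simp_all
    ultimately show "0 < ?W x" "?W x \<le> 1" by blast+
  qed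
  show ?thesis
  proof (intro exI[of _ G] conjI allI impI)
    show "0 < G" using G by simp
    fix p :: ennreal and D and v :: "'n heis \<Rightarrow> complex"
    assume p: "1 \<le> p" and D: "0 \<le> D" and m: "(\<lambda>x. cmod (v x)) \<in> borel_measurable lborel"
      and "\<forall>x. (1 + cmod (heis_A x)) ^ (CARD('n) + 3) * cmod (v x) \<le> D"
    then have le: "(1 + cmod (heis_A x)) ^ (CARD('n) + 3) * cmod (v x) \<le> D" for x by blast
    have v: "cmod (v x) \<le> D * ?W x" for x
    proof -
      have "0 < (1 + cmod (heis_A x)) ^ (CARD('n) + 3)" by (intro zero_less_power add_pos_nonneg) auto
      then show ?thesis using le[of x] by (simp add: pos_le_divide_eq mult.commute del: power_Suc)
    qed
    show "Lp_norm p v \<le> ennreal (D * G)"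
    proof (cases "p = \<infinity>")
      case True
      have "cmod (v x) \<le> D * G" for x
        using order_trans[OF v mult_left_mono[OF order_trans[OF W(2) G(1)] D]] .
      moreover have "(\<lambda>x. ennreal (cmod (v x))) \<in> borel_measurable lborel" using m by measurable
      ultimately show ?thesis using True by (auto simp: Lp_norm_def intro!: esssup_I ennreal_leI)
    next
      case False
      define r where "r = enn2real p"
      have r: "1 \<le> r" using p False unfolding r_def
        by (metis enn2real_1 enn2real_mono infinity_ennreal_def less_top)
      have "(\<integral>\<^sup>+ x. ennreal (cmod (v x) powr r) \<partial>lborel) \<le> (\<integral>\<^sup>+ x. ennreal (D powr r) * ennreal (?W x) \<partial>lborel)"
      proof (rule nn_integral_mono)
        fix x
        have "cmod (v x) powr r \<le> (D * ?W x) powr r" using v r by (intro powr_mono2) auto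
        also have "\<dots> = D powr r * ?W x powr r" by (rule powr_mult)
        also have "\<dots> \<le> D powr r * ?W x powr 1"
          using r W[of x] by (intro mult_left_mono powr_mono') auto
        also have "\<dots> = D powr r * ?W x" using W(1)[of x] by (simp only: powr_one less_imp_le)
        finally show "ennreal (cmod (v x) powr r) \<le> ennreal (D powr r) * ennreal (?W x)"
          using W(1)[of x] by (simp only: ennreal_mult[symmetric] powr_ge_zero less_imp_le ennreal_leI)
      qed
      also have "\<dots> = ennreal (D powr r) * (\<integral>\<^sup>+ x. ennreal (?W x) \<partial>lborel)"
        by (rule nn_integral_cmult) measurable
      also have "\<dots> \<le> ennreal (D powr r) * ennreal G" by (rule mult_left_mono[OF G(2)]) simp
      also have "\<dots> = ennreal (D powr r * G)" using G by (simp add: ennreal_mult)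
      finally have "ennpowr (\<integral>\<^sup>+ x. ennreal (cmod (v x) powr r) \<partial>lborel) (1 / r) \<le> ennpowr (ennreal (D powr r * G)) (1 / r)"
        using r by (intro ennpowr_mono) auto
      also have "\<dots> = ennreal (D * G powr (1 / r))"
        using r G D by (simp add: ennpowr_def powr_mult powr_powr)
      also have "\<dots> \<le> ennreal (D * G)"
      proof (intro ennreal_leI mult_left_mono D)
        show "G powr (1 / r) \<le> G" using powr_mono[of "1 / r" 1 G] r G by simp
      qed
      finally show ?thesis using False by (simp add: Lp_norm_def r_def)
    qed
  qed
qed

lemma root_tendsto:
  assumes "0 < C" "0 < R" shows "(\<lambda>j. (C * ((1 + real j / R) ^ m * R ^ j)) powr (1 / real j)) \<longlonglongrightarrow> R"
proof -
  have 1: "(\<lambda>j. C powr (1 / real j)) \<longlonglongrightarrow> 1" using assms by real_asymp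
  have 2: "(\<lambda>j. (1 + real j / R) powr (real m / real j)) \<longlonglongrightarrow> 1" using assms by real_asymp
  have "(\<lambda>j. C powr (1 / real j) * ((1 + real j / R) powr (real m / real j) * R)) \<longlonglongrightarrow> 1 * (1 * R)"
    by (intro tendsto_mult 1 2 tendsto_const)
  moreover have "\<forall>\<^sub>F j in sequentially. C powr (1 / real j) * ((1 + real j / R) powr (real m / real j) * R)
      = (C * ((1 + real j / R) ^ m * R ^ j)) powr (1 / real j)"
    using eventually_gt_at_top[of 0]
  proof eventually_elim
    case (elim j)
    have "0 < 1 + real j / R" using assms by (simp add: add_pos_nonneg)
    then have "((1 + real j / R) ^ m) powr (1 / real j) = (1 + real j / R) powr (real m / real j)"
      by (simp add: powr_realpow[symmetric] powr_powr)
    moreover have "(R ^ j) powr (1 / real j) = R"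
      using elim assms by (simp add: powr_realpow[symmetric] powr_powr)
    ultimately show ?case using assms by (simp add: powr_mult)
  qed
  ultimately show ?thesis by (auto elim: Lim_transform_eventually)
qed

lemma sublaplacian_inv_gelfand_measurable:
  assumes "schwartz_fan CARD('n) F"
  shows "(sublaplacian ^^ J) (inv_gelfand F) \<in> borel_measurable (lborel :: 'n::finite heis measure)"
proof -
  obtain f where f: "schwartz f" "\<And>p. p \<in> fan CARD('n) \<Longrightarrow> F p = f p" using assms by (auto simp: schwartz_fan_def)
  note a = adm_schwartz[OF f(1) card_ge_1[where 'n = 'n]]
  have "adm CARD('n) (fan_coeff CARD('n) (\<lambda>p. of_real (fst p ^ J) * f p))"
  proof -
    have "fan_coeff CARD('n) (\<lambda>p. of_real (fst p ^ J) * f p) = (\<lambda>q. of_real (xi CARD('n) q ^ J) * fan_coeff CARD('n) f q)"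
      by (simp add: fun_eq_iff fan_coeff_def xi_def)
    then show ?thesis using sublaplacian_pow_wave[OF a(1), of J] by simp
  qed
  moreover have "(sublaplacian ^^ J) (inv_gelfand F) = (wave 0 (fan_coeff CARD('n) (\<lambda>p. of_real (fst p ^ J) * f p)) :: 'n heis \<Rightarrow> complex)"
    by (rule inv_gelfand_wave_pow[OF a(2) f(2) a(1)])
  ultimately show ?thesis by (simp only: adm_def wave_measurable)
qed

lemma Lp_norm_root_limsup:
  fixes F :: "real \<times> real \<Rightarrow> complex"
  assumes F: "schwartz_fan CARD('n) F" and \<rho>: "rho CARD('n) F < \<infinity>" and p: "1 \<le> p" and h: "0 \<le> h"
  shows "limsup (\<lambda>j. ennpowr (Lp_norm p (\<lambda>x :: 'n::finite heis. (1 + heis_A x) powr of_real h * (sublaplacian ^^ j) (inv_gelfand F) x)) (1 / real j))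
    \<le> rho CARD('n) F"
proof (rule ennreal_le_epsilon)
  let ?n = "CARD('n)"
  fix e :: real assume e: "0 < e"
  define \<rho> where "\<rho> = enn2real (rho ?n F)"
  have rr: "rho ?n F = ennreal \<rho>" unfolding \<rho>_def using \<rho> by simp
  have \<rho>0: "0 \<le> \<rho>" by (simp add: \<rho>_def)
  define R where "R = \<rho> + e"
  have R: "\<rho> < R" "0 < R" using e \<rho>0 by (auto simp: R_def)
  have "fst q \<le> \<rho>" if "q \<in> fan ?n" "F q \<noteq> 0" for q
  proof -
    have "ennreal (fst q) \<le> ennreal \<rho>" unfolding rr[symmetric] rho_def using that by (intro SUP_upper) auto
    then show ?thesis using \<rho>0 by (simp add: ennreal_le_iff)
  qed
  define H where "H = nat \<lceil>h\<rceil>"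
  \<comment> \<open>H powers of 1 + |\<A>| dominate the real power h; the other n + 3 serve
    integrability.\<close>
  let ?k = "H + (?n + 3)"
  let ?v = "\<lambda>j (x :: 'n heis). (1 + heis_A x) powr of_real h * (sublaplacian ^^ j) (inv_gelfand F) x"
  obtain C where C: "0 \<le> C" "\<And>J (x :: 'n heis). (1 + cmod (heis_A x)) ^ ?k * cmod ((sublaplacian ^^ J) (inv_gelfand F) x)
      \<le> C * (1 + real J / R) ^ (2 * ?k) * R ^ J"
    using inv_gelfand_upper_bound[OF F \<open>\<And>q. q \<in> fan ?n \<Longrightarrow> F q \<noteq> 0 \<Longrightarrow> fst q \<le> \<rho>\<close> \<rho>0 R(1), of ?k] by blast
  obtain G where G: "0 < G" "\<And>p D (v :: 'n heis \<Rightarrow> complex). 1 \<le> p \<Longrightarrow> 0 \<le> D \<Longrightarrow> (\<lambda>x. cmod (v x)) \<in> borel_measurable lborel \<Longrightarrow>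
    (\<And>x. (1 + cmod (heis_A x)) ^ (?n + 3) * cmod (v x) \<le> D) \<Longrightarrow> Lp_norm p v \<le> ennreal (D * G)"
    using Lp_norm_le_weight[where 'n = 'n] by blast
  have n: "Lp_norm p (?v j) \<le> ennreal (C * (1 + real j / R) ^ (2 * ?k) * R ^ j * G)" for j
  proof (rule G(2)[OF p])
    show "0 \<le> C * (1 + real j / R) ^ (2 * ?k) * R ^ j" using C(1) R by simp
    note [measurable] = sublaplacian_inv_gelfand_measurable[OF F]
    show "(\<lambda>x. cmod (?v j x)) \<in> borel_measurable lborel"
      unfolding norm_mult norm_powr_of_real by measurable
    fix x :: "'n heis"
    let ?a = "cmod (heis_A x)"
    have "cmod (1 + heis_A x) powr h \<le> (1 + ?a) powr h"
      using norm_triangle_ineq[of 1 "heis_A x"] h by (intro powr_mono2) auto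
    also have "\<dots> \<le> (1 + ?a) powr real H" using h by (intro powr_mono) (auto simp: H_def)
    also have "\<dots> = (1 + ?a) ^ H" by (intro powr_realpow add_pos_nonneg) auto
    finally have "cmod (?v j x) \<le> (1 + ?a) ^ H * cmod ((sublaplacian ^^ j) (inv_gelfand F) x)"
      unfolding norm_mult norm_powr_of_real by (rule mult_right_mono) simp
    then have "(1 + ?a) ^ (?n + 3) * cmod (?v j x) \<le> (1 + ?a) ^ (?n + 3) * ((1 + ?a) ^ H * cmod ((sublaplacian ^^ j) (inv_gelfand F) x))"
      by (rule mult_left_mono) simp
    also have "\<dots> = (1 + ?a) ^ ?k * cmod ((sublaplacian ^^ j) (inv_gelfand F) x)"
      by (simp only: power_add mult_ac)
    also have "\<dots> \<le> C * (1 + real j / R) ^ (2 * ?k) * R ^ j" by (rule C(2))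
    finally show "(1 + ?a) ^ (?n + 3) * cmod (?v j x) \<le> C * (1 + real j / R) ^ (2 * ?k) * R ^ j" .
  qed
  \<comment> \<open>The limit of the roots requires a positive constant; C itself may be 0.\<close>
  define C' where "C' = (C + 1) * G"
  have C': "0 < C'" using C(1) G(1) by (simp add: C'_def)
  \<comment> \<open>This includes j = 0, where 1/0 = 0 by convention and monotonicity holds with
    exponent 0.\<close>
  have n': "ennpowr (Lp_norm p (?v j)) (1 / real j) \<le> ennreal ((C' * ((1 + real j / R) ^ (2 * ?k) * R ^ j)) powr (1 / real j))" for j
  proof -
    have "C * G * ((1 + real j / R) ^ (2 * ?k) * R ^ j) \<le> C' * ((1 + real j / R) ^ (2 * ?k) * R ^ j)"
      unfolding C'_def using R G(1) by (intro mult_right_mono) auto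
    then have "Lp_norm p (?v j) \<le> ennreal (C' * ((1 + real j / R) ^ (2 * ?k) * R ^ j))"
      using order_trans[OF n[of j] ennreal_leI] by (simp only: mult_ac)
    then have "ennpowr (Lp_norm p (?v j)) (1 / real j) \<le> ennpowr (ennreal (C' * ((1 + real j / R) ^ (2 * ?k) * R ^ j))) (1 / real j)"
      by (rule ennpowr_mono) simp
    moreover have "0 \<le> C' * ((1 + real j / R) ^ (2 * ?k) * R ^ j)" using C' R by simp
    ultimately show ?thesis by (simp only: ennpowr_def infinity_ennreal_def ennreal_neq_top if_False enn2real_ennreal)
  qed
  have "limsup (\<lambda>j. ennpowr (Lp_norm p (?v j)) (1 / real j)) \<le> limsup (\<lambda>j. ennreal ((C' * ((1 + real j / R) ^ (2 * ?k) * R ^ j)) powr (1 / real j)))"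
    by (intro Limsup_mono always_eventually allI n')
  also have "\<dots> = ennreal R"
    by (intro lim_imp_Limsup tendsto_ennrealI root_tendsto C' R(2)) simp
  also have "\<dots> = rho ?n F + ennreal e" using e \<rho>0 by (simp add: rr R_def)
  finally show "limsup (\<lambda>j. ennpowr (Lp_norm p (?v j)) (1 / real j)) \<le> rho ?n F + ennreal e" .
qed

text \<open>Each point of the support gives the lower bound r for every r below its \<xi>, since the
  constant c disappears in the root. Density of the order and the supremum over the support give
  \<rho>(F), whether finite or not.\<close>

lemma Lp_norm_root_liminf:
  fixes F :: "real \<times> real \<Rightarrow> complex"
  assumes F: "schwartz_fan CARD('n) F" and p: "1 \<le> p"
  shows "rho CARD('n) F \<le> liminf (\<lambda>j. ennpowr (Lp_norm p ((sublaplacian ^^ j) (inv_gelfand F) :: 'n::finite heis \<Rightarrow> complex)) (1 / real j))"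
    (is "_ \<le> liminf ?N")
  unfolding rho_def
proof (rule SUP_least)
  fix q assume q: "q \<in> {p \<in> fan CARD('n). F p \<noteq> 0}"
  show "ennreal (fst q) \<le> liminf ?N"
  proof (rule dense_le)
    fix y assume y: "y < ennreal (fst q)"
    show "y \<le> liminf ?N"
    proof (cases "y = 0")
      case False
      then obtain r where r: "y = ennreal r" "0 < r" "r < fst q"
        using y by (cases y) (auto simp: ennreal_less_iff)
      obtain c where c: "0 < c" "\<And>J. ennreal (c * r ^ J) \<le> Lp_norm p ((sublaplacian ^^ J) (inv_gelfand F) :: 'n heis \<Rightarrow> complex)"
        using inv_gelfand_lower_bound[OF F _ _ less_imp_le[OF r(2)] r(3)] q p by blast
      \<comment> \<open>The factor with exponent 0 is 1; it brings the bound into the form whose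
        root limit is known.\<close>
      have "ennreal ((c * ((1 + real j / r) ^ 0 * r ^ j)) powr (1 / real j)) \<le> ?N j" for j
      proof -
        have "ennpowr (ennreal (c * r ^ j)) (1 / real j) \<le> ?N j" by (rule ennpowr_mono[OF c(2)]) simp
        then show ?thesis using c(1) r(2) by (simp add: ennpowr_def)
      qed
      then have "liminf (\<lambda>j. ennreal ((c * ((1 + real j / r) ^ 0 * r ^ j)) powr (1 / real j))) \<le> liminf ?N"
        by (intro Liminf_mono always_eventually allI)
      moreover have "liminf (\<lambda>j. ennreal ((c * ((1 + real j / r) ^ 0 * r ^ j)) powr (1 / real j))) = ennreal r"
        by (intro lim_imp_Liminf tendsto_ennrealI root_tendsto c(1) r(2)) simp
      ultimately show ?thesis using r(1) by simp
    qed simp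
  qed
qed

theorem theorem8p9:
  fixes F :: "real \<times> real \<Rightarrow> complex" and g :: "'n::finite heis \<Rightarrow> complex"
  assumes F: "schwartz_fan CARD('n) F"
  defines "g \<equiv> inv_gelfand F"
  shows
    "let C1 = (rho CARD('n) F < \<infinity>);
         C2 = (\<forall>h::real. \<forall>p::ennreal. h \<ge> 0 \<and> p \<ge> 1 \<longrightarrow>
                 limsup (\<lambda>j. ennpowr (Lp_norm p (\<lambda>x. heis_A x powr of_real h * (sublaplacian ^^ j) g x))
                               (1 / real j)) < \<infinity>);
         C3 = (\<exists>p::ennreal. p \<ge> 1 \<and>
                 liminf (\<lambda>j. ennpowr (Lp_norm p ((sublaplacian ^^ j) g)) (1 / real j)) < \<infinity>)
     in (C1 \<longleftrightarrow> C2) \<and> (C2 \<longleftrightarrow> C3) \<and>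
        (C1 \<or> C2 \<or> C3 \<longrightarrow>
           (\<forall>h::real. \<forall>p::ennreal. h \<ge> 0 \<and> p \<ge> 1 \<longrightarrow>
              (\<lambda>j. ennpowr (Lp_norm p (\<lambda>x. (1 + heis_A x) powr of_real h * (sublaplacian ^^ j) g x))
                     (1 / real j)) \<longlonglongrightarrow> rho CARD('n) F))"
proof -
  let ?n = "CARD('n)"
  let ?u = "\<lambda>j. (sublaplacian ^^ j) g"
  let ?a = "\<lambda>h j (x :: 'n heis). heis_A x powr of_real h * ?u j x"
  let ?b = "\<lambda>h j (x :: 'n heis). (1 + heis_A x) powr of_real h * ?u j x"
  let ?N = "\<lambda>p v j. ennpowr (Lp_norm p (v j)) (1 / real j)"
  define C1 C2 C3 where "C1 \<longleftrightarrow> rho ?n F < \<infinity>"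
    and "C2 \<longleftrightarrow> (\<forall>h::real. \<forall>p::ennreal. h \<ge> 0 \<and> p \<ge> 1 \<longrightarrow> limsup (?N p (?a h)) < \<infinity>)"
    and "C3 \<longleftrightarrow> (\<exists>p::ennreal. p \<ge> 1 \<and> liminf (?N p ?u) < \<infinity>)"
  note [measurable] = sublaplacian_inv_gelfand_measurable[OF F, folded g_def]
  have upper: "limsup (?N p (?b h)) \<le> rho ?n F" if C1 "1 \<le> p" "0 \<le> h" for p h
    using Lp_norm_root_limsup[OF F _ that(2,3)] that(1) unfolding g_def C1_def .
  have lower: "rho ?n F \<le> liminf (?N p ?u)" if "1 \<le> p" for p
    using Lp_norm_root_liminf[OF F that] unfolding g_def .
  have ab: "?N p (?a h) j \<le> ?N p (?b h) j" if "0 \<le> h" for h p j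
  proof (intro ennpowr_mono Lp_norm_mono_AE AE_I2)
    show "(\<lambda>x. cmod (?a h j x)) \<in> borel_measurable lborel"
      unfolding norm_mult norm_powr_of_real by measurable
    show "cmod (?a h j x) \<le> cmod (?b h j x)" for x :: "'n heis"
      unfolding norm_mult norm_powr_of_real using that heis_A_bounds(4)[of x] by (intro mult_right_mono powr_mono2) auto
  qed simp
  \<comment> \<open>The modulus of 1 + \<A> is at least 1, so this weight can only increase the
    norm. The lower bound for unweighted norms thus passes to every h.\<close>
  have ub: "?N p ?u j \<le> ?N p (?b h) j" if "0 \<le> h" for h p j
  proof (intro ennpowr_mono Lp_norm_mono_AE AE_I2)
    show "(\<lambda>x. cmod (?u j x)) \<in> borel_measurable lborel" by measurable
    fix x :: "'n heis"
    have "1 \<le> cmod (1 + heis_A x) powr h" using heis_A_bounds(3)[of x] that by (rule ge_one_powr_ge_zero)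
    then show "cmod (?u j x) \<le> cmod (?b h j x)"
      unfolding norm_mult norm_powr_of_real using mult_right_mono[of 1 _ "cmod (?u j x)"] by simp
  qed simp
  \<comment> \<open>For h = 0 the power of \<A> is 1 except at the origin, where 0 powr 0 = 0. Hence
    the comparison holds only almost everywhere.\<close>
  have ua: "?N p ?u j \<le> ?N p (?a 0) j" for p j
  proof (intro ennpowr_mono Lp_norm_mono_AE)
    show "(\<lambda>x. cmod (?u j x)) \<in> borel_measurable lborel" by measurable
    have "AE x in lborel. x \<noteq> (0 :: 'n heis)" by (rule AE_lborel_singleton)
    then show "AE x in lborel. cmod (?u j x) \<le> cmod (?a 0 j x)"
    proof eventually_elim
      case (elim x)
      then have "heis_A x \<noteq> 0" using heis_A_bounds(1,2)[of x] by (auto simp: prod_eq_iff)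
      then show ?case by simp
    qed
  qed simp
  have 12: C2 if C1
    unfolding C2_def
  proof (intro allI impI, elim conjE)
    fix h :: real and p :: ennreal assume h: "0 \<le> h" "1 \<le> p"
    have "limsup (?N p (?a h)) \<le> limsup (?N p (?b h))" by (intro Limsup_mono always_eventually allI ab h)
    also have "\<dots> \<le> rho ?n F" by (rule upper[OF that h(2,1)])
    also have "\<dots> < \<infinity>" using that by (simp add: C1_def)
    finally show "limsup (?N p (?a h)) < \<infinity>" .
  qed
  have 23: C3 if C2
    unfolding C3_def
  \<comment> \<open>Any exponent would do; p = 1 and h = 0 are taken.\<close>
  proof (intro exI conjI)
    show "(1 :: ennreal) \<ge> 1" by simp
    have "liminf (?N 1 ?u) \<le> limsup (?N 1 ?u)" by (rule Liminf_le_Limsup) simp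
    also have "\<dots> \<le> limsup (?N 1 (?a 0))" by (intro Limsup_mono always_eventually allI ua)
    also have "\<dots> < \<infinity>" using that unfolding C2_def by (blast intro: order_refl)
    finally show "liminf (?N 1 ?u) < \<infinity>" .
  qed
  have 31: C1 if C3
    using that lower unfolding C3_def C1_def by (meson le_less_trans)
  have lim: "?N p (?b h) \<longlonglongrightarrow> rho ?n F" if C1 "0 \<le> h" "1 \<le> p" for h p
  proof -
    have "rho ?n F \<le> liminf (?N p ?u)" by (rule lower[OF that(3)])
    also have "\<dots> \<le> liminf (?N p (?b h))" by (intro Liminf_mono always_eventually allI ub that)
    finally have 1: "rho ?n F \<le> liminf (?N p (?b h))" .
    have 2: "limsup (?N p (?b h)) \<le> rho ?n F" by (rule upper[OF that(1,3,2)])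
    have "liminf (?N p (?b h)) \<le> limsup (?N p (?b h))" by (rule Liminf_le_Limsup) simp
    then show ?thesis using 1 2 by (intro Liminf_eq_Limsup) auto
  qed
  have "(C1 \<longleftrightarrow> C2) \<and> (C2 \<longleftrightarrow> C3) \<and> (C1 \<or> C2 \<or> C3 \<longrightarrow> (\<forall>h p. h \<ge> 0 \<and> p \<ge> 1 \<longrightarrow> ?N p (?b h) \<longlonglongrightarrow> rho ?n F))"
    using 12 23 31 lim by blast
  then show ?thesis unfolding Let_def C1_def C2_def C3_def .
qed

end
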